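(* \textsc{Offensive Alliance} on signed graphs is fixed-parameter tractable when parameterized by the signed neighborhood diversity $\textsf{snd}(G)$ of the input signed graph $G$.
   Context: A signed graph is a triple $G=(V,E^+,E^-)$ with $V$ finite, $E^+,E^-\subseteq\binom{V}{2}$ and $E^+\cap E^-=\emptyset$. $N^+(v)=\{u: uv\in E^+\}$, $N^-(v)=\{u: uv\in E^-\}$, $N(v)=N^+(v)\cup N^-(v)$. For $X\subseteq V$, $\deg^+_X(v)=|N^+(v)\cap X|$, $\deg^-_X(v)=|N^-(v)\cap X|$, $\overline{X}=V\setminus X$. For $S\subseteq V$, $\partial S=\left(\bigcup_{u\in S}N(u)\right)\setminus S$. A set $S\subseteq V$ is an offensive alliance if for every $w\in\partial S$: (1) $\deg^-_S(w)\geq \deg^+_S(w)$ and (2) $\deg^-_S(w)\geq \deg^+_{\overline S}(w)+1$. \textsc{Offensive Alliance}: given a signed graph $G$ and an integer $k\geq 1$, decide whether $G$ has an offensive alliance $S$ with $1\leq|S|\leq k$. The signed neighborhood diversity $\textsf{snd}(G)$ is the least integer $k$ such that $V$ can be partitioned into $k$ classes where, for each class $C$ and any $u,v\in C$, $N^+(v)\setminus\{u\}=N^+(u)\setminus\{v\}$ and $N^-(v)\setminus\{u\}=N^-(u)\setminus\{v\}$. *)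

theory Defs
  imports "HOL-Library.Disjoint_Sets" "HOL-Library.Log_Nat"
begin

section \<open>Signed graphs and offensive alliances\<close>

record 'a sgraph =
  verts :: "'a set"
  pos_edges :: "'a set set"
  neg_edges :: "'a set set"

definition signed_graph :: "'a sgraph \<Rightarrow> bool" where
  "signed_graph G \<longleftrightarrow>
     finite (verts G) \<and>
     pos_edges G \<subseteq> {e. e \<subseteq> verts G \<and> card e = 2} \<and>
     neg_edges G \<subseteq> {e. e \<subseteq> verts G \<and> card e = 2} \<and>
     pos_edges G \<inter> neg_edges G = {}"

definition pos_nbrs :: "'a sgraph \<Rightarrow> 'a \<Rightarrow> 'a set" where
  "pos_nbrs G v = {u. {u, v} \<in> pos_edges G}"

definition neg_nbrs :: "'a sgraph \<Rightarrow> 'a \<Rightarrow> 'a set" where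
  "neg_nbrs G v = {u. {u, v} \<in> neg_edges G}"

definition nbrs :: "'a sgraph \<Rightarrow> 'a \<Rightarrow> 'a set" where
  "nbrs G v = pos_nbrs G v \<union> neg_nbrs G v"

definition pos_deg :: "'a sgraph \<Rightarrow> 'a set \<Rightarrow> 'a \<Rightarrow> nat" where
  "pos_deg G X v = card (pos_nbrs G v \<inter> X)"

definition neg_deg :: "'a sgraph \<Rightarrow> 'a set \<Rightarrow> 'a \<Rightarrow> nat" where
  "neg_deg G X v = card (neg_nbrs G v \<inter> X)"

definition boundary :: "'a sgraph \<Rightarrow> 'a set \<Rightarrow> 'a set" where
  "boundary G S = (\<Union>u\<in>S. nbrs G u) - S"

definition offensive_alliance :: "'a sgraph \<Rightarrow> 'a set \<Rightarrow> bool" where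
  "offensive_alliance G S \<longleftrightarrow>
     S \<subseteq> verts G \<and>
     (\<forall>w\<in>boundary G S.
        neg_deg G S w \<ge> pos_deg G S w \<and>
        neg_deg G S w \<ge> pos_deg G (verts G - S) w + 1)"

definition same_signed_type :: "'a sgraph \<Rightarrow> 'a \<Rightarrow> 'a \<Rightarrow> bool" where
  "same_signed_type G u v \<longleftrightarrow>
     pos_nbrs G v - {u} = pos_nbrs G u - {v} \<and>
     neg_nbrs G v - {u} = neg_nbrs G u - {v}"

definition signed_neighborhood_diversity :: "'a sgraph \<Rightarrow> nat" where
  "signed_neighborhood_diversity G =
     (LEAST k. \<exists>P. partition_on (verts G) P \<and> card P = k \<and>
        (\<forall>C\<in>P. \<forall>u\<in>C. \<forall>v\<in>C. same_signed_type G u v))"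


section \<open>A random access machine\<close>

text \<open>
  Programs are while-programs over natural-number registers and finitely many (per program)
  arrays of natural numbers with indirect addressing. The arithmetic is addition and truncated
  subtraction only. Every evaluated operation costs one time unit. As there is no unit-cost
  multiplication, numbers grow by at most one bit per operation, and the model simulates, and is
  simulated by, a multitape Turing machine with polynomial overhead in time.
\<close>

datatype expr =
    Num nat
  | Reg nat
  | Arr nat expr
  | Plus expr expr
  | Minus expr expr

datatype prog =
    Skip
  | Assign nat expr
  | Store nat expr expr
  | Seq prog prog
  | Cond expr prog prog
  | While expr prog

record state =
  regs :: "nat \<Rightarrow> nat"
  arrs :: "nat \<Rightarrow> nat \<Rightarrow> nat"

fun eval_expr :: "state \<Rightarrow> expr \<Rightarrow> nat" where
  "eval_expr s (Num n) = n"
| "eval_expr s (Reg x) = regs s x"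
| "eval_expr s (Arr a e) = arrs s a (eval_expr s e)"
| "eval_expr s (Plus e f) = eval_expr s e + eval_expr s f"
| "eval_expr s (Minus e f) = eval_expr s e - eval_expr s f"

fun cost :: "expr \<Rightarrow> nat" where
  "cost (Num n) = 1"
| "cost (Reg x) = 1"
| "cost (Arr a e) = 1 + cost e"
| "cost (Plus e f) = 1 + cost e + cost f"
| "cost (Minus e f) = 1 + cost e + cost f"

definition set_reg :: "nat \<Rightarrow> nat \<Rightarrow> state \<Rightarrow> state" where
  "set_reg x v s = s\<lparr>regs := (regs s)(x := v)\<rparr>"

definition set_arr :: "nat \<Rightarrow> nat \<Rightarrow> nat \<Rightarrow> state \<Rightarrow> state" where
  "set_arr a i v s = s\<lparr>arrs := (arrs s)(a := (arrs s a)(i := v))\<rparr>"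

text \<open>
  \<open>exec p s t s'\<close>: started in \<open>s\<close>, the program \<open>p\<close> halts in \<open>s'\<close> after exactly \<open>t\<close> time units.
  Guards count as true when they are nonzero.
\<close>

inductive exec :: "prog \<Rightarrow> state \<Rightarrow> nat \<Rightarrow> state \<Rightarrow> bool" where
  Skip: "exec Skip s 1 s"
| Assign: "exec (Assign x e) s (1 + cost e) (set_reg x (eval_expr s e) s)"
| Store: "exec (Store a i e) s (1 + cost i + cost e)
            (set_arr a (eval_expr s i) (eval_expr s e) s)"
| Seq: "exec p s t s' \<Longrightarrow> exec q s' t' s'' \<Longrightarrow> exec (Seq p q) s (t + t') s''"
| CondTrue: "eval_expr s b \<noteq> 0 \<Longrightarrow> exec p s t s' \<Longrightarrow> exec (Cond b p q) s (1 + cost b + t) s'"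
| CondFalse: "eval_expr s b = 0 \<Longrightarrow> exec q s t s' \<Longrightarrow> exec (Cond b p q) s (1 + cost b + t) s'"
| WhileFalse: "eval_expr s b = 0 \<Longrightarrow> exec (While b p) s (1 + cost b) s"
| WhileTrue: "eval_expr s b \<noteq> 0 \<Longrightarrow> exec p s t s' \<Longrightarrow> exec (While b p) s' t' s'' \<Longrightarrow>
    exec (While b p) s (1 + cost b + t + t') s''"

inductive_cases SkipE: "exec Skip s t s'"
inductive_cases AssignE: "exec (Assign x e) s t s'"
inductive_cases StoreE: "exec (Store a i e) s t s'"
inductive_cases SeqE: "exec (Seq p q) s t s'"
inductive_cases CondE: "exec (Cond b p q) s t s'"
inductive_cases WhileE: "exec (While b p) s t s'"

lemma exec_deterministic:
  "exec p s t s' \<Longrightarrow> exec p s u s'' \<Longrightarrow> t = u \<and> s' = s''"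
proof (induction arbitrary: u s'' rule: exec.induct)
  case (Skip s)
  from Skip.prems show ?case by (rule SkipE) simp
next
  case (Assign x e s)
  from Assign.prems show ?case by (rule AssignE) simp
next
  case (Store a i e s)
  from Store.prems show ?case by (rule StoreE) simp
next
  case (Seq p s t s' q t' s2)
  from Seq.prems show ?case
  proof (rule SeqE)
    fix t1 s1 t2
    assume *: "u = t1 + t2" "exec p s t1 s1" "exec q s1 t2 s''"
    from Seq.IH(1)[OF *(2)] have "t = t1" "s' = s1" by simp_all
    with Seq.IH(2) * show ?thesis by simp
  qed
next
  case (CondTrue s b p t s' q)
  from CondTrue.prems show ?case
  proof (rule CondE)
    fix t1
    assume *: "u = Suc (cost b + t1)" "exec p s t1 s''"
    from CondTrue.IH[OF *(2)] *(1) show ?thesis by simp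
  next
    assume "eval_expr s b = 0"
    with CondTrue.hyps show ?thesis by simp
  qed
next
  case (CondFalse s b q t s' p)
  from CondFalse.prems show ?case
  proof (rule CondE)
    assume "eval_expr s b > 0"
    with CondFalse.hyps show ?thesis by simp
  next
    fix t1
    assume *: "u = Suc (cost b + t1)" "exec q s t1 s''"
    from CondFalse.IH[OF *(2)] *(1) show ?thesis by simp
  qed
next
  case (WhileFalse s b p)
  from WhileFalse.prems show ?case
  proof (rule WhileE)
    assume "eval_expr s b > 0"
    with WhileFalse.hyps show ?thesis by simp
  qed simp
next
  case (WhileTrue s b p t s' t' s2)
  from WhileTrue.prems show ?case
  proof (rule WhileE)
    assume "eval_expr s b = 0"
    with WhileTrue.hyps show ?thesis by simp
  next
    fix t1 s1 t2
    assume *: "u = Suc (cost b + t1 + t2)" "exec p s t1 s1" "exec (While b p) s1 t2 s''"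
    from WhileTrue.IH(1)[OF *(2)] have "t = t1" "s' = s1" by simp_all
    with WhileTrue.IH(2) * show ?thesis by simp
  qed
qed

text \<open>
  The input word is placed in array 0 and its length in register 0. Everything else is zero.
  The output is read from register 0.
\<close>

definition init_state :: "nat list \<Rightarrow> state" where
  "init_state w =
     \<lparr>regs = (\<lambda>_. 0)(0 := length w),
      arrs = (\<lambda>_ _. 0)(0 := (\<lambda>i. if i < length w then w ! i else 0))\<rparr>"

definition result :: "state \<Rightarrow> nat" where
  "result s = regs s 0"

definition computable :: "(nat \<Rightarrow> nat) \<Rightarrow> bool" where
  "computable f \<longleftrightarrow>
     (\<exists>p. \<forall>n. \<exists>t s. exec p (init_state [n]) t s \<and> result s = f n)"


section \<open>Fixed-parameter tractability\<close>

text \<open>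
  The size of an input word is its number of bits, with one additional unit per number
  (\<open>floorlog 2 x\<close> is the length of the binary representation of \<open>x\<close>).
\<close>

definition input_size :: "nat list \<Rightarrow> nat" where
  "input_size w = (\<Sum>x\<leftarrow>w. 1 + floorlog 2 x)"

text \<open>
  A parameterized problem is given by its set of instances, the words encoding an instance
  (an instance may have several encodings, and the algorithm has to be correct on each of them),
  the question, and the parameter. The algorithm is not given the value of the parameter.
\<close>

definition fixed_parameter_tractable ::
  "'i set \<Rightarrow> ('i \<Rightarrow> nat list set) \<Rightarrow> ('i \<Rightarrow> bool) \<Rightarrow> ('i \<Rightarrow> nat) \<Rightarrow> bool" where
  "fixed_parameter_tractable inst enc question param \<longleftrightarrow>
     (\<exists>p f c. computable f \<and>
        (\<forall>x\<in>inst. \<forall>w\<in>enc x. \<exists>t s.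
           exec p (init_state w) t s \<and>
           (result s \<noteq> 0 \<longleftrightarrow> question x) \<and>
           t \<le> f (param x) * input_size w ^ c))"


section \<open>The problem Offensive Alliance\<close>

definition oa_instances :: "('a sgraph \<times> nat) set" where
  "oa_instances = {(G, k). signed_graph G \<and> k \<ge> 1}"

definition oa_question :: "'a sgraph \<times> nat \<Rightarrow> bool" where
  "oa_question = (\<lambda>(G, k). \<exists>S. offensive_alliance G S \<and> 1 \<le> card S \<and> card S \<le> k)"

definition edge_sign :: "'a sgraph \<Rightarrow> 'a \<Rightarrow> 'a \<Rightarrow> nat" where
  "edge_sign G u v =
     (if {u, v} \<in> pos_edges G then 1 else if {u, v} \<in> neg_edges G then 2 else 0)"

text \<open>
  An instance is encoded by \<open>k\<close>, the number of vertices, and the signed adjacency matrix, row by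
  row, with respect to an arbitrary enumeration of the vertices.
\<close>

definition oa_encodings :: "'a sgraph \<times> nat \<Rightarrow> nat list set" where
  "oa_encodings = (\<lambda>(G, k).
     {k # length vs # concat (map (\<lambda>u. map (edge_sign G u) vs) vs) | vs.
        distinct vs \<and> set vs = verts G})"

end

theory Submission
  imports Defs
begin

text \<open>
  Vertices of equal signed type are interchangeable, so a set is described by the number of its
  members in each class, and being an offensive alliance of size at most \<open>k\<close> amounts to the signs of
  boundedly many linear forms with small coefficients in these numbers, the class sizes and
  \<open>min n k\<close>. No integer programming is needed to decide whether suitable numbers exist. Read all
  numbers in binary, most significant digit first. Each digit doubles the value of every form and
  changes it by an amount that is bounded in terms of the number of classes, so a value exceeding
  that bound in modulus never changes its sign again and may be truncated. Hence a table of the reachable vectors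
  of truncated values, one for each prefix length, decides the problem.

  To obtain a program, terms with bounded sums are compiled to the machine, and the algorithm is
  written as a sequence of array definitions, each given by a term that may refer to earlier entries.
\<close>

section \<open>Bounded terms on the machine\<close>

text \<open>The obvious table over all vectors of class counts has about n^d entries, a degree that
  grows with the parameter. Truncating the values of the forms instead of the counts makes the
  number of states depend on the number d of classes alone. For this, class sizes and budget must
  not occur as coefficients or constants, where their size would enter the truncation bound: they
  are further columns, whose known digits are read along with those of the counts. Reading n digits
  is enough because every number involved is at most n < 2^n; this is also why the budget is cut at
  n, as k may be exponential in the input length. The algorithm never learns the parameter: it
  computes its own classes, of which there are at most as many as the signed neighborhood diversity.
  Time is polynomial in a single loop bound M, with a degree fixed by the program, and M is linear
  in n for fixed d. The dependence on d is finally relaxed to a double exponential, since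
  tractability asks for a bound that the machine itself computes.\<close>

definition run :: "prog \<Rightarrow> state \<Rightarrow> nat \<Rightarrow> (state \<Rightarrow> bool) \<Rightarrow> bool" where
  "run p s T Q \<longleftrightarrow> (\<exists>t s'. exec p s t s' \<and> t \<le> T \<and> Q s')"

lemma run_mono:
  "run p s T Q \<Longrightarrow> T \<le> T' \<Longrightarrow> (\<And>s'. Q s' \<Longrightarrow> Q' s') \<Longrightarrow> run p s T' Q'"
  unfolding run_def by (meson le_trans)

lemma run_Assign: "1 + cost e \<le> T \<Longrightarrow> Q (set_reg x (eval_expr s e) s) \<Longrightarrow> run (Assign x e) s T Q"
  unfolding run_def using exec.Assign by blast

lemma run_Store:
  "1 + cost i + cost e \<le> T \<Longrightarrow> Q (set_arr a (eval_expr s i) (eval_expr s e) s) \<Longrightarrow>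
    run (Store a i e) s T Q"
  unfolding run_def using exec.Store by blast

lemma run_Seq:
  assumes "run p s T1 (\<lambda>s'. run q s' T2 Q)" "T1 + T2 \<le> T"
  shows "run (Seq p q) s T Q"
proof -
  obtain t s' where p: "exec p s t s'" "t \<le> T1" "run q s' T2 Q"
    using assms(1) unfolding run_def by blast
  then obtain t' s'' where q: "exec q s' t' s''" "t' \<le> T2" "Q s''"
    unfolding run_def by blast
  have "exec (Seq p q) s (t + t') s''" using p q exec.Seq by blast
  moreover have "t + t' \<le> T" using p q assms(2) by linarith
  ultimately show ?thesis using q(3) unfolding run_def by blast
qed

text \<open>Indexing the invariant by the number of completed iterations fixes that number to
  exactly \<open>N\<close>, so termination comes along. The final \<open>1 + cost b\<close> pays for
  the failing guard.\<close>

lemma run_While: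
  assumes I: "I (0::nat) s"
    and step: "\<And>j s. j < N \<Longrightarrow> I j s \<Longrightarrow> eval_expr s b \<noteq> 0 \<and> run p s T (I (Suc j))"
    and exit: "\<And>s. I N s \<Longrightarrow> eval_expr s b = 0"
    and T': "N * (1 + cost b + T) + 1 + cost b \<le> T'"
  shows "run (While b p) s T' (I N)"
proof -
  have "run (While b p) s ((N - j) * (1 + cost b + T) + 1 + cost b) (I N)"
    if "j \<le> N" "I j s" for j s
    using that
  proof (induction "N - j" arbitrary: j s)
    case 0
    then have "eval_expr s b = 0" "I N s" "N - j = 0" using exit by auto
    then show ?case unfolding run_def using exec.WhileFalse[of s b p] by auto
  next
    case (Suc k)
    then have j: "j < N" by simp
    then obtain t s' where p: "exec p s t s'" "t \<le> T" "I (Suc j) s'" and b: "eval_expr s b \<noteq> 0"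
      using step[OF j Suc.prems(2)] unfolding run_def by blast
    have "run (While b p) s' ((N - Suc j) * (1 + cost b + T) + 1 + cost b) (I N)"
      using Suc.hyps j p(3) by simp
    then obtain t' s'' where w: "exec (While b p) s' t' s''"
      "t' \<le> (N - Suc j) * (1 + cost b + T) + 1 + cost b" "I N s''"
      unfolding run_def by blast
    have "exec (While b p) s (1 + cost b + t + t') s''"
      using exec.WhileTrue[OF b p(1) w(1)] .
    moreover have "1 + cost b + t + t' \<le> (N - j) * (1 + cost b + T) + 1 + cost b"
    proof -
      have "N - j = Suc (N - Suc j)" using j by simp
      then show ?thesis using w(2) p(2) by simp
    qed
    ultimately show ?case using w(3) unfolding run_def by blast
  qed
  from this[of 0 s] I T' show ?thesis by (auto intro: run_mono)
qed

lemma regs_set_reg [simp]: "regs (set_reg x v s) y = (if y = x then v else regs s y)"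
  and arrs_set_reg [simp]: "arrs (set_reg x v s) = arrs s"
  and regs_set_arr [simp]: "regs (set_arr a i v s) = regs s"
  and arrs_set_arr [simp]: "arrs (set_arr a i v s) c j = (if c = a \<and> j = i then v else arrs s c j)"
  by (auto simp: set_reg_def set_arr_def)

section \<open>Arithmetic terms with bounded sums and their compilation\<close>

datatype tm =
    C nat
  | V nat
  | A nat tm
  | Add tm tm
  | Sub tm tm
  | Mul tm tm
  | Div tm tm
  | Sm nat tm tm

fun tev :: "(nat \<Rightarrow> nat \<Rightarrow> nat) \<Rightarrow> (nat \<Rightarrow> nat) \<Rightarrow> tm \<Rightarrow> nat" where
  "tev \<alpha> \<rho> (C k) = k"
| "tev \<alpha> \<rho> (V x) = \<rho> x"
| "tev \<alpha> \<rho> (A a t) = \<alpha> a (tev \<alpha> \<rho> t)"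
| "tev \<alpha> \<rho> (Add s t) = tev \<alpha> \<rho> s + tev \<alpha> \<rho> t"
| "tev \<alpha> \<rho> (Sub s t) = tev \<alpha> \<rho> s - tev \<alpha> \<rho> t"
| "tev \<alpha> \<rho> (Mul s t) = tev \<alpha> \<rho> s * tev \<alpha> \<rho> t"
| "tev \<alpha> \<rho> (Div s t) = tev \<alpha> \<rho> s div tev \<alpha> \<rho> t"
| "tev \<alpha> \<rho> (Sm x b t) = (\<Sum>v<tev \<alpha> \<rho> b. tev \<alpha> (\<rho>(x := v)) t)"

text \<open>Multiplication, division and summation are compiled to loops. The predicate below bounds
  the number of iterations of each of them by \<open>M\<close>; the size of other values does not matter,
  since addition has unit cost.\<close>

fun ok :: "nat \<Rightarrow> (nat \<Rightarrow> nat \<Rightarrow> nat) \<Rightarrow> (nat \<Rightarrow> nat) \<Rightarrow> tm \<Rightarrow> bool" where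
  "ok M \<alpha> \<rho> (C k) = True"
| "ok M \<alpha> \<rho> (V x) = True"
| "ok M \<alpha> \<rho> (A a t) = ok M \<alpha> \<rho> t"
| "ok M \<alpha> \<rho> (Add s t) = (ok M \<alpha> \<rho> s \<and> ok M \<alpha> \<rho> t)"
| "ok M \<alpha> \<rho> (Sub s t) = (ok M \<alpha> \<rho> s \<and> ok M \<alpha> \<rho> t)"
| "ok M \<alpha> \<rho> (Mul s t) = (ok M \<alpha> \<rho> s \<and> ok M \<alpha> \<rho> t \<and> tev \<alpha> \<rho> s \<le> M)"
| "ok M \<alpha> \<rho> (Div s t) =
    (ok M \<alpha> \<rho> s \<and> ok M \<alpha> \<rho> t \<and> tev \<alpha> \<rho> s \<le> M \<and> 0 < tev \<alpha> \<rho> t)"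
| "ok M \<alpha> \<rho> (Sm x b t) =
    (ok M \<alpha> \<rho> b \<and> tev \<alpha> \<rho> b \<le> M \<and> (\<forall>v<tev \<alpha> \<rho> b. ok M \<alpha> (\<rho>(x := v)) t))"

text \<open>Variable \<open>x\<close> lives in register \<open>2 * x\<close>; the odd registers are used as a stack.\<close>

definition tmp :: "nat \<Rightarrow> nat" where "tmp i = 2 * i + 1"

lemma tmp_neq_even [simp]: "tmp i \<noteq> 2 * j" "2 * j \<noteq> tmp i" "tmp i \<noteq> 0"
  and tmp_eq_iff [simp]: "tmp i = tmp j \<longleftrightarrow> i = j"
  unfolding tmp_def by presburger+

text \<open>The result goes to \<open>tmp n\<close>, and the stack below \<open>n\<close> is left
  alone. A sum saves the old value of its variable in \<open>tmp (n + 2)\<close>, since the variable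
  register itself is the loop counter. The guard of the division loop is nonzero exactly when the
  divisor can be subtracted once more.\<close>

fun compile :: "nat \<Rightarrow> tm \<Rightarrow> prog" where
  "compile n (C k) = Assign (tmp n) (Num k)"
| "compile n (V x) = Assign (tmp n) (Reg (2 * x))"
| "compile n (A a t) = Seq (compile n t) (Assign (tmp n) (Arr a (Reg (tmp n))))"
| "compile n (Add s t) = Seq (compile n s) (Seq (compile (n + 1) t)
    (Assign (tmp n) (Plus (Reg (tmp n)) (Reg (tmp (n + 1))))))"
| "compile n (Sub s t) = Seq (compile n s) (Seq (compile (n + 1) t)
    (Assign (tmp n) (Minus (Reg (tmp n)) (Reg (tmp (n + 1))))))"
| "compile n (Mul s t) = Seq (compile n s) (Seq (compile (n + 1) t) (Seq (Assign (tmp (n + 2)) (Num 0))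
    (Seq (While (Reg (tmp n))
       (Seq (Assign (tmp (n + 2)) (Plus (Reg (tmp (n + 2))) (Reg (tmp (n + 1)))))
            (Assign (tmp n) (Minus (Reg (tmp n)) (Num 1)))))
     (Assign (tmp n) (Reg (tmp (n + 2)))))))"
| "compile n (Div s t) = Seq (compile n s) (Seq (compile (n + 1) t) (Seq (Assign (tmp (n + 2)) (Num 0))
    (Seq (While (Minus (Plus (Reg (tmp n)) (Num 1)) (Reg (tmp (n + 1))))
       (Seq (Assign (tmp (n + 2)) (Plus (Reg (tmp (n + 2))) (Num 1)))
            (Assign (tmp n) (Minus (Reg (tmp n)) (Reg (tmp (n + 1)))))))
     (Assign (tmp n) (Reg (tmp (n + 2)))))))"
| "compile n (Sm x b t) = Seq (compile n b) (Seq (Assign (tmp (n + 1)) (Num 0))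
    (Seq (Assign (tmp (n + 2)) (Reg (2 * x))) (Seq (Assign (2 * x) (Num 0))
    (Seq (While (Minus (Reg (tmp n)) (Reg (2 * x)))
       (Seq (compile (n + 3) t)
       (Seq (Assign (tmp (n + 1)) (Plus (Reg (tmp (n + 1))) (Reg (tmp (n + 3)))))
            (Assign (2 * x) (Plus (Reg (2 * x)) (Num 1))))))
     (Seq (Assign (tmp n) (Reg (tmp (n + 1))))
          (Assign (2 * x) (Reg (tmp (n + 2)))))))))"

text \<open>Each sum multiplies the cost of its body by \<open>M\<close>, so a fixed term has a cost
  polynomial in \<open>M\<close> whose degree depends on the term only.\<close>

fun tc :: "tm \<Rightarrow> nat \<Rightarrow> nat" where
  "tc (C k) M = 2"
| "tc (V x) M = 2"
| "tc (A a t) M = tc t M + 3"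
| "tc (Add s t) M = tc s M + tc t M + 4"
| "tc (Sub s t) M = tc s M + tc t M + 4"
| "tc (Mul s t) M = tc s M + tc t M + M * 20 + 20"
| "tc (Div s t) M = tc s M + tc t M + M * 20 + 20"
| "tc (Sm x b t) M = tc b M + M * (tc t M + 20) + 20"

text \<open>Besides the result this is a frame condition: all variables survive, and so do the
  operands already evaluated, which lie below \<open>n\<close> on the stack.\<close>

definition post :: "nat \<Rightarrow> nat \<Rightarrow> state \<Rightarrow> state \<Rightarrow> bool" where
  "post n v s s' \<longleftrightarrow> arrs s' = arrs s \<and> regs s' (tmp n) = v \<and>
     (\<forall>i. regs s' (2 * i) = regs s (2 * i)) \<and> (\<forall>i<n. regs s' (tmp i) = regs s (tmp i))"

abbreviation vars :: "state \<Rightarrow> nat \<Rightarrow> nat" where "vars s \<equiv> \<lambda>x. regs s (2 * x)"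

text \<open>The common prefix of the four binary operators. The induction hypotheses are assumptions
  because the rule is applied inside the induction over terms.\<close>

lemma run_compile2:
  assumes IH: "\<And>n s. ok M (arrs s) (vars s) t1 \<Longrightarrow>
      run (compile n t1) s (tc t1 M) (post n (tev (arrs s) (vars s) t1) s)"
    "\<And>n s. ok M (arrs s) (vars s) t2 \<Longrightarrow>
      run (compile n t2) s (tc t2 M) (post n (tev (arrs s) (vars s) t2) s)"
    and ok: "ok M (arrs s) (vars s) t1" "ok M (arrs s) (vars s) t2"
    and q: "\<And>s'. post n (tev (arrs s) (vars s) t1) s s' \<Longrightarrow>
      regs s' (tmp (n + 1)) = tev (arrs s) (vars s) t2 \<Longrightarrow> run q s' T3 Q"
    and le: "tc t1 M + tc t2 M + T3 \<le> U"
  shows "run (Seq (compile n t1) (Seq (compile (n + 1) t2) q)) s U Q"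
proof (rule run_Seq, rule run_mono[OF IH(1)[OF ok(1)] order_refl])
  show "tc t1 M + (tc t2 M + T3) \<le> U" using le by simp
next
  fix s1 assume s1: "post n (tev (arrs s) (vars s) t1) s s1"
  then have eq: "arrs s1 = arrs s" "vars s1 = vars s" by (auto simp: post_def)
  show "run (Seq (compile (n + 1) t2) q) s1 (tc t2 M + T3) Q"
  proof (rule run_Seq[OF _ order_refl], rule run_mono[OF IH(2) order_refl])
    show "ok M (arrs s1) (vars s1) t2" unfolding eq by (rule ok)
  next
    fix s2 assume "post (n + 1) (tev (arrs s1) (vars s1) t2) s1 s2"
    then have s2: "post (n + 1) (tev (arrs s) (vars s) t2) s1 s2" unfolding eq .
    show "run q s2 T3 Q"
      by (rule q) (use s1 s2 in \<open>auto simp: post_def\<close>)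
  qed
qed

lemma run_compile:
  "ok M (arrs s) (vars s) t \<Longrightarrow>
    run (compile n t) s (tc t M) (post n (tev (arrs s) (vars s) t) s)"
proof (induction t arbitrary: n s)
  case (C k)
  show ?case by (auto intro!: run_Assign simp: post_def)
next
  case (V x)
  show ?case by (auto intro!: run_Assign simp: post_def)
next
  case (A a t)
  show ?case
    unfolding compile.simps
  proof (rule run_Seq, rule run_mono[OF A.IH])
    show "ok M (arrs s) (vars s) t" using A.prems by simp
  next
    fix s' assume "post n (tev (arrs s) (vars s) t) s s'"
    then show "run (Assign (tmp n) (Arr a (Reg (tmp n)))) s' 3 (post n (tev (arrs s) (vars s) (A a t)) s)"
      by (auto intro!: run_Assign simp: post_def)
  qed auto
next
  case (Add t1 t2)
  let ?v1 = "tev (arrs s) (vars s) t1" and ?v2 = "tev (arrs s) (vars s) t2"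
  show ?case
    unfolding compile.simps
  proof (rule run_compile2[OF Add.IH])
    fix s' assume "post n ?v1 s s'" "regs s' (tmp (n + 1)) = ?v2"
    then show "run (Assign (tmp n) (Plus (Reg (tmp n)) (Reg (tmp (n + 1))))) s' 4
        (post n (tev (arrs s) (vars s) (Add t1 t2)) s)"
      by (auto intro!: run_Assign simp: post_def)
  qed (use Add.prems in auto)
next
  case (Sub t1 t2)
  let ?v1 = "tev (arrs s) (vars s) t1" and ?v2 = "tev (arrs s) (vars s) t2"
  show ?case
    unfolding compile.simps
  proof (rule run_compile2[OF Sub.IH])
    fix s' assume "post n ?v1 s s'" "regs s' (tmp (n + 1)) = ?v2"
    then show "run (Assign (tmp n) (Minus (Reg (tmp n)) (Reg (tmp (n + 1))))) s' 4
        (post n (tev (arrs s) (vars s) (Sub t1 t2)) s)"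
      by (auto intro!: run_Assign simp: post_def)
  qed (use Sub.prems in auto)
next
  case (Mul t1 t2)
  let ?v1 = "tev (arrs s) (vars s) t1" and ?v2 = "tev (arrs s) (vars s) t2"
  \<comment> \<open>The first factor is the loop counter, so it is the one that has to be bounded by
    \<open>M\<close>; \<open>tmp (n + 2)\<close> accumulates the product.\<close>
  let ?I = "\<lambda>j s'. post n (?v1 - j) s s' \<and> regs s' (tmp (n + 1)) = ?v2 \<and> regs s' (tmp (n + 2)) = j * ?v2"
  show ?case
    unfolding compile.simps
  proof (rule run_compile2[OF Mul.IH])
    fix s1 assume s1: "post n ?v1 s s1" "regs s1 (tmp (n + 1)) = ?v2"
    show "run (Seq (Assign (tmp (n + 2)) (Num 0))
     (Seq (While (Reg (tmp n))
       (Seq (Assign (tmp (n + 2)) (Plus (Reg (tmp (n + 2))) (Reg (tmp (n + 1)))))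
            (Assign (tmp n) (Minus (Reg (tmp n)) (Num 1)))))
     (Assign (tmp n) (Reg (tmp (n + 2)))))) s1 (M * 20 + 20)
        (post n (tev (arrs s) (vars s) (Mul t1 t2)) s)"
    proof (rule run_Seq, rule run_Assign[OF order_refl], rule run_Seq,
        rule run_mono[OF run_While[of ?I _ ?v1 _ _ 8 "?v1 * 20 + 2"]])
      fix s' assume "?I ?v1 s'"
      then show "run (Assign (tmp n) (Reg (tmp (n + 2)))) s' 2 (post n (tev (arrs s) (vars s) (Mul t1 t2)) s)"
        by (auto intro!: run_Assign simp: post_def)
    next
      fix j s' assume "j < ?v1" "?I j s'"
      then show "eval_expr s' (Reg (tmp n)) \<noteq> 0 \<and>
         run (Seq (Assign (tmp (n + 2)) (Plus (Reg (tmp (n + 2))) (Reg (tmp (n + 1)))))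
            (Assign (tmp n) (Minus (Reg (tmp n)) (Num 1)))) s' 8 (?I (Suc j))"
        by (auto intro!: run_Seq[of _ _ 4 _ 4] run_Assign simp: post_def)
    qed (use s1 Mul.prems in \<open>auto simp: post_def\<close>)
  qed (use Mul.prems in auto)
next
  case (Div t1 t2)
  let ?v1 = "tev (arrs s) (vars s) t1" and ?v2 = "tev (arrs s) (vars s) t2"
  let ?I = "\<lambda>j s'. post n (?v1 - j * ?v2) s s' \<and> regs s' (tmp (n + 1)) = ?v2 \<and> regs s' (tmp (n + 2)) = j"
  have pos: "0 < ?v2" and le: "?v1 \<le> M" using Div.prems by auto
  have le': "?v1 div ?v2 \<le> M" using le div_le_dividend[of ?v1 ?v2] by linarith
  show ?case
    unfolding compile.simps
  proof (rule run_compile2[OF Div.IH])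
    fix s1 assume s1: "post n ?v1 s s1" "regs s1 (tmp (n + 1)) = ?v2"
    show "run (Seq (Assign (tmp (n + 2)) (Num 0))
     (Seq (While (Minus (Plus (Reg (tmp n)) (Num 1)) (Reg (tmp (n + 1))))
       (Seq (Assign (tmp (n + 2)) (Plus (Reg (tmp (n + 2))) (Num 1)))
            (Assign (tmp n) (Minus (Reg (tmp n)) (Reg (tmp (n + 1)))))))
     (Assign (tmp n) (Reg (tmp (n + 2)))))) s1 (M * 20 + 20)
        (post n (tev (arrs s) (vars s) (Div t1 t2)) s)"
    proof (rule run_Seq, rule run_Assign[OF order_refl], rule run_Seq,
        rule run_mono[OF run_While[of ?I _ "?v1 div ?v2" _ _ 8 "(?v1 div ?v2) * 20 + 6"]])
      fix s' assume "?I (?v1 div ?v2) s'"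
      then show "run (Assign (tmp n) (Reg (tmp (n + 2)))) s' 2 (post n (tev (arrs s) (vars s) (Div t1 t2)) s)"
        by (auto intro!: run_Assign simp: post_def)
    next
      fix j s' assume j: "j < ?v1 div ?v2" and I: "?I j s'"
      \<comment> \<open>A full divisor still fits, so the guard is positive and the truncated
        subtraction is exact.\<close>
      have "Suc j * ?v2 \<le> ?v1" using j pos
        by (metis Suc_leI less_eq_div_iff_mult_less_eq)
      then show "eval_expr s' (Minus (Plus (Reg (tmp n)) (Num 1)) (Reg (tmp (n + 1)))) \<noteq> 0 \<and>
         run (Seq (Assign (tmp (n + 2)) (Plus (Reg (tmp (n + 2))) (Num 1)))
            (Assign (tmp n) (Minus (Reg (tmp n)) (Reg (tmp (n + 1)))))) s' 8 (?I (Suc j))"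
        using I by (auto intro!: run_Seq[of _ _ 4 _ 4] run_Assign simp: post_def)
    next
      fix s' assume "?I (?v1 div ?v2) s'"
      moreover have "?v1 - ?v1 div ?v2 * ?v2 < ?v2"
        using pos by (simp add: minus_div_mult_eq_mod)
      ultimately show "eval_expr s' (Minus (Plus (Reg (tmp n)) (Num 1)) (Reg (tmp (n + 1)))) = 0"
        by (simp add: post_def)
    qed (use s1 le' in \<open>auto simp: post_def\<close>)
  qed (use Div.prems in auto)
next
  case (Sm x b t)
  let ?N = "tev (arrs s) (vars s) b"
  let ?f = "\<lambda>v. tev (arrs s) ((vars s)(x := v)) t"
  \<comment> \<open>The whole environment is given as an update at \<open>x\<close>, the form in
    which the semantics of the sum evaluates the body; the old value of \<open>x\<close> waits in
    \<open>tmp (n + 2)\<close>.\<close>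
  let ?I = "\<lambda>j s'. arrs s' = arrs s \<and> vars s' = (vars s)(x := j) \<and> regs s' (tmp n) = ?N \<and>
     regs s' (tmp (n + 1)) = (\<Sum>v<j. ?f v) \<and> regs s' (tmp (n + 2)) = regs s (2 * x) \<and>
     (\<forall>i<n. regs s' (tmp i) = regs s (tmp i))"
  let ?b = "Minus (Reg (tmp n)) (Reg (2 * x))"
  let ?body = "Seq (compile (n + 3) t)
       (Seq (Assign (tmp (n + 1)) (Plus (Reg (tmp (n + 1))) (Reg (tmp (n + 3)))))
            (Assign (2 * x) (Plus (Reg (2 * x)) (Num 1))))"
  have step: "eval_expr s' ?b \<noteq> 0 \<and> run ?body s' (tc t M + 8) (?I (Suc j))"
    if j: "j < ?N" and I: "?I j s'" for j s'
  proof
    show "eval_expr s' ?b \<noteq> 0" using j I by (simp add: fun_eq_iff)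
    have okt: "ok M (arrs s') (vars s') t" using Sm.prems j I by simp
    show "run ?body s' (tc t M + 8) (?I (Suc j))"
    proof (rule run_Seq[OF _ order_refl], rule run_mono[OF Sm.IH(2)[OF okt] order_refl])
      fix s2 assume s2: "post (n + 3) (tev (arrs s') (vars s') t) s' s2"
      have v2: "vars s2 = (vars s)(x := j)" and a2: "arrs s2 = arrs s"
        using s2 I by (auto simp: post_def)
      have r2: "regs s2 (tmp n) = ?N" "regs s2 (tmp (n + 1)) = (\<Sum>v<j. ?f v)"
        "regs s2 (tmp (n + 2)) = regs s (2 * x)" "\<And>i. i < n \<Longrightarrow> regs s2 (tmp i) = regs s (tmp i)"
        "regs s2 (tmp (n + 3)) = ?f j"
        using s2 I by (auto simp: post_def)
      have r3: "regs s2 (2 * x) = j" using fun_cong[OF v2, of x] by simp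
      show "run (Seq (Assign (tmp (n + 1)) (Plus (Reg (tmp (n + 1))) (Reg (tmp (n + 3)))))
            (Assign (2 * x) (Plus (Reg (2 * x)) (Num 1)))) s2 8 (?I (Suc j))"
      proof (rule run_Seq[of _ _ 4 _ 4], rule run_Assign, simp, rule run_Assign, simp)
        have "\<And>y. y \<noteq> x \<Longrightarrow> regs s2 (2 * y) = regs s (2 * y)"
          using v2 by (metis fun_upd_other)
        then show "?I (Suc j) (set_reg (2 * x) (eval_expr (set_reg (tmp (n + 1)) (eval_expr s2 (Plus (Reg (tmp (n + 1))) (Reg (tmp (n + 3))))) s2) (Plus (Reg (2 * x)) (Num 1))) (set_reg (tmp (n + 1)) (eval_expr s2 (Plus (Reg (tmp (n + 1))) (Reg (tmp (n + 3))))) s2))"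
          using r2 r3 a2 by (simp add: fun_eq_iff)
      qed simp
    qed
  qed
  have okb: "ok M (arrs s) (vars s) b" and N: "?N \<le> M" using Sm.prems by auto
  have "run (compile n (Sm x b t)) s (tc b M + (2 + (2 + (2 + ((?N * (1 + 3 + (tc t M + 8)) + 1 + 3) + (2 + 2))))))
      (post n (tev (arrs s) (vars s) (Sm x b t)) s)"
    unfolding compile.simps
  proof (rule run_Seq[OF _ order_refl], rule run_mono[OF Sm.IH(1)[OF okb] order_refl],
      rule run_Seq[OF _ order_refl], rule run_Assign, simp, rule run_Seq[OF _ order_refl],
      rule run_Assign, simp, rule run_Seq[OF _ order_refl], rule run_Assign, simp,
      rule run_Seq[OF _ order_refl], rule run_mono[OF run_While[of ?I _ ?N _ _ "tc t M + 8"] order_refl])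
    fix s1 assume s1: "post n ?N s s1"
    show "?I 0 (set_reg (2 * x) (eval_expr (set_reg (tmp (n + 2)) (eval_expr (set_reg (tmp (n + 1)) (eval_expr s1 (Num 0)) s1)
         (Reg (2 * x))) (set_reg (tmp (n + 1)) (eval_expr s1 (Num 0)) s1)) (Num 0))
         (set_reg (tmp (n + 2)) (eval_expr (set_reg (tmp (n + 1)) (eval_expr s1 (Num 0)) s1) (Reg (2 * x)))
         (set_reg (tmp (n + 1)) (eval_expr s1 (Num 0)) s1)))"
      using s1 by (auto simp: post_def)
  next
    fix s' assume I: "?I ?N s'"
    then have "regs s' (2 * x) = ?N" by (metis fun_upd_same)
    then show "eval_expr s' ?b = 0" using I by simp
  next
    fix s' assume I: "?I ?N s'"
    then have "\<And>i. i \<noteq> x \<Longrightarrow> regs s' (2 * i) = regs s (2 * i)" by (metis fun_upd_other)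
    then show "run (Seq (Assign (tmp n) (Reg (tmp (n + 1)))) (Assign (2 * x) (Reg (tmp (n + 2))))) s' (2 + 2)
        (post n (tev (arrs s) (vars s) (Sm x b t)) s)"
      using I by (auto intro!: run_Seq[of _ _ 2 _ 2] run_Assign simp: post_def)
  qed (use step in auto)
  then show ?case
  proof (rule run_mono)
    have "?N * (1 + 3 + (tc t M + 8)) \<le> M * (tc t M + 20)"
      by (rule mult_mono) (use N in auto)
    then show "tc b M + (2 + (2 + (2 + ((?N * (1 + 3 + (tc t M + 8)) + 1 + 3) + (2 + 2))))) \<le> tc (Sm x b t) M"
      by simp
  qed
qed

section \<open>Filling arrays entry by entry\<close>

definition fill :: "nat \<Rightarrow> tm \<Rightarrow> nat \<Rightarrow> tm \<Rightarrow> prog" where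
  "fill a b x t = Seq (compile 0 b) (Seq (Assign (2 * x) (Num 0))
     (While (Minus (Reg (tmp 0)) (Reg (2 * x)))
       (Seq (compile 1 t) (Seq (Store a (Reg (2 * x)) (Reg (tmp 1)))
         (Assign (2 * x) (Plus (Reg (2 * x)) (Num 1)))))))"

definition fill_cost :: "tm \<Rightarrow> tm \<Rightarrow> nat \<Rightarrow> nat" where
  "fill_cost b t M = tc b M + M * (tc t M + 20) + 20"

text \<open>The term must be correct in every memory that agrees with \<open>\<alpha>\<close> off
  \<open>a\<close> and is correct below \<open>i\<close> in \<open>a\<close> itself, so an entry may
  refer to earlier entries of its own array, as recursive tables need. Quantifying over all
  \<open>\<rho>\<close> makes leftover register contents harmless.\<close>

lemma run_fill:
  fixes G :: "nat \<Rightarrow> nat"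
  assumes b: "\<And>\<rho>. ok M \<alpha> \<rho> b \<and> tev \<alpha> \<rho> b = N" and N: "N \<le> M" and \<alpha>: "arrs s = \<alpha>"
    and t: "\<And>\<beta> \<rho> i. i < N \<Longrightarrow> \<rho> x = i \<Longrightarrow> (\<And>c. c \<noteq> a \<Longrightarrow> \<beta> c = \<alpha> c) \<Longrightarrow>
       (\<And>j. j < i \<Longrightarrow> \<beta> a j = G j) \<Longrightarrow> ok M \<beta> \<rho> t \<and> tev \<beta> \<rho> t = G i"
  shows "run (fill a b x t) s (fill_cost b t M)
    (\<lambda>s'. (\<forall>c. c \<noteq> a \<longrightarrow> arrs s' c = \<alpha> c) \<and> (\<forall>j<N. arrs s' a j = G j))"
proof -
  let ?I = "\<lambda>i s'. (\<forall>c. c \<noteq> a \<longrightarrow> arrs s' c = \<alpha> c) \<and> (\<forall>j<i. arrs s' a j = G j) \<and>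
     regs s' (tmp 0) = N \<and> regs s' (2 * x) = i"
  let ?b = "Minus (Reg (tmp 0)) (Reg (2 * x))"
  let ?body = "Seq (compile 1 t) (Seq (Store a (Reg (2 * x)) (Reg (tmp 1)))
         (Assign (2 * x) (Plus (Reg (2 * x)) (Num 1))))"
  have step: "eval_expr s' ?b \<noteq> 0 \<and> run ?body s' (tc t M + 8) (?I (Suc i))"
    if i: "i < N" and I: "?I i s'" for i s'
  proof
    show "eval_expr s' ?b \<noteq> 0" using i I by simp
    have okt: "ok M (arrs s') (vars s') t" and v: "tev (arrs s') (vars s') t = G i"
      using t[of i "vars s'" "arrs s'"] i I by auto
    show "run ?body s' (tc t M + 8) (?I (Suc i))"
    proof (rule run_Seq[OF _ order_refl], rule run_mono[OF run_compile[OF okt] order_refl])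
      fix s2 assume s2: "post 1 (tev (arrs s') (vars s') t) s' s2"
      then have "arrs s2 = arrs s'" "regs s2 (tmp 1) = G i" "regs s2 (tmp 0) = regs s' (tmp 0)"
        "regs s2 (2 * x) = regs s' (2 * x)" using v by (auto simp: post_def)
      then show "run (Seq (Store a (Reg (2 * x)) (Reg (tmp 1)))
         (Assign (2 * x) (Plus (Reg (2 * x)) (Num 1)))) s2 8 (?I (Suc i))"
        using I
        by (auto intro!: run_Seq[of _ _ 3 _ 4] run_Store run_Assign simp: less_Suc_eq fun_eq_iff)
    qed
  qed
  have "run (fill a b x t) s (tc b M + (2 + (N * (1 + 3 + (tc t M + 8)) + 1 + 3))) (?I N)"
    unfolding fill_def
  proof (rule run_Seq[OF _ order_refl], rule run_mono[OF run_compile order_refl])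
    show "ok M (arrs s) (vars s) b" using b \<alpha> by blast
  next
    fix s1 assume "post 0 (tev (arrs s) (vars s) b) s s1"
    then have "arrs s1 = \<alpha>" "regs s1 (tmp 0) = N" using b \<alpha> by (auto simp: post_def)
    then show "run (Seq (Assign (2 * x) (Num 0)) (While ?b ?body)) s1
        (2 + (N * (1 + 3 + (tc t M + 8)) + 1 + 3)) (?I N)"
      by (intro run_Seq[OF _ order_refl] run_Assign run_While[of ?I _ N _ _ "tc t M + 8"] step)
        (auto)
  qed
  then show ?thesis
  proof (rule run_mono)
    have "N * (1 + 3 + (tc t M + 8)) \<le> M * (tc t M + 20)"
      by (rule mult_mono) (use N in auto)
    then show "tc b M + (2 + (N * (1 + 3 + (tc t M + 8)) + 1 + 3)) \<le> fill_cost b t M"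
      by (simp add: fill_cost_def)
  qed auto
qed

definition emit :: "tm \<Rightarrow> prog" where
  "emit t = Seq (compile 0 t) (Assign 0 (Reg (tmp 0)))"

lemma run_emit:
  assumes "\<And>\<rho>. ok M \<alpha> \<rho> t \<and> tev \<alpha> \<rho> t = v" "arrs s = \<alpha>"
  shows "run (emit t) s (tc t M + 2) (\<lambda>s'. result s' = v)"
  unfolding emit_def
proof (rule run_Seq[OF _ order_refl], rule run_mono[OF run_compile order_refl])
  show "ok M (arrs s) (vars s) t" using assms by blast
qed (use assms in \<open>auto intro!: run_Assign simp: post_def result_def\<close>)

section \<open>Polynomial cost bounds\<close>

definition poly_bounded :: "(nat \<Rightarrow> nat) \<Rightarrow> bool" where
  "poly_bounded g \<longleftrightarrow> (\<exists>c e. \<forall>M\<ge>1. g M \<le> c * M ^ e)"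

lemma poly_bounded_const: "poly_bounded (\<lambda>M. c)"
  unfolding poly_bounded_def by (rule exI[of _ c], rule exI[of _ 0]) simp

lemma poly_bounded_id: "poly_bounded (\<lambda>M. M)"
  unfolding poly_bounded_def by (rule exI[of _ 1], rule exI[of _ 1]) simp

lemma poly_bounded_add:
  assumes "poly_bounded f" "poly_bounded g"
  shows "poly_bounded (\<lambda>M. f M + g M)"
proof -
  obtain c e c' e' where f: "\<And>M. M \<ge> 1 \<Longrightarrow> f M \<le> c * M ^ e" and g: "\<And>M. M \<ge> 1 \<Longrightarrow> g M \<le> c' * M ^ e'"
    using assms unfolding poly_bounded_def by blast
  have "f M + g M \<le> (c + c') * M ^ (e + e')" if M: "M \<ge> 1" for M
  proof -
    have "c * M ^ e \<le> c * M ^ (e + e')" "c' * M ^ e' \<le> c' * M ^ (e + e')"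
      using M by (simp_all add: power_increasing mult_left_mono del: mult_le_cancel1)
    then show ?thesis using f[OF M] g[OF M] unfolding add_mult_distrib by linarith
  qed
  then show ?thesis unfolding poly_bounded_def by blast
qed

lemma poly_bounded_mult:
  assumes "poly_bounded f" "poly_bounded g"
  shows "poly_bounded (\<lambda>M. f M * g M)"
proof -
  obtain c e c' e' where f: "\<And>M. M \<ge> 1 \<Longrightarrow> f M \<le> c * M ^ e" and g: "\<And>M. M \<ge> 1 \<Longrightarrow> g M \<le> c' * M ^ e'"
    using assms unfolding poly_bounded_def by blast
  have "f M * g M \<le> (c * c') * M ^ (e + e')" if M: "M \<ge> 1" for M
    using mult_mono[OF f[OF M] g[OF M]] by (simp add: power_add algebra_simps)
  then show ?thesis unfolding poly_bounded_def by blast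
qed

lemmas poly_bounded_intros =
  poly_bounded_const poly_bounded_id poly_bounded_add poly_bounded_mult

lemma poly_bounded_tc: "poly_bounded (tc t)"
  unfolding tc.simps[abs_def]
  by (induction t) (simp_all add: tc.simps[abs_def] poly_bounded_intros)

lemma poly_bounded_fill_cost: "poly_bounded (fill_cost b t)"
  unfolding fill_cost_def[abs_def] by (intro poly_bounded_intros poly_bounded_tc)

section \<open>Signs of linear forms by digits\<close>

text \<open>Used with base 2, to pack one binary digit of every unknown into one number, and with a
  larger base, to pack a vector of truncated values into a table index.\<close>

lemma ex_digits:
  fixes b :: nat
  assumes "\<And>r. r < m \<Longrightarrow> f r < b"
  shows "\<exists>s<b ^ m. \<forall>r<m. s div b ^ r mod b = f r"
  using assms
proof (induction m)
  case 0
  show ?case by simp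
next
  case (Suc m)
  then obtain s where s: "s < b ^ m" "\<And>r. r < m \<Longrightarrow> s div b ^ r mod b = f r"
    by (metis less_SucI)
  have fm: "f m < b" using Suc.prems by simp
  let ?s = "f m * b ^ m + s"
  have "?s < b ^ Suc m"
  proof -
    have "?s < Suc (f m) * b ^ m" using s(1) by simp
    also have "\<dots> \<le> b * b ^ m" using fm by (intro mult_right_mono) auto
    finally show ?thesis by simp
  qed
  moreover have "?s div b ^ r mod b = f r" if "r < Suc m" for r
  proof (cases "r = m")
    case True
    have "b ^ m > 0" using s(1) by linarith
    then show ?thesis using True s(1) fm by simp
  next
    case False
    then have r: "r < m" using that by simp
    \<comment> \<open>The new leading term is a multiple of \<open>b * b ^ r\<close>, so it leaves
      digit \<open>r\<close> unchanged.\<close>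
    then have "b ^ m = b ^ r * (b * b ^ (m - Suc r))"
      by (metis Suc_diff_Suc power_Suc power_add le_add_diff_inverse less_imp_le_nat)
    then have "?s = s + b ^ r * (b * b ^ (m - Suc r) * f m)" by (simp add: algebra_simps)
    moreover have "b ^ r \<noteq> 0" using fm by simp
    ultimately have "?s div b ^ r = s div b ^ r + b * b ^ (m - Suc r) * f m"
      by (metis add.commute div_mult_self2)
    then show ?thesis using s(2)[OF r] by (simp add: mult.assoc)
  qed
  ultimately show ?case by blast
qed

text \<open>Truncation to the interval from -B to B, shifted by \<open>B\<close> into the natural
  numbers. Zero is encoded by \<open>B\<close>, and signs become comparisons with
  \<open>B\<close>.\<close>

definition sat :: "nat \<Rightarrow> int \<Rightarrow> nat" where
  "sat B v = nat (max 0 (min (v + int B) (2 * int B)))"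

lemma sat_le: "sat B v \<le> 2 * B"
  by (auto simp: sat_def)

text \<open>A saturated value at least \<open>B\<close> in modulus stays so, because doubling beats the increment.\<close>

lemma sat_step:
  assumes "p \<le> B" "q \<le> B"
  shows "sat B (2 * v + int p - int q) = min (2 * B) (2 * sat B v + p - (B + q))"
proof -
  consider "v \<ge> int B" | "v \<le> - int B" | "- int B < v" "v < int B" by linarith
  then show ?thesis
  proof cases
    case 1
    then have "sat B v = 2 * B" "sat B (2 * v + int p - int q) = 2 * B"
      using assms by (auto simp: sat_def)
    then show ?thesis using assms by simp
  next
    case 2
    then have "sat B v = 0" "sat B (2 * v + int p - int q) = 0"
      using assms by (auto simp: sat_def)
    then show ?thesis using assms by simp
  next
    case 3
    then have "int (sat B v) = v + int B" by (auto simp: sat_def)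
    then show ?thesis by (auto simp: sat_def)
  qed
qed

section \<open>A table of truncated values over digit prefixes\<close>

locale digit_dp =
  fixes d q m L B :: nat and Y :: "nat \<Rightarrow> nat" and P Q :: "nat \<Rightarrow> nat \<Rightarrow> nat"
  assumes Y: "\<And>i. d \<le> i \<Longrightarrow> i < q \<Longrightarrow> Y i < 2 ^ L"
    and P: "\<And>r. r < m \<Longrightarrow> (\<Sum>i<q. P r i) \<le> B"
    and Q: "\<And>r. r < m \<Longrightarrow> (\<Sum>i<q. Q r i) \<le> B"
begin

text \<open>A vector of \<open>m\<close> truncated values is stored as one number, whose digit
  \<open>r\<close> in base \<open>2 * B + 1\<close> belongs to row \<open>r\<close>.\<close>

definition dig :: "nat \<Rightarrow> nat \<Rightarrow> nat" where
  "dig s r = s div (2 * B + 1) ^ r mod (2 * B + 1)"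

text \<open>\<open>z\<close> packs the digits that the unknowns receive in one round. Those of the
  known numbers are forced: the l-th of \<open>L\<close> digits from the front is bit
  \<open>L - l\<close>.\<close>

definition bit_at :: "nat \<Rightarrow> nat \<Rightarrow> nat \<Rightarrow> nat" where
  "bit_at l z i = (if i < d then z div 2 ^ i mod 2 else Y i div 2 ^ (L - l) mod 2)"

fun tab :: "nat \<Rightarrow> nat \<Rightarrow> bool" where
  "tab 0 s \<longleftrightarrow> (\<forall>r<m. dig s r = B)"
| "tab (Suc l) s \<longleftrightarrow> (\<exists>s'<(2 * B + 1) ^ m. tab l s' \<and> (\<exists>z<2 ^ d. \<forall>r<m.
     dig s r = min (2 * B) (2 * dig s' r + (\<Sum>i<q. P r i * bit_at (Suc l) z i)
       - (B + (\<Sum>i<q. Q r i * bit_at (Suc l) z i)))))"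

text \<open>\<open>P\<close> and \<open>Q\<close> are the positive and the negative part of the
  coefficients, kept apart because the table is computed in natural numbers.\<close>

definition row :: "(nat \<Rightarrow> nat) \<Rightarrow> nat \<Rightarrow> int" where
  "row X r = int (\<Sum>i<q. P r i * X i) - int (\<Sum>i<q. Q r i * X i)"

text \<open>An unknown may be any number with \<open>l\<close> digits, whereas a known number is
  \<open>Y i\<close> cut off behind its first \<open>l\<close> of \<open>L\<close> digits. At
  \<open>l = L\<close> the known numbers are complete.\<close>

definition prefix_at :: "nat \<Rightarrow> (nat \<Rightarrow> nat) \<Rightarrow> bool" where
  "prefix_at l X \<longleftrightarrow> (\<forall>i<d. X i < 2 ^ l) \<and> (\<forall>i. d \<le> i \<longrightarrow> i < q \<longrightarrow> X i = Y i div 2 ^ (L - l))"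

lemma row_cong: "(\<And>i. i < q \<Longrightarrow> X i = X' i) \<Longrightarrow> row X r = row X' r"
  unfolding row_def by simp

text \<open>By linearity, appending digits doubles the value and adds the form at the digits. As
  these are at most 1, the two added parts are at most the coefficient sums, hence at most
  \<open>B\<close>, as \<open>sat_step\<close> requires.\<close>

lemma sat_row:
  assumes r: "r < m" and b: "\<And>i. b i \<le> 1"
  shows "sat B (row (\<lambda>i. 2 * X i + b i) r) =
    min (2 * B) (2 * sat B (row X r) + (\<Sum>i<q. P r i * b i) - (B + (\<Sum>i<q. Q r i * b i)))"
proof -
  have "(\<Sum>i<q. R r i * b i) \<le> (\<Sum>i<q. R r i)" for R :: "nat \<Rightarrow> nat \<Rightarrow> nat"
    using b by (intro sum_mono) (metis mult.right_neutral mult_le_mono2)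
  then have "(\<Sum>i<q. P r i * b i) \<le> B" "(\<Sum>i<q. Q r i * b i) \<le> B"
    using P[OF r] Q[OF r] le_trans by blast+
  note step = sat_step[OF this, of "row X r"]
  have "(\<Sum>i<q. R r i * (2 * X i + b i)) = 2 * (\<Sum>i<q. R r i * X i) + (\<Sum>i<q. R r i * b i)"
    for R :: "nat \<Rightarrow> nat \<Rightarrow> nat"
    by (simp add: algebra_simps sum.distrib sum_distrib_left)
  then have "row (\<lambda>i. 2 * X i + b i) r =
      2 * row X r + int (\<Sum>i<q. P r i * b i) - int (\<Sum>i<q. Q r i * b i)"
    unfolding row_def by simp
  then show ?thesis using step by simp
qed

lemma Y_step: "Suc l \<le> L \<Longrightarrow> Y i div 2 ^ (L - Suc l) = 2 * (Y i div 2 ^ (L - l)) + Y i div 2 ^ (L - Suc l) mod 2"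
proof -
  assume "Suc l \<le> L"
  then have "L - l = Suc (L - Suc l)" by simp
  then have "Y i div 2 ^ (L - l) = Y i div 2 ^ (L - Suc l) div 2"
    by (metis div_mult2_eq power_Suc2)
  then show ?thesis by simp
qed

text \<open>Appending a digit extends a shorter prefix, and \<open>div 2\<close> takes it off again.
  The truncated values of the longer prefix depend on the shorter one only through its truncated
  values, so the table has to remember nothing else.\<close>

lemma tab_iff:
  "l \<le> L \<Longrightarrow> tab l s \<longleftrightarrow> (\<exists>X. prefix_at l X \<and> (\<forall>r<m. dig s r = sat B (row X r)))"
proof (induction l arbitrary: s)
  case 0
  have sat0: "sat B 0 = B" by (simp add: sat_def)
  have z: "row X r = 0" if "prefix_at 0 X" for X r
  proof -
    \<comment> \<open>Length 0 leaves the unknowns below 1 and shifts out all \<open>L\<close>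
      digits of the known numbers.\<close>
    have "X i = 0" if "i < q" for i
      using \<open>prefix_at 0 X\<close> that Y[of i] by (cases "i < d") (auto simp: prefix_at_def)
    then show ?thesis by (simp add: row_def)
  qed
  have "prefix_at 0 (\<lambda>_. 0)" using Y by (auto simp: prefix_at_def)
  then show ?case using z sat0 by auto
next
  case (Suc l)
  have IH: "tab l s \<longleftrightarrow> (\<exists>X. prefix_at l X \<and> (\<forall>r<m. dig s r = sat B (row X r)))" for s
    using Suc by simp
  have bit_at: "bit_at l z i \<le> 1" for l z i
    unfolding bit_at_def by auto
  show ?case
  proof
    assume "tab (Suc l) s"
    then obtain s' z where "tab l s'"
      and s: "\<And>r. r < m \<Longrightarrow> dig s r = min (2 * B) (2 * dig s' r + (\<Sum>i<q. P r i * bit_at (Suc l) z i)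
       - (B + (\<Sum>i<q. Q r i * bit_at (Suc l) z i)))"
      by auto
    then obtain X where X: "prefix_at l X" and s': "\<And>r. r < m \<Longrightarrow> dig s' r = sat B (row X r)"
      using IH by blast
    let ?X = "\<lambda>i. 2 * X i + bit_at (Suc l) z i"
    have "2 * X i + bit_at (Suc l) z i < 2 ^ Suc l" if "i < d" for i
    proof -
      have "X i < 2 ^ l" using X that by (simp add: prefix_at_def)
      then show ?thesis using bit_at[of "Suc l" z i] by simp
    qed
    then have "prefix_at (Suc l) ?X"
      using X Y_step[OF Suc.prems] by (auto simp: prefix_at_def bit_at_def)
    moreover have "dig s r = sat B (row ?X r)" if "r < m" for r
      using s[OF that] s'[OF that] sat_row[OF that bit_at] by simp
    ultimately show "\<exists>X. prefix_at (Suc l) X \<and> (\<forall>r<m. dig s r = sat B (row X r))" by blast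
  next
    assume "\<exists>X. prefix_at (Suc l) X \<and> (\<forall>r<m. dig s r = sat B (row X r))"
    then obtain X where X: "prefix_at (Suc l) X" and s: "\<And>r. r < m \<Longrightarrow> dig s r = sat B (row X r)"
      by blast
    let ?X = "\<lambda>i. X i div 2"
    \<comment> \<open>\<open>z\<close> collects the last digits of the unknowns, \<open>s'\<close>
      the truncated values of the shortened prefix; both respect the ranges quantified over in
      \<open>tab\<close>.\<close>
    obtain z where z: "z < 2 ^ d" "\<And>i. i < d \<Longrightarrow> z div 2 ^ i mod 2 = X i mod 2"
      using ex_digits[of d "\<lambda>i. X i mod 2" 2] by auto
    obtain s' where s': "s' < (2 * B + 1) ^ m" "\<And>r. r < m \<Longrightarrow> dig s' r = sat B (row ?X r)"
      using ex_digits[of m "\<lambda>r. sat B (row ?X r)" "2 * B + 1"] sat_le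
      unfolding dig_def by (metis add.commute less_Suc_eq_le plus_1_eq_Suc)
    have Xl: "prefix_at l ?X"
    proof -
      have "X i div 2 < 2 ^ l" if "i < d" for i
        using X that by (auto simp: prefix_at_def)
      moreover have "X i div 2 = Y i div 2 ^ (L - l)" if "d \<le> i" "i < q" for i
        using X that Y_step[OF Suc.prems, of i] by (simp add: prefix_at_def)
      ultimately show ?thesis by (auto simp: prefix_at_def)
    qed
    have "X i = 2 * (X i div 2) + bit_at (Suc l) z i" if "i < q" for i
      using X that z(2) unfolding bit_at_def prefix_at_def by (cases "i < d") auto
    then have "row X r = row (\<lambda>i. 2 * ?X i + bit_at (Suc l) z i) r" for r
      by (intro row_cong) blast
    then have "dig s r = min (2 * B) (2 * dig s' r + (\<Sum>i<q. P r i * bit_at (Suc l) z i)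
       - (B + (\<Sum>i<q. Q r i * bit_at (Suc l) z i)))" if "r < m" for r
      using s[OF that] s'(2)[OF that] sat_row[OF that, of "bit_at (Suc l) z" ?X] bit_at by simp
    moreover have "tab l s'" using IH Xl s'(2) by blast
    ultimately show "tab (Suc l) s" using s'(1) z(1) by auto
  qed
qed

end

section \<open>Twin classes of a signed matrix\<close>

text \<open>The exempted rows \<open>u\<close> and \<open>v\<close> correspond to the vertices
  removed in a signed type, so twins may be joined by an edge of either sign or by none.\<close>

definition twin :: "nat \<Rightarrow> (nat \<Rightarrow> nat \<Rightarrow> nat) \<Rightarrow> nat \<Rightarrow> nat \<Rightarrow> bool" where
  "twin n E u v \<longleftrightarrow> (\<forall>x<n. x = u \<or> x = v \<or> E x u = E x v)"

definition leader :: "nat \<Rightarrow> (nat \<Rightarrow> nat \<Rightarrow> nat) \<Rightarrow> nat \<Rightarrow> bool" where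
  "leader n E v \<longleftrightarrow> \<not> (\<exists>u<v. twin n E u v)"

definition ncls :: "nat \<Rightarrow> (nat \<Rightarrow> nat \<Rightarrow> nat) \<Rightarrow> nat" where
  "ncls n E = (\<Sum>u<n. of_bool (leader n E u))"

text \<open>A class is numbered by the leaders that precede its least member.\<close>

definition cls :: "nat \<Rightarrow> (nat \<Rightarrow> nat \<Rightarrow> nat) \<Rightarrow> nat \<Rightarrow> nat" where
  "cls n E v = (\<Sum>u<n. of_bool (leader n E u \<and> \<not> (\<exists>w<Suc u. twin n E w v)))"

definition csize :: "nat \<Rightarrow> (nat \<Rightarrow> nat \<Rightarrow> nat) \<Rightarrow> nat \<Rightarrow> nat" where
  "csize n E j = (\<Sum>v<n. of_bool (cls n E v = j))"

text \<open>The existential form is what the program tests; \<open>E_iff_rel\<close> shows that one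
  witness decides all pairs of distinct vertices from the two classes.\<close>

definition rel :: "nat \<Rightarrow> (nat \<Rightarrow> nat \<Rightarrow> nat) \<Rightarrow> nat \<Rightarrow> nat \<Rightarrow> nat \<Rightarrow> bool" where
  "rel n E \<sigma> i j \<longleftrightarrow> (\<exists>u<n. \<exists>v<n. cls n E u = i \<and> cls n E v = j \<and> E u v = \<sigma>)"

definition alliance :: "nat \<Rightarrow> (nat \<Rightarrow> nat \<Rightarrow> nat) \<Rightarrow> nat set \<Rightarrow> bool" where
  "alliance n E S \<longleftrightarrow> (\<forall>w<n. w \<notin> S \<longrightarrow> (\<exists>u\<in>S. E u w \<noteq> 0) \<longrightarrow>
     card {u \<in> S. E u w = 1} \<le> card {u \<in> S. E u w = 2} \<and>
     card {u. u < n \<and> u \<notin> S \<and> E u w = 1} + 1 \<le> card {u \<in> S. E u w = 2})"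

text \<open>A class imposes its condition only if some member is outside the set, that is if
  \<open>x j < csize n E j\<close>. The positive degree into the complement is the total minus the
  degree into the set, with the subtraction moved to the other side;
  \<open>of_bool (rel n E 1 j j)\<close> corrects for the total counting the vertex itself.\<close>

definition good :: "nat \<Rightarrow> (nat \<Rightarrow> nat \<Rightarrow> nat) \<Rightarrow> (nat \<Rightarrow> nat) \<Rightarrow> bool" where
  "good n E x \<longleftrightarrow> (\<forall>j<ncls n E. x j \<le> csize n E j \<and>
     (x j < csize n E j \<and> 0 < (\<Sum>i<ncls n E. of_bool (rel n E 1 i j) * x i) + (\<Sum>i<ncls n E. of_bool (rel n E 2 i j) * x i) \<longrightarrow>
       (\<Sum>i<ncls n E. of_bool (rel n E 1 i j) * x i) \<le> (\<Sum>i<ncls n E. of_bool (rel n E 2 i j) * x i) \<and>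
       (\<Sum>i<ncls n E. of_bool (rel n E 1 i j) * csize n E i) <
         (\<Sum>i<ncls n E. of_bool (rel n E 2 i j) * x i) + (\<Sum>i<ncls n E. of_bool (rel n E 1 i j) * x i)
         + of_bool (rel n E 1 j j)))"

locale signed_matrix =
  fixes n :: nat and E :: "nat \<Rightarrow> nat \<Rightarrow> nat"
  assumes sym: "\<And>u v. u < n \<Longrightarrow> v < n \<Longrightarrow> E u v = E v u"
    and diag: "\<And>u. u < n \<Longrightarrow> E u u = 0"
    and le2: "\<And>u v. u < n \<Longrightarrow> v < n \<Longrightarrow> E u v \<le> 2"
begin

lemma twin_refl: "twin n E u u"
  by (simp add: twin_def)

lemma twin_sym: "twin n E u v \<Longrightarrow> twin n E v u"
  by (auto simp: twin_def)

lemma twin_trans: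
  assumes uv: "twin n E u v" and vw: "twin n E v w" and n: "u < n" "v < n" "w < n"
  shows "twin n E u w"
  unfolding twin_def
proof (intro allI impI)
  fix x assume x: "x < n"
  have 1: "x = u \<or> x = v \<or> E x u = E x v" "x = v \<or> x = w \<or> E x v = E x w"
    using uv vw x by (auto simp: twin_def)
  \<comment> \<open>The facts above say nothing at \<open>x = v\<close>, where
    \<open>E v u = E v w\<close> is required. Both equal \<open>E u w\<close>, by the assumptions at
    \<open>u\<close> and \<open>w\<close> and by symmetry.\<close>
  have 2: "w = u \<or> w = v \<or> E w u = E w v" "u = v \<or> u = w \<or> E u v = E u w"
    using uv vw n by (auto simp: twin_def)
  have s: "E u v = E v u" "E w v = E v w" "E u w = E w u" using sym n by auto
  show "x = u \<or> x = w \<or> E x u = E x w" using 1 2 s by metis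
qed

lemma card_sum_of_bool: "(\<Sum>u<n. of_bool (P u)) = card {u. u < n \<and> P u}"
  by (simp add: lessThan_def Collect_conj_eq Int_commute)

text \<open>The least twin of \<open>v\<close> is a leader, since by transitivity any smaller twin
  of it would be a twin of \<open>v\<close>.\<close>

lemma ex_leader:
  assumes "v < n"
  obtains a where "a < n" "leader n E a" "twin n E a v" "\<And>w. w < a \<Longrightarrow> \<not> twin n E w v"
proof -
  define a where "a = (LEAST a. twin n E a v)"
  have t: "twin n E a v" unfolding a_def using twin_refl by (rule LeastI)
  have m: "\<not> twin n E w v" if "w < a" for w using that unfolding a_def by (rule not_less_Least)
  have "a \<le> v" unfolding a_def using twin_refl by (rule Least_le)
  then have a: "a < n" using assms by simp
  have "leader n E a"
    unfolding leader_def
  proof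
    assume "\<exists>w<a. twin n E w a"
    then obtain w where "w < a" "twin n E w a" by blast
    then show False using twin_trans[of w a v] t m a assms by simp
  qed
  then show thesis using that a t m by blast
qed

lemma cls_eq:
  assumes "twin n E a v" "\<And>w. w < a \<Longrightarrow> \<not> twin n E w v" "a < n"
  shows "cls n E v = card {u. u < a \<and> leader n E u}"
proof -
  have "u < n \<and> leader n E u \<and> \<not> (\<exists>w<Suc u. twin n E w v) \<longleftrightarrow> u < a \<and> leader n E u" for u
  proof
    assume "u < n \<and> leader n E u \<and> \<not> (\<exists>w<Suc u. twin n E w v)"
    then have "\<not> a < Suc u" "leader n E u" using assms(1) by auto
    then show "u < a \<and> leader n E u" by simp
  next
    assume "u < a \<and> leader n E u"
    then show "u < n \<and> leader n E u \<and> \<not> (\<exists>w<Suc u. twin n E w v)"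
      using assms(2,3) by auto
  qed
  then show ?thesis unfolding cls_def card_sum_of_bool by simp
qed

lemma cls_less: "v < n \<Longrightarrow> cls n E v < ncls n E"
proof -
  assume "v < n"
  then obtain a where a: "a < n" "leader n E a" "twin n E a v" "\<And>w. w < a \<Longrightarrow> \<not> twin n E w v"
    using ex_leader by blast
  have "card {u. u < a \<and> leader n E u} < card {u. u < n \<and> leader n E u}"
    by (rule psubset_card_mono) (use a in auto)
  then show ?thesis using cls_eq[OF a(3,4,1)] unfolding ncls_def card_sum_of_bool by simp
qed

text \<open>The number of leaders before a leader strictly increases from one leader to the next, so
  it identifies the leader.\<close>

lemma cls_twin:
  assumes "u < n" "v < n" "cls n E u = cls n E v"
  shows "twin n E u v"
proof -
  obtain a where a: "a < n" "leader n E a" "twin n E a u" "\<And>w. w < a \<Longrightarrow> \<not> twin n E w u"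
    using ex_leader[OF assms(1)] by blast
  obtain b where b: "b < n" "leader n E b" "twin n E b v" "\<And>w. w < b \<Longrightarrow> \<not> twin n E w v"
    using ex_leader[OF assms(2)] by blast
  have less: "card {u. u < x \<and> leader n E u} < card {u. u < y \<and> leader n E u}"
    if "leader n E x" "x < y" for x y
    by (rule psubset_card_mono) (use that in auto)
  have "card {u. u < a \<and> leader n E u} = card {u. u < b \<and> leader n E u}"
    using cls_eq[OF a(3,4,1)] cls_eq[OF b(3,4,1)] assms(3) by simp
  then have "a = b" using less[of a b] less[of b a] a(2) b(2) by (cases a b rule: linorder_cases) auto
  then show ?thesis using twin_trans[of u a v] twin_sym[OF a(3)] b(3) a(1) assms by simp
qed

section \<open>Signs, degrees and alliances in terms of classes\<close>

lemma E_iff_rel: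
  assumes "u < n" "w < n" "u \<noteq> w" "\<sigma> \<noteq> 0"
  shows "E u w = \<sigma> \<longleftrightarrow> rel n E \<sigma> (cls n E u) (cls n E w)"
proof
  assume "E u w = \<sigma>"
  then show "rel n E \<sigma> (cls n E u) (cls n E w)" using assms by (auto simp: rel_def)
next
  assume "rel n E \<sigma> (cls n E u) (cls n E w)"
  then obtain a b where ab: "a < n" "b < n" "E a b = \<sigma>" "cls n E a = cls n E u" "cls n E b = cls n E w"
    by (auto simp: rel_def)
  then have "a \<noteq> b" using diag assms(4) by auto
  have t: "twin n E a u" "twin n E b w" using cls_twin ab assms by auto
  have a: "E x a = E x u" if "x < n" "x \<noteq> a" "x \<noteq> u" for x
    using t(1) that by (auto simp: twin_def)
  have b: "E x b = E x w" if "x < n" "x \<noteq> b" "x \<noteq> w" for x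
    using t(2) that by (auto simp: twin_def)
  show "E u w = \<sigma>"
  \<comment> \<open>The witness pair is moved to \<open>u\<close> and \<open>w\<close> one end at a
    time. Moving \<open>a\<close> to \<open>u\<close> first requires \<open>b \<noteq> u\<close>,
    because twins are not compared on their own rows.\<close>
  proof (cases "b = u")
    case False
    have "E u b = \<sigma>" using a[OF ab(2)] False \<open>a \<noteq> b\<close> ab sym[of b a] sym[of b u] assms by auto
    then show ?thesis using b[of u] False assms by auto
  next
    case bu: True
    show ?thesis
    \<comment> \<open>For \<open>b = u\<close> the other end moves first. If also
      \<open>a = w\<close>, the witness is the given pair reversed, and symmetry settles it.\<close>
    proof (cases "a = w")
      case True
      then show ?thesis using bu ab sym[of u w] assms by auto
    next
      case False
      have "E a w = \<sigma>" using b[OF ab(1)] False \<open>a \<noteq> b\<close> ab by auto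
      then show ?thesis using a[of w] False assms sym[of a w] sym[of u w] ab by auto
    qed
  qed
qed

lemma card_cls:
  assumes "S \<subseteq> {..<n}"
  shows "card {u \<in> S. R (cls n E u)} = (\<Sum>i<ncls n E. of_bool (R i) * card {u \<in> S. cls n E u = i})"
proof -
  have f: "finite S" using assms finite_subset by blast
  have "card {u \<in> S. R (cls n E u)} = (\<Sum>u\<in>S. of_bool (R (cls n E u)))"
    using f by (simp add: Int_def)
  also have "\<dots> = (\<Sum>i<ncls n E. \<Sum>u\<in>{u \<in> S. cls n E u = i}. of_bool (R (cls n E u)))"
    by (rule sum.group[symmetric]) (use f assms cls_less in auto)
  also have "\<dots> = (\<Sum>i<ncls n E. of_bool (R i) * card {u \<in> S. cls n E u = i})"
    by (rule sum.cong) (auto simp: mult.commute)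
  finally show ?thesis .
qed

lemma csize_card: "csize n E j = card {u \<in> {..<n}. cls n E u = j}"
  unfolding csize_def card_sum_of_bool by simp

lemma card_split:
  assumes "S \<subseteq> {..<n}"
  shows "card S = (\<Sum>i<ncls n E. card {u \<in> S. cls n E u = i})"
  using card_cls[OF assms, of "\<lambda>_. True"] by simp

lemma deg_in:
  assumes S: "S \<subseteq> {..<n}" and w: "w < n" "w \<notin> S" and "\<sigma> \<noteq> 0"
  shows "card {u \<in> S. E u w = \<sigma>} =
    (\<Sum>i<ncls n E. of_bool (rel n E \<sigma> i (cls n E w)) * card {u \<in> S. cls n E u = i})"
proof -
  have "{u \<in> S. E u w = \<sigma>} = {u \<in> S. rel n E \<sigma> (cls n E u) (cls n E w)}"
    using E_iff_rel[of _ w \<sigma>] S w assms(4) by blast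
  then show ?thesis using card_cls[OF S, of "\<lambda>i. rel n E \<sigma> i (cls n E w)"] by simp
qed

text \<open>Counting whole classes positively joined to that of \<open>w\<close> finds the positive
  neighbours inside and outside \<open>S\<close>, and also \<open>w\<close> itself if its class is
  positively joined to itself, although \<open>E w w = 0\<close>.\<close>

lemma deg_out:
  assumes S: "S \<subseteq> {..<n}" and w: "w < n" "w \<notin> S"
  shows "card {u. u < n \<and> u \<notin> S \<and> E u w = 1} + card {u \<in> S. E u w = 1}
      + of_bool (rel n E 1 (cls n E w) (cls n E w)) =
    (\<Sum>i<ncls n E. of_bool (rel n E 1 i (cls n E w)) * csize n E i)"
proof -
  let ?j = "cls n E w"
  let ?A = "{u. u < n \<and> u \<notin> S \<and> E u w = 1}" and ?B = "{u \<in> S. E u w = 1}"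
  have fin: "finite ?A" "finite ?B" using finite_subset[OF S] by auto
  have "{u \<in> {..<n}. rel n E 1 (cls n E u) ?j} = ?A \<union> ?B \<union> (if rel n E 1 ?j ?j then {w} else {})"
    (is "?L = ?R")
  proof (rule set_eqI)
    fix u show "u \<in> ?L \<longleftrightarrow> u \<in> ?R"
      using E_iff_rel[of u w 1] S w diag[of w] by (cases "u = w") auto
  qed
  moreover have "card ?R = card ?A + card ?B + of_bool (rel n E 1 ?j ?j)"
  proof -
    have "card (?A \<union> ?B) = card ?A + card ?B" using fin by (intro card_Un_disjoint) auto
    moreover have "w \<notin> ?A \<union> ?B" using w diag by auto
    ultimately show ?thesis using fin by simp
  qed
  ultimately show ?thesis
    using card_cls[of "{..<n}" "\<lambda>i. rel n E 1 i ?j"] by (simp add: csize_card)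
qed

lemma adj_in:
  assumes S: "S \<subseteq> {..<n}" and w: "w < n" "w \<notin> S"
  shows "(\<exists>u\<in>S. E u w \<noteq> 0) \<longleftrightarrow> 0 < card {u \<in> S. E u w = 1} + card {u \<in> S. E u w = 2}"
proof -
  have "E u w \<noteq> 0 \<longleftrightarrow> E u w = 1 \<or> E u w = 2" if "u \<in> S" for u
    using le2[of u w] w S that by (auto simp: le_Suc_eq numeral_2_eq_2)
  then have "(\<exists>u\<in>S. E u w \<noteq> 0) \<longleftrightarrow> {u \<in> S. E u w = 1} \<noteq> {} \<or> {u \<in> S. E u w = 2} \<noteq> {}" by blast
  then show ?thesis using finite_subset[OF S] by (simp add: card_gt_0_iff)
qed

text \<open>By the degree formulas the condition at \<open>w\<close> depends on its class alone, and
  a class has a vertex outside \<open>S\<close> exactly when it is not exhausted.\<close>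

lemma alliance_iff_good:
  assumes S: "S \<subseteq> {..<n}"
  shows "alliance n E S \<longleftrightarrow> good n E (\<lambda>j. card {u \<in> S. cls n E u = j})"
proof -
  define x where "x j = card {u \<in> S. cls n E u = j}" for j
  define K where "K j \<longleftrightarrow> (0 < (\<Sum>i<ncls n E. of_bool (rel n E 1 i j) * x i) + (\<Sum>i<ncls n E. of_bool (rel n E 2 i j) * x i) \<longrightarrow>
       (\<Sum>i<ncls n E. of_bool (rel n E 1 i j) * x i) \<le> (\<Sum>i<ncls n E. of_bool (rel n E 2 i j) * x i) \<and>
       (\<Sum>i<ncls n E. of_bool (rel n E 1 i j) * csize n E i) <
         (\<Sum>i<ncls n E. of_bool (rel n E 2 i j) * x i) + (\<Sum>i<ncls n E. of_bool (rel n E 1 i j) * x i)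
         + of_bool (rel n E 1 j j))" for j
  have le: "x j \<le> csize n E j" for j
    unfolding x_def csize_card using S by (intro card_mono) auto
  have lt: "x j < csize n E j \<longleftrightarrow> (\<exists>w<n. w \<notin> S \<and> cls n E w = j)" for j
  proof -
    have sub: "{u \<in> S. cls n E u = j} \<subseteq> {u \<in> {..<n}. cls n E u = j}" using S by auto
    have "x j = csize n E j \<longleftrightarrow> {u \<in> S. cls n E u = j} = {u \<in> {..<n}. cls n E u = j}"
      unfolding x_def csize_card by (rule iffI, rule card_subset_eq[OF _ sub]) simp_all
    then have "x j < csize n E j \<longleftrightarrow> {u \<in> S. cls n E u = j} \<noteq> {u \<in> {..<n}. cls n E u = j}"
      using le[of j] by linarith
    then show ?thesis using S by auto
  qed
  have "alliance n E S \<longleftrightarrow> (\<forall>w<n. w \<notin> S \<longrightarrow> K (cls n E w))"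
  proof -
    have "((\<exists>u\<in>S. E u w \<noteq> 0) \<longrightarrow>
       card {u \<in> S. E u w = 1} \<le> card {u \<in> S. E u w = 2} \<and>
       card {u. u < n \<and> u \<notin> S \<and> E u w = 1} + 1 \<le> card {u \<in> S. E u w = 2}) \<longleftrightarrow> K (cls n E w)"
      if w: "w < n" "w \<notin> S" for w
    proof -
      have ne: "(1::nat) \<noteq> 0" "(2::nat) \<noteq> 0" by simp_all
      show ?thesis
        unfolding K_def x_def adj_in[OF S w] deg_in[OF S w ne(1), symmetric]
          deg_in[OF S w ne(2), symmetric] deg_out[OF S w, symmetric]
        by (intro imp_cong refl) arith
    qed
    then show ?thesis unfolding alliance_def by simp
  qed
  also have "\<dots> \<longleftrightarrow> (\<forall>j<ncls n E. x j < csize n E j \<longrightarrow> K j)"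
    unfolding lt using cls_less by auto
  also have "\<dots> \<longleftrightarrow> (\<forall>j<ncls n E. x j \<le> csize n E j \<and> (x j < csize n E j \<longrightarrow> K j))"
    using le by simp
  also have "\<dots> \<longleftrightarrow> good n E x"
    unfolding good_def K_def by (simp only: imp_conjL)
  finally show ?thesis unfolding x_def .
qed

lemma good_cong: "(\<And>j. j < ncls n E \<Longrightarrow> x j = y j) \<Longrightarrow> good n E x \<longleftrightarrow> good n E y"
  unfolding good_def by simp

text \<open>This is interchangeability: for the converse any \<open>x j\<close> members of class
  \<open>j\<close> may be chosen, and the union has the prescribed counts because the classes are
  disjoint.\<close>

lemma ex_alliance_iff:
  "(\<exists>S\<subseteq>{..<n}. alliance n E S \<and> 1 \<le> card S \<and> card S \<le> k) \<longleftrightarrow>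
   (\<exists>x. good n E x \<and> 1 \<le> (\<Sum>i<ncls n E. x i) \<and> (\<Sum>i<ncls n E. x i) \<le> k)"
proof
  assume "\<exists>S\<subseteq>{..<n}. alliance n E S \<and> 1 \<le> card S \<and> card S \<le> k"
  then obtain S where S: "S \<subseteq> {..<n}" "alliance n E S" "1 \<le> card S" "card S \<le> k" by blast
  show "\<exists>x. good n E x \<and> 1 \<le> (\<Sum>i<ncls n E. x i) \<and> (\<Sum>i<ncls n E. x i) \<le> k"
    by (rule exI[of _ "\<lambda>j. card {u \<in> S. cls n E u = j}"])
      (use S alliance_iff_good[OF S(1)] card_split[OF S(1)] in simp)
next
  assume "\<exists>x. good n E x \<and> 1 \<le> (\<Sum>i<ncls n E. x i) \<and> (\<Sum>i<ncls n E. x i) \<le> k"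
  then obtain x where x: "good n E x" "1 \<le> (\<Sum>i<ncls n E. x i)" "(\<Sum>i<ncls n E. x i) \<le> k" by blast
  have "\<exists>T. T \<subseteq> {u \<in> {..<n}. cls n E u = j} \<and> card T = x j" if "j < ncls n E" for j
  proof -
    have "x j \<le> card {u \<in> {..<n}. cls n E u = j}"
      using x(1) that by (simp add: good_def csize_card)
    then show ?thesis by (meson obtain_subset_with_card_n)
  qed
  then obtain T where T: "\<And>j. j < ncls n E \<Longrightarrow> T j \<subseteq> {u \<in> {..<n}. cls n E u = j} \<and> card (T j) = x j"
    by metis
  define S where "S = (\<Union>j<ncls n E. T j)"
  have S: "S \<subseteq> {..<n}" using T by (auto simp: S_def)
  have "{u \<in> S. cls n E u = j} = T j" if "j < ncls n E" for j
    using T that by (auto simp: S_def)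
  then have c: "card {u \<in> S. cls n E u = j} = x j" if "j < ncls n E" for j using T that by simp
  have "alliance n E S"
    unfolding alliance_iff_good[OF S] using good_cong[of "\<lambda>j. card {u \<in> S. cls n E u = j}" x] c x(1) by blast
  moreover have "card S = (\<Sum>i<ncls n E. x i)" using card_split[OF S] c by simp
  ultimately show "\<exists>S\<subseteq>{..<n}. alliance n E S \<and> 1 \<le> card S \<and> card S \<le> k" using S x by auto
qed

end

section \<open>Signed graphs as matrices\<close>

locale enumerated_sgraph =
  fixes G :: "'a sgraph" and vs :: "'a list"
  assumes G: "signed_graph G" and vs: "distinct vs" "set vs = verts G"
begin

abbreviation n where "n \<equiv> length vs"

definition E :: "nat \<Rightarrow> nat \<Rightarrow> nat" where "E u v = edge_sign G (vs ! u) (vs ! v)"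

lemma E_sym: "E u v = E v u"
  by (simp add: E_def edge_sign_def insert_commute)

lemma loop: "{v, v} \<notin> pos_edges G" "{v, v} \<notin> neg_edges G"
  using G by (auto simp: signed_graph_def)

sublocale signed_matrix n E
  by unfold_locales (use E_sym loop in \<open>auto simp: E_def edge_sign_def\<close>)

lemma pos_iff: "vs ! u \<in> pos_nbrs G (vs ! w) \<longleftrightarrow> E u w = 1"
  by (simp add: pos_nbrs_def E_def edge_sign_def)

text \<open>\<open>edge_sign\<close> tests for a positive edge first, so the disjointness of the two
  edge sets enters here.\<close>

lemma neg_iff: "vs ! u \<in> neg_nbrs G (vs ! w) \<longleftrightarrow> E u w = 2"
  using G by (auto simp: signed_graph_def neg_nbrs_def E_def edge_sign_def)

lemma nbrs_subset: "pos_nbrs G v \<subseteq> verts G" "neg_nbrs G v \<subseteq> verts G"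
  using G by (auto simp: signed_graph_def pos_nbrs_def neg_nbrs_def)

lemma verts_eq: "verts G = (!) vs ` {..<n}"
  unfolding vs(2)[symmetric] set_conv_nth by auto

lemma inj: "S \<subseteq> {..<n} \<Longrightarrow> inj_on ((!) vs) S"
  by (rule inj_on_nth[OF vs(1)]) auto

lemma nth_mem_image: "S \<subseteq> {..<n} \<Longrightarrow> w < n \<Longrightarrow> vs ! w \<in> (!) vs ` S \<longleftrightarrow> w \<in> S"
  by (rule inj_on_image_mem_iff[OF inj[OF order_refl]]) auto

lemma deg_image:
  assumes S: "S \<subseteq> {..<n}"
  shows "pos_deg G ((!) vs ` S) (vs ! w) = card {u \<in> S. E u w = 1}"
    and "neg_deg G ((!) vs ` S) (vs ! w) = card {u \<in> S. E u w = 2}"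
proof -
  have "pos_nbrs G (vs ! w) \<inter> (!) vs ` S = (!) vs ` {u \<in> S. E u w = 1}"
    by (auto simp: pos_iff)
  then show "pos_deg G ((!) vs ` S) (vs ! w) = card {u \<in> S. E u w = 1}"
    unfolding pos_deg_def using S by (simp add: card_image[OF inj_on_subset[OF inj[OF S]]])
  have "neg_nbrs G (vs ! w) \<inter> (!) vs ` S = (!) vs ` {u \<in> S. E u w = 2}"
    by (auto simp: neg_iff)
  then show "neg_deg G ((!) vs ` S) (vs ! w) = card {u \<in> S. E u w = 2}"
    unfolding neg_deg_def using S by (simp add: card_image[OF inj_on_subset[OF inj[OF S]]])
qed

lemma boundary_iff:
  assumes S: "S \<subseteq> {..<n}" and w: "w < n"
  shows "vs ! w \<in> boundary G ((!) vs ` S) \<longleftrightarrow> w \<notin> S \<and> (\<exists>u\<in>S. E u w \<noteq> 0)"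
proof -
  have "vs ! w \<in> nbrs G (vs ! u) \<longleftrightarrow> E u w \<noteq> 0" if "u \<in> S" for u
  proof -
    have "E w u \<noteq> 0 \<longleftrightarrow> E w u = 1 \<or> E w u = 2"
      by (auto simp: E_def edge_sign_def)
    then show ?thesis unfolding nbrs_def using pos_iff[of w u] neg_iff[of w u] E_sym[of u w] by simp
  qed
  then show ?thesis unfolding boundary_def using nth_mem_image[OF S w] by auto
qed

lemma offensive_alliance_iff:
  assumes S: "S \<subseteq> {..<n}"
  shows "offensive_alliance G ((!) vs ` S) \<longleftrightarrow> alliance n E S"
proof -
  have sub: "(!) vs ` S \<subseteq> verts G" using S verts_eq by auto
  have compl: "verts G - (!) vs ` S = (!) vs ` ({..<n} - S)"
    unfolding verts_eq using inj[of "{..<n}"] S by (simp add: inj_on_image_set_diff)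
  have "boundary G ((!) vs ` S) \<subseteq> verts G"
    using nbrs_subset G unfolding boundary_def nbrs_def pos_nbrs_def neg_nbrs_def signed_graph_def
    by auto
  then have "offensive_alliance G ((!) vs ` S) \<longleftrightarrow> (\<forall>w<n. vs ! w \<in> boundary G ((!) vs ` S) \<longrightarrow>
        pos_deg G ((!) vs ` S) (vs ! w) \<le> neg_deg G ((!) vs ` S) (vs ! w) \<and>
        pos_deg G (verts G - (!) vs ` S) (vs ! w) + 1 \<le> neg_deg G ((!) vs ` S) (vs ! w))"
    unfolding offensive_alliance_def using sub verts_eq by auto
  moreover have "{u \<in> {..<n} - S. E u w = 1} = {u. u < n \<and> u \<notin> S \<and> E u w = 1}" for w
    by auto
  ultimately show ?thesis
    unfolding alliance_def compl deg_image[OF S] deg_image[of "{..<n} - S", OF Diff_subset]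
    using boundary_iff[OF S] by (simp add: imp_conjL)
qed

lemma question_iff:
  "oa_question (G, k) \<longleftrightarrow> (\<exists>S\<subseteq>{..<n}. alliance n E S \<and> 1 \<le> card S \<and> card S \<le> k)"
proof
  assume "oa_question (G, k)"
  then obtain A where A: "offensive_alliance G A" "1 \<le> card A" "card A \<le> k"
    by (auto simp: oa_question_def)
  then have "A \<subseteq> (!) vs ` {..<n}" using verts_eq by (simp add: offensive_alliance_def)
  then obtain S where S: "S \<subseteq> {..<n}" "A = (!) vs ` S" by (auto simp: subset_image_iff)
  then show "\<exists>S\<subseteq>{..<n}. alliance n E S \<and> 1 \<le> card S \<and> card S \<le> k"
    using A offensive_alliance_iff[OF S(1)] card_image[OF inj[OF S(1)]] by auto
next
  assume "\<exists>S\<subseteq>{..<n}. alliance n E S \<and> 1 \<le> card S \<and> card S \<le> k"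
  then obtain S where S: "S \<subseteq> {..<n}" "alliance n E S" "1 \<le> card S" "card S \<le> k" by blast
  then show "oa_question (G, k)"
    using offensive_alliance_iff[OF S(1)] card_image[OF inj[OF S(1)]] by (auto simp: oa_question_def)
qed

lemma twin_if_same_type:
  assumes "u < n" "v < n" "same_signed_type G (vs ! u) (vs ! v)"
  shows "twin n E u v"
  unfolding twin_def
proof (intro allI impI)
  fix x assume x: "x < n"
  show "x = u \<or> x = v \<or> E x u = E x v"
  proof (cases "x = u \<or> x = v")
    case False
    then have "vs ! x \<noteq> vs ! u" "vs ! x \<noteq> vs ! v"
      using vs(1) x assms by (auto simp: nth_eq_iff_index_eq)
    then have "E x u = 1 \<longleftrightarrow> E x v = 1" "E x u = 2 \<longleftrightarrow> E x v = 2"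
      using assms(3) pos_iff[of x] neg_iff[of x] unfolding same_signed_type_def by blast+
    then show ?thesis using le2[of x u] le2[of x v] x assms by linarith
  qed auto
qed

text \<open>Of two leaders in one part of an admissible partition the larger would have a smaller
  twin, so leaders inject into the parts. This turns a time bound in the computed number of classes
  into one in the parameter.\<close>

lemma ncls_le: "ncls n E \<le> signed_neighborhood_diversity G"
proof -
  let ?R = "\<lambda>k. \<exists>P. partition_on (verts G) P \<and> card P = k \<and>
        (\<forall>C\<in>P. \<forall>u\<in>C. \<forall>v\<in>C. same_signed_type G u v)"
  \<comment> \<open>Singletons form an admissible partition, so the least number of parts is
    attained.\<close>
  have "partition_on (verts G) ((\<lambda>v. {v}) ` verts G)"
    by (auto simp: partition_on_def disjoint_def)
  moreover have "\<forall>C\<in>(\<lambda>v. {v}) ` verts G. \<forall>u\<in>C. \<forall>v\<in>C. same_signed_type G u v"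
    by (auto simp: same_signed_type_def)
  ultimately have "?R (card ((\<lambda>v. {v}) ` verts G))" by blast
  then have "?R (signed_neighborhood_diversity G)"
    unfolding signed_neighborhood_diversity_def by (rule LeastI)
  then obtain P where P: "partition_on (verts G) P" "card P = signed_neighborhood_diversity G"
    "\<And>C u v. C \<in> P \<Longrightarrow> u \<in> C \<Longrightarrow> v \<in> C \<Longrightarrow> same_signed_type G u v" by blast
  have finP: "finite P" using P(1) G finite_elements by (auto simp: signed_graph_def)
  have "\<exists>C\<in>P. vs ! u \<in> C" if "u < n" for u
    using P(1) that verts_eq by (auto simp: partition_on_def)
  then obtain h where h: "\<And>u. u < n \<Longrightarrow> h u \<in> P \<and> vs ! u \<in> h u" by metis
  have no: "h u \<noteq> h v" if "u < v" "v < n" "leader n E v" for u v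
  proof
    assume "h u = h v"
    then have "same_signed_type G (vs ! u) (vs ! v)" using P(3)[of "h v" "vs ! u" "vs ! v"] h[of u] h[of v] that by simp
    then have "twin n E u v" using twin_if_same_type that by simp
    then show False using that by (auto simp: leader_def)
  qed
  have "inj_on h {u. u < n \<and> leader n E u}"
  proof (rule inj_onI)
    fix u v assume "u \<in> {u. u < n \<and> leader n E u}" "v \<in> {u. u < n \<and> leader n E u}" "h u = h v"
    then show "u = v" using no[of u v] no[of v u] by (cases u v rule: linorder_cases) auto
  qed
  then have "card {u. u < n \<and> leader n E u} \<le> card P"
    by (rule card_inj_on_le) (use h finP in auto)
  then show ?thesis unfolding ncls_def card_sum_of_bool P(2) .
qed

end

section \<open>The algorithm\<close>

definition bNot :: "tm \<Rightarrow> tm" where "bNot t = Sub (C 1) t"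
definition bAnd :: "tm \<Rightarrow> tm \<Rightarrow> tm" where "bAnd s t = bNot (Add (bNot s) (bNot t))"
definition bOr :: "tm \<Rightarrow> tm \<Rightarrow> tm" where "bOr s t = bNot (bNot (Add s t))"
definition bLe :: "tm \<Rightarrow> tm \<Rightarrow> tm" where "bLe s t = bNot (Sub s t)"
definition bLess :: "tm \<Rightarrow> tm \<Rightarrow> tm" where "bLess s t = bNot (bLe t s)"
definition bEq :: "tm \<Rightarrow> tm \<Rightarrow> tm" where "bEq s t = bAnd (bLe s t) (bLe t s)"
text \<open>The sum counts witnesses, possibly with multiplicity; truncated \<open>1 - t\<close>
  negates, so a double negation reduces the count to 0 or 1.\<close>

definition bEx :: "nat \<Rightarrow> tm \<Rightarrow> tm \<Rightarrow> tm" where "bEx x b t = bNot (bNot (Sm x b t))"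
definition bAll :: "nat \<Rightarrow> tm \<Rightarrow> tm \<Rightarrow> tm" where "bAll x b t = bNot (Sm x b (bNot t))"
text \<open>Truncated subtraction yields the minimum without a loop, which matters for
  \<open>k\<close>, a number not bounded by \<open>M\<close>.\<close>

definition tMin :: "tm \<Rightarrow> tm \<Rightarrow> tm" where "tMin s t = Sub s (Sub s t)"
definition tMod :: "tm \<Rightarrow> tm \<Rightarrow> tm" where "tMod s t = Sub s (Mul (Div s t) t)"

lemma tev_bNot [simp]: "tev \<alpha> \<rho> (bNot t) = of_bool (tev \<alpha> \<rho> t = 0)"
  by (simp add: bNot_def)
lemma tev_bAnd [simp]: "tev \<alpha> \<rho> (bAnd s t) = of_bool (tev \<alpha> \<rho> s \<noteq> 0 \<and> tev \<alpha> \<rho> t \<noteq> 0)"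
  by (simp add: bAnd_def)
lemma tev_bOr [simp]: "tev \<alpha> \<rho> (bOr s t) = of_bool (tev \<alpha> \<rho> s \<noteq> 0 \<or> tev \<alpha> \<rho> t \<noteq> 0)"
  by (simp add: bOr_def)
lemma tev_bLe [simp]: "tev \<alpha> \<rho> (bLe s t) = of_bool (tev \<alpha> \<rho> s \<le> tev \<alpha> \<rho> t)"
  by (simp add: bLe_def)
lemma tev_bLess [simp]: "tev \<alpha> \<rho> (bLess s t) = of_bool (tev \<alpha> \<rho> s < tev \<alpha> \<rho> t)"
  by (simp add: bLess_def not_le)
lemma tev_bEq [simp]: "tev \<alpha> \<rho> (bEq s t) = of_bool (tev \<alpha> \<rho> s = tev \<alpha> \<rho> t)"
  by (auto simp: bEq_def)
lemma tev_bEx [simp]: "tev \<alpha> \<rho> (bEx x b t) = of_bool (\<exists>v<tev \<alpha> \<rho> b. tev \<alpha> (\<rho>(x := v)) t \<noteq> 0)"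
  by (auto simp: bEx_def)
lemma tev_bAll [simp]: "tev \<alpha> \<rho> (bAll x b t) = of_bool (\<forall>v<tev \<alpha> \<rho> b. tev \<alpha> (\<rho>(x := v)) t \<noteq> 0)"
  by (auto simp: bAll_def)
lemma tev_tMin [simp]: "tev \<alpha> \<rho> (tMin s t) = min (tev \<alpha> \<rho> s) (tev \<alpha> \<rho> t)"
  by (auto simp: tMin_def)
lemma tev_tMod [simp]: "tev \<alpha> \<rho> (tMod s t) = tev \<alpha> \<rho> s mod tev \<alpha> \<rho> t"
  by (simp add: tMod_def minus_div_mult_eq_mod)

lemma ok_bNot [simp]: "ok M \<alpha> \<rho> (bNot t) \<longleftrightarrow> ok M \<alpha> \<rho> t"
  by (simp add: bNot_def)
lemma ok_bAnd [simp]: "ok M \<alpha> \<rho> (bAnd s t) \<longleftrightarrow> ok M \<alpha> \<rho> s \<and> ok M \<alpha> \<rho> t"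
  by (simp add: bAnd_def)
lemma ok_bOr [simp]: "ok M \<alpha> \<rho> (bOr s t) \<longleftrightarrow> ok M \<alpha> \<rho> s \<and> ok M \<alpha> \<rho> t"
  by (simp add: bOr_def)
lemma ok_bLe [simp]: "ok M \<alpha> \<rho> (bLe s t) \<longleftrightarrow> ok M \<alpha> \<rho> s \<and> ok M \<alpha> \<rho> t"
  by (simp add: bLe_def)
lemma ok_bLess [simp]: "ok M \<alpha> \<rho> (bLess s t) \<longleftrightarrow> ok M \<alpha> \<rho> s \<and> ok M \<alpha> \<rho> t"
  by (auto simp: bLess_def)
lemma ok_bEq [simp]: "ok M \<alpha> \<rho> (bEq s t) \<longleftrightarrow> ok M \<alpha> \<rho> s \<and> ok M \<alpha> \<rho> t"
  by (auto simp: bEq_def)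
lemma ok_bEx [simp]: "ok M \<alpha> \<rho> (bEx x b t) \<longleftrightarrow> ok M \<alpha> \<rho> (Sm x b t)"
  by (simp add: bEx_def)
lemma ok_bAll [simp]: "ok M \<alpha> \<rho> (bAll x b t) \<longleftrightarrow> ok M \<alpha> \<rho> (Sm x b t)"
  by (simp add: bAll_def)
lemma ok_tMin [simp]: "ok M \<alpha> \<rho> (tMin s t) \<longleftrightarrow> ok M \<alpha> \<rho> s \<and> ok M \<alpha> \<rho> t"
  by (auto simp: tMin_def)
lemma ok_tMod [simp]: "ok M \<alpha> \<rho> (tMod s t) \<longleftrightarrow> ok M \<alpha> \<rho> (Div s t)"
  by (auto simp: tMod_def intro: order_trans[OF div_le_dividend])

text \<open>Array 0 holds the input. The arrays 2 to 13 are filled in turn; their contents are given by \<open>val\<close> below.\<close>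

definition tK where "tK = A 0 (C 0)"
definition tN where "tN = A 0 (C 1)"
definition tE where "tE s t = A 0 (Add (C 2) (Add (Mul s tN) t))"
text \<open>Variable 6 is bound here, so the arguments must not mention it.\<close>

definition tTwin where "tTwin s t = bAll 6 tN (bOr (bEq (V 6) s) (bOr (bEq (V 6) t) (bEq (tE (V 6) s) (tE (V 6) t))))"
definition tD where "tD = A 3 (C 0)"
definition tQ where "tQ = Add (Mul (C 2) tD) (C 1)"
definition tRows where "tRows = Mul (C 6) tD"
definition tBase where "tBase = Add (Mul (C 2) tQ) (C 1)"
definition tW where "tW = A 10 tRows"
definition tRel where "tRel a i j = A a (Add (Mul i tD) j)"
definition tDig where "tDig s r = tMod (Div s (A 10 r)) tBase"
definition tCoef where "tCoef a r i = A a (Add (Mul r tQ) i)"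
definition tTab where "tTab l s = A 13 (Add (Mul l tW) s)"
definition tBit where "tBit l z i = Add (Mul (bLess i tD) (tMod (Div z (A 9 i)) (C 2)))
  (Mul (bLe tD i) (tMod (Div (A 8 i) (A 9 (Sub tN l))) (C 2)))"

definition fillLeader where "fillLeader = (tN, (bNot (bEx 3 (V 2) (tTwin (V 3) (V 2)))))"
definition fillD where "fillD = ((C 1), (Sm 3 tN (A 2 (V 3))))"
definition fillCls where "fillCls = (tN, (Sm 3 tN (bAnd (A 2 (V 3))
   (bNot (bEx 4 (Add (V 3) (C 1)) (tTwin (V 4) (V 2)))))))"
definition fillSize where "fillSize = (tD, (Sm 3 tN (bEq (A 4 (V 3)) (V 2))))"
definition fillRel where "fillRel \<sigma> = ((Mul tD tD), (bEx 3 tN (bEx 4 tN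
   (bAnd (bEq (A 4 (V 3)) (Div (V 2) tD)) (bAnd (bEq (A 4 (V 4)) (tMod (V 2) tD)) (bEq (tE (V 3) (V 4)) (C \<sigma>)))))))"
definition fillY where "fillY = (tQ, (Add
   (Mul (bAnd (bLe tD (V 2)) (bLess (V 2) (Mul (C 2) tD))) (A 5 (Sub (V 2) tD)))
   (Mul (bLe (Mul (C 2) tD) (V 2)) (tMin tN tK))))"
text \<open>At index 0 the truncated predecessor is 0 again, an entry not yet filled; the factor 0
  discards what is read there.\<close>

definition fillPow where "fillPow a bound b = (bound, (Add (bEq (V 2) (C 0))
   (Mul (bLess (C 0) (V 2)) (Mul b (A a (Sub (V 2) (C 1)))))))"

text \<open>In the rows, unknown \<open>i < d\<close> is the number of chosen vertices of class \<open>i\<close>, unknown \<open>d + i\<close>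
  is the size of class \<open>i\<close>, and unknown \<open>2 * d\<close> is the budget. Row \<open>6 * j + c\<close> is the
  \<open>c\<close>-th row of class \<open>j\<close>, the last two kinds being the same for all classes.\<close>

definition posC :: "nat \<Rightarrow> (nat \<Rightarrow> nat \<Rightarrow> nat) \<Rightarrow> nat \<Rightarrow> nat \<Rightarrow> nat" where
  "posC n E r i = (let d = ncls n E; j = r div 6; c = r mod 6 in
     of_bool (i < d \<and> (c = 0 \<and> i = j \<or> (c = 1 \<or> c = 2 \<or> c = 3) \<and> rel n E 2 i j \<or> 4 \<le> c)) +
     of_bool (i < d \<and> (c = 2 \<or> c = 3) \<and> rel n E 1 i j))"

definition negC :: "nat \<Rightarrow> (nat \<Rightarrow> nat \<Rightarrow> nat) \<Rightarrow> nat \<Rightarrow> nat \<Rightarrow> nat" where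
  "negC n E r i = (let d = ncls n E; j = r div 6; c = r mod 6 in
     of_bool (c = 0 \<and> i = d + j \<or> c = 1 \<and> i < d \<and> rel n E 1 i j \<or>
       c = 2 \<and> d \<le> i \<and> i < 2 * d \<and> rel n E 1 (i - d) j \<or> c = 4 \<and> i = 2 * d))"

definition fillPos where "fillPos = (let i = tMod (V 2) tQ; r = Div (V 2) tQ; j = Div r (C 6); c = tMod r (C 6) in
   ((Mul tRows tQ), (Add
     (bAnd (bLess i tD) (bOr (bAnd (bEq c (C 0)) (bEq i j))
       (bOr (bAnd (bOr (bEq c (C 1)) (bOr (bEq c (C 2)) (bEq c (C 3)))) (tRel 7 i j)) (bLe (C 4) c))))
     (bAnd (bLess i tD) (bAnd (bOr (bEq c (C 2)) (bEq c (C 3))) (tRel 6 i j))))))"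
definition fillNeg where "fillNeg = (let i = tMod (V 2) tQ; r = Div (V 2) tQ; j = Div r (C 6); c = tMod r (C 6) in
   ((Mul tRows tQ), 
     (bOr (bAnd (bEq c (C 0)) (bEq i (Add tD j)))
     (bOr (bAnd (bEq c (C 1)) (bAnd (bLess i tD) (tRel 6 i j)))
     (bOr (bAnd (bEq c (C 2)) (bAnd (bLe tD i) (bAnd (bLess i (Mul (C 2) tD)) (tRel 6 (Sub i tD) j))))
         (bAnd (bEq c (C 4)) (bEq i (Mul (C 2) tD))))))))"

text \<open>Position \<open>l * W + s\<close> tells whether state \<open>s\<close> is reachable
  after \<open>l\<close> digits. Bound variables: 4 is the previous state, 5 the packed digits, 3
  the row and 6 the column.\<close>

definition fillTab where "fillTab = (let l = Div (V 2) tW; s = tMod (V 2) tW in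
   ((Mul (Add tN (C 1)) tW), 
     (bOr (bAnd (bEq l (C 0)) (bAll 3 tRows (bEq (tDig s (V 3)) tQ)))
     (bAnd (bLess (C 0) l) (bEx 4 tW (bAnd (tTab (Sub l (C 1)) (V 4)) (bEx 5 (A 9 tD) (bAll 3 tRows
       (bEq (tDig s (V 3)) (tMin (Mul (C 2) tQ) (Sub
         (Add (Mul (C 2) (tDig (V 4) (V 3))) (Sm 6 tQ (Mul (tCoef 11 (V 3) (V 6)) (tBit l (V 5) (V 6)))))
         (Add tQ (Sm 6 tQ (Mul (tCoef 12 (V 3) (V 6)) (tBit l (V 5) (V 6))))))))))))))))"

text \<open>The values of \<open>f\<close> are shifted by \<open>B\<close>, so every comparison with
  \<open>B\<close> is a sign test. The tests on the total are repeated for every class, and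
  \<open>0 < d\<close> keeps them from holding vacuously when there is no class.\<close>

definition accepts :: "nat \<Rightarrow> nat \<Rightarrow> (nat \<Rightarrow> bool) \<Rightarrow> (nat \<Rightarrow> nat) \<Rightarrow> bool" where
  "accepts d B r1 f \<longleftrightarrow> 0 < d \<and> (\<forall>j<d. f (6 * j) \<le> B \<and> f (6 * j + 4) \<le> B \<and> B < f (6 * j + 5) \<and>
     (f (6 * j) < B \<and> B < f (6 * j + 3) \<longrightarrow> B \<le> f (6 * j + 1) \<and> B < f (6 * j + 2) + of_bool (r1 j)))"

definition tAnswer where "tAnswer = (let f = (\<lambda>c. tDig (V 2) (Add (Mul (C 6) (V 3)) (C c))) in
   (bEx 2 tW (bAnd (tTab tN (V 2)) (bAnd (bLess (C 0) tD) (bAll 3 tD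
     (bAnd (bLe (f 0) tQ) (bAnd (bLe (f 4) tQ) (bAnd (bLess tQ (f 5))
       (bOr (bNot (bAnd (bLess (f 0) tQ) (bLess tQ (f 3))))
         (bAnd (bLe tQ (f 1)) (bLess tQ (Add (f 2) (tRel 6 (V 3) (V 3))))))))))))))"

fun fills :: "nat \<Rightarrow> (tm \<times> tm) list \<Rightarrow> tm \<Rightarrow> prog" where
  "fills a [] t = emit t"
| "fills a (p # ps) t = Seq (fill a (fst p) 2 (snd p)) (fills (Suc a) ps t)"

fun fills_cost :: "(tm \<times> tm) list \<Rightarrow> tm \<Rightarrow> nat \<Rightarrow> nat" where
  "fills_cost [] t M = tc t M + 2"
| "fills_cost (p # ps) t M = fill_cost (fst p) (snd p) M + fills_cost ps t M"

lemma poly_bounded_fills_cost: "poly_bounded (fills_cost ps t)"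
proof (induction ps)
  case Nil
  show ?case unfolding fills_cost.simps[abs_def] by (intro poly_bounded_intros poly_bounded_tc)
next
  case (Cons p ps)
  then show ?case
    unfolding fills_cost.simps[abs_def] by (intro poly_bounded_intros poly_bounded_fill_cost)
qed

section \<open>Chains of array definitions\<close>

locale tables =
  fixes M :: nat and val :: "nat \<Rightarrow> nat \<Rightarrow> nat" and len :: "nat \<Rightarrow> nat"
begin

text \<open>Entries from the declared length on are left arbitrary, so each use of a table must show
  its index in range.\<close>

definition holds_upto :: "nat \<Rightarrow> (nat \<Rightarrow> nat \<Rightarrow> nat) \<Rightarrow> bool" where
  "holds_upto a \<alpha> \<longleftrightarrow> (\<forall>c. c = 0 \<or> 2 \<le> c \<and> c < a \<longrightarrow> (\<forall>i<len c. \<alpha> c i = val c i))"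

lemma lookup: "holds_upto a \<alpha> \<Longrightarrow> c = 0 \<or> 2 \<le> c \<and> c < a \<Longrightarrow> i < len c \<Longrightarrow> \<alpha> c i = val c i"
  unfolding holds_upto_def by blast

lemma holds_upto_cong: "holds_upto a \<alpha> \<Longrightarrow> (\<And>c. c \<noteq> a \<Longrightarrow> \<beta> c = \<alpha> c) \<Longrightarrow> 2 \<le> a \<Longrightarrow> holds_upto a \<beta>"
  unfolding holds_upto_def by (metis less_irrefl not_numeral_le_zero)

lemma run_step:
  assumes s: "holds_upto a (arrs s)" "2 \<le> a" and N: "len a \<le> M"
    and b: "\<And>\<alpha> \<rho>. holds_upto a \<alpha> \<Longrightarrow> ok M \<alpha> \<rho> bt \<and> tev \<alpha> \<rho> bt = len a"
    and t: "\<And>\<alpha> \<rho> i. holds_upto a \<alpha> \<Longrightarrow> i < len a \<Longrightarrow> \<rho> 2 = i \<Longrightarrow> (\<And>j. j < i \<Longrightarrow> \<alpha> a j = val a j) \<Longrightarrow>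
       ok M \<alpha> \<rho> t \<and> tev \<alpha> \<rho> t = val a i"
  shows "run (fill a bt 2 t) s (fill_cost bt t M) (\<lambda>s'. holds_upto (Suc a) (arrs s'))"
proof (rule run_mono[OF run_fill[of M "arrs s" bt "len a" s 2 a "val a"] order_refl])
  show "ok M (arrs s) \<rho> bt \<and> tev (arrs s) \<rho> bt = len a" for \<rho> using b s by blast
next
  fix \<beta> and \<rho> :: "nat \<Rightarrow> nat" and i assume "i < len a" "\<rho> 2 = i" "\<And>c. c \<noteq> a \<Longrightarrow> \<beta> c = arrs s c"
    "\<And>j. j < i \<Longrightarrow> \<beta> a j = val a j"
  then show "ok M \<beta> \<rho> t \<and> tev \<beta> \<rho> t = val a i" using t[of \<beta> i \<rho>] holds_upto_cong[OF s(1) _ s(2)] by simp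
next
  fix s' assume *: "(\<forall>c. c \<noteq> a \<longrightarrow> arrs s' c = arrs s c) \<and> (\<forall>j<len a. arrs s' a j = val a j)"
  show "holds_upto (Suc a) (arrs s')"
    unfolding holds_upto_def
  proof (intro allI impI)
    fix c i assume c: "c = 0 \<or> 2 \<le> c \<and> c < Suc a" and i: "i < len c"
    show "arrs s' c i = val c i"
    proof (cases "c = a")
      case True
      then show ?thesis using * i by simp
    next
      case False
      then show ?thesis using * c lookup[OF s(1) _ i] by auto
    qed
  qed
qed (use N in auto)

text \<open>The obligation for one array once the machine is eliminated: its terms evaluate as
  intended, within the loop bound, in every memory where the earlier arrays are correct.\<close>

definition step_ok :: "nat \<Rightarrow> tm \<times> tm \<Rightarrow> bool" where
  "step_ok a p \<longleftrightarrow> len a \<le> M \<and>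
     (\<forall>\<alpha> \<rho>. holds_upto a \<alpha> \<longrightarrow> ok M \<alpha> \<rho> (fst p) \<and> tev \<alpha> \<rho> (fst p) = len a) \<and>
     (\<forall>\<alpha> \<rho>. holds_upto a \<alpha> \<longrightarrow> \<rho> 2 < len a \<longrightarrow> (\<forall>j<\<rho> 2. \<alpha> a j = val a j) \<longrightarrow>
        ok M \<alpha> \<rho> (snd p) \<and> tev \<alpha> \<rho> (snd p) = val a (\<rho> 2))"

fun steps_ok :: "nat \<Rightarrow> (tm \<times> tm) list \<Rightarrow> bool" where
  "steps_ok a [] = True"
| "steps_ok a (p # ps) = (step_ok a p \<and> steps_ok (Suc a) ps)"

lemma run_fills:
  assumes "holds_upto a (arrs s)" "2 \<le> a" "steps_ok a ps"
    and "\<And>\<alpha> \<rho>. holds_upto (a + length ps) \<alpha> \<Longrightarrow> ok M \<alpha> \<rho> t \<and> tev \<alpha> \<rho> t = v"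
  shows "run (fills a ps t) s (fills_cost ps t M) (\<lambda>s'. result s' = v)"
  using assms
proof (induction ps arbitrary: a s)
  case Nil
  show ?case
    unfolding fills.simps fills_cost.simps by (rule run_emit[OF _ refl]) (use Nil in simp)
next
  case (Cons p ps)
  show ?case
    unfolding fills.simps fills_cost.simps
  proof (rule run_Seq[OF _ order_refl], rule run_mono[OF run_step order_refl])
    show "run (fills (Suc a) ps t) s' (fills_cost ps t M) (\<lambda>s'. result s' = v)"
      if "holds_upto (Suc a) (arrs s')" for s'
      using Cons.IH[of "Suc a" s'] Cons.prems that by simp
  qed (use Cons.prems in \<open>auto simp: step_ok_def\<close>)
qed

lemma step_okI:
  assumes "len a \<le> M" "\<And>\<alpha> \<rho>. holds_upto a \<alpha> \<Longrightarrow> ok M \<alpha> \<rho> (fst p) \<and> tev \<alpha> \<rho> (fst p) = len a"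
    "\<And>\<alpha> \<rho>. holds_upto a \<alpha> \<Longrightarrow> \<rho> 2 < len a \<Longrightarrow> (\<And>j. j < \<rho> 2 \<Longrightarrow> \<alpha> a j = val a j) \<Longrightarrow>
       ok M \<alpha> \<rho> (snd p) \<and> tev \<alpha> \<rho> (snd p) = val a (\<rho> 2)"
  shows "step_ok a p"
  using assms unfolding step_ok_def by blast

lemma step_Pow:
  assumes "1 \<le> M" "len a \<le> M" "\<And>i. val a i = x ^ i" "x \<le> M"
    "\<And>\<alpha> \<rho>. holds_upto a \<alpha> \<Longrightarrow> ok M \<alpha> \<rho> b \<and> tev \<alpha> \<rho> b = len a"
    "\<And>\<alpha> \<rho>. holds_upto a \<alpha> \<Longrightarrow> ok M \<alpha> \<rho> t \<and> tev \<alpha> \<rho> t = x"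
  shows "step_ok a (fillPow a b t)"
proof (rule step_okI[OF assms(2)])
  fix \<alpha> and \<rho> :: "nat \<Rightarrow> nat" assume H: "holds_upto a \<alpha>"
  show "ok M \<alpha> \<rho> (fst (fillPow a b t)) \<and> tev \<alpha> \<rho> (fst (fillPow a b t)) = len a"
    using assms(5)[OF H] by (simp add: fillPow_def)
  assume "\<And>j. j < \<rho> 2 \<Longrightarrow> \<alpha> a j = val a j"
  then show "ok M \<alpha> \<rho> (snd (fillPow a b t)) \<and> tev \<alpha> \<rho> (snd (fillPow a b t)) = val a (\<rho> 2)"
    using assms(1,3,4) assms(6)[OF H] by (cases "\<rho> 2") (simp_all add: fillPow_def)
qed

end

section \<open>Correctness of the algorithm\<close>

locale oa_run = signed_matrix +
  fixes k :: nat
begin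

abbreviation d where "d \<equiv> ncls n E"
text \<open>The columns are \<open>d\<close> counts, \<open>d\<close> class sizes and the budget.
  The same number bounds the coefficient sums of each row and so serves as truncation bound.\<close>

definition q where "q = 2 * d + 1"
definition m where "m = 6 * d"
definition base where "base = 2 * q + 1"
definition W where "W = base ^ m"
definition Y where "Y i = (if i < d then 0 else if i < 2 * d then csize n E (i - d) else min n k)"
text \<open>A sum majorising every array length and loop count, such as the
  \<open>(n + 1) * W\<close> table entries and the \<open>2 ^ d\<close> choices of digits.\<close>

definition M where "M = (n + 1) * W + 2 ^ d + m * q + d * d + 2 * n + 2 * q + m + 10"

lemma csize_le: "csize n E j \<le> n"
proof -
  have "card {u \<in> {..<n}. cls n E u = j} \<le> card {..<n}" by (rule card_mono) auto
  then show ?thesis unfolding csize_card by simp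
qed

lemma d_le: "d \<le> n"
proof -
  have "card {u. u < n \<and> leader n E u} \<le> card {..<n}" by (rule card_mono) auto
  then show ?thesis unfolding ncls_def card_sum_of_bool by simp
qed

lemma Y_le: "Y i \<le> n"
  unfolding Y_def using csize_le by auto

text \<open>Positive coefficients are at most 2 and live on the \<open>d\<close> unknowns, negative
  ones are at most 1 on the \<open>q\<close> columns; so \<open>q\<close> bounds both sums.\<close>

sublocale dp: digit_dp d q m n q Y "posC n E" "negC n E"
proof
  show "Y i < 2 ^ n" for i
    using Y_le[of i] less_exp[of n] by linarith
next
  fix r
  have "posC n E r i \<le> 2 * of_bool (i < d)" for i
    by (auto simp: posC_def Let_def)
  then have "(\<Sum>i<q. posC n E r i) \<le> (\<Sum>i<q. 2 * of_bool (i < d))" by (rule sum_mono)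
  also have "\<dots> = 2 * card {i. i < q \<and> i < d}"
    by (simp add: sum_distrib_left[symmetric] lessThan_def Collect_conj_eq)
  also have "{i. i < q \<and> i < d} = {..<d}" by (auto simp: q_def)
  finally show "(\<Sum>i<q. posC n E r i) \<le> q" by (simp add: q_def)
next
  fix r
  have "negC n E r i \<le> 1" for i
    by (auto simp: negC_def Let_def)
  then have "(\<Sum>i<q. negC n E r i) \<le> (\<Sum>i<q. 1)" by (intro sum_mono)
  then show "(\<Sum>i<q. negC n E r i) \<le> q" by simp
qed

definition val :: "nat \<Rightarrow> nat \<Rightarrow> nat" where
  "val a i = (if a = 0 then if i = 0 then k else if i = 1 then n else E ((i - 2) div n) ((i - 2) mod n)
    else if a = 2 then of_bool (leader n E i)
    else if a = 3 then d
    else if a = 4 then cls n E i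
    else if a = 5 then csize n E i
    else if a = 6 then of_bool (rel n E 1 (i div d) (i mod d))
    else if a = 7 then of_bool (rel n E 2 (i div d) (i mod d))
    else if a = 8 then Y i
    else if a = 9 then 2 ^ i
    else if a = 10 then base ^ i
    else if a = 11 then posC n E (i div q) (i mod q)
    else if a = 12 then negC n E (i div q) (i mod q)
    else of_bool (dp.tab (i div W) (i mod W)))"

definition len :: "nat \<Rightarrow> nat" where
  "len a = (if a = 0 then 2 + n * n else if a = 2 then n else if a = 3 then 1 else if a = 4 then n
    else if a = 5 then d else if a = 6 then d * d else if a = 7 then d * d else if a = 8 then q
    else if a = 9 then 2 * n + 1 else if a = 10 then m + 1 else if a = 11 then m * q
    else if a = 12 then m * q else (n + 1) * W)"

sublocale tables M val len .

lemma W_pos: "0 < W" by (simp add: W_def base_def)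
lemma W_le: "W \<le> M" by (simp add: M_def)
lemma nW_le: "(n + 1) * W \<le> M" by (simp add: M_def)
lemma n_le: "2 * n + 10 \<le> M" by (simp add: M_def)
lemma d_le_M: "d \<le> M" using d_le n_le by linarith
lemma q_le: "2 * q + 1 \<le> M" by (simp add: M_def)
lemma m_le: "m + 1 \<le> M" by (simp add: M_def)
lemma mq_le: "m * q \<le> M" by (simp add: M_def)
lemma dd_le: "d * d \<le> M" by (simp add: M_def)
lemma pow_le: "2 ^ d \<le> M" by (simp add: M_def)
lemma q_pos: "0 < q" by (simp add: q_def)

lemma M_const: "1 \<le> M" "2 \<le> M" "6 \<le> M" using n_le by linarith+

section \<open>Values and loop bounds of the building blocks\<close>

lemma tev_tN: "holds_upto a \<alpha> \<Longrightarrow> tev \<alpha> \<rho> tN = n"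
  using lookup[of a \<alpha> 0 1] by (simp add: tN_def len_def val_def)

lemma ok_tN [simp]: "ok M \<alpha> \<rho> tN" by (simp add: tN_def)

lemma tev_tK: "holds_upto a \<alpha> \<Longrightarrow> tev \<alpha> \<rho> tK = k"
  using lookup[of a \<alpha> 0 0] by (simp add: tK_def len_def val_def)

lemma ok_tK [simp]: "ok M \<alpha> \<rho> tK" by (simp add: tK_def)

lemma mult_add_less: "u < x \<Longrightarrow> v < y \<Longrightarrow> u * y + v < x * (y::nat)"
proof -
  assume "u < x" "v < y"
  then have "u * y + v < Suc u * y" by simp
  also have "\<dots> \<le> x * y" using \<open>u < x\<close> by (intro mult_right_mono) auto
  finally show ?thesis .
qed

lemma tev_tE:
  assumes "holds_upto a \<alpha>" "tev \<alpha> \<rho> s < n" "tev \<alpha> \<rho> t < n"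
  shows "tev \<alpha> \<rho> (tE s t) = E (tev \<alpha> \<rho> s) (tev \<alpha> \<rho> t)"
proof -
  let ?u = "tev \<alpha> \<rho> s" and ?v = "tev \<alpha> \<rho> t"
  have "2 + (?u * n + ?v) < len 0" using mult_add_less[OF assms(2,3)] by (simp add: len_def)
  from lookup[OF assms(1) _ this] show ?thesis
    using assms by (simp add: tE_def tev_tN val_def)
qed

lemma ok_tE: "ok M \<alpha> \<rho> (tE s t) \<longleftrightarrow> ok M \<alpha> \<rho> s \<and> ok M \<alpha> \<rho> t \<and> tev \<alpha> \<rho> s \<le> M"
  by (auto simp: tE_def)

lemma tev_tTwin:
  assumes "holds_upto a \<alpha>" "\<rho> x < n" "\<rho> y < n" "x \<noteq> 6" "y \<noteq> 6"
  shows "tev \<alpha> \<rho> (tTwin (V x) (V y)) = of_bool (twin n E (\<rho> x) (\<rho> y))"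
proof -
  have "tev \<alpha> (\<rho>(6 := v)) (tE (V 6) (V z)) = E v (\<rho> z)" if "v < n" "\<rho> z < n" "z \<noteq> 6" for v z
    using tev_tE[OF assms(1), of "\<rho>(6 := v)" "V 6" "V z"] that by simp
  then show ?thesis using assms by (auto simp: tTwin_def twin_def tev_tN)
qed

lemma ok_tTwin: "holds_upto a \<alpha> \<Longrightarrow> ok M \<alpha> \<rho> (tTwin (V x) (V y))"
  using n_le by (auto simp: tTwin_def ok_tE tev_tN)

lemma tev_tD: "holds_upto a \<alpha> \<Longrightarrow> 3 < a \<Longrightarrow> tev \<alpha> \<rho> tD = d"
  using lookup[of a \<alpha> 3 0] by (simp add: tD_def len_def val_def)

lemma ok_tD [simp]: "ok M \<alpha> \<rho> tD" by (simp add: tD_def)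

lemma tev_tQ: "holds_upto a \<alpha> \<Longrightarrow> 3 < a \<Longrightarrow> tev \<alpha> \<rho> tQ = q"
  by (simp add: tQ_def tev_tD q_def)

lemma ok_tQ [simp]: "ok M \<alpha> \<rho> tQ" by (simp add: tQ_def M_const)

lemma tev_tRows: "holds_upto a \<alpha> \<Longrightarrow> 3 < a \<Longrightarrow> tev \<alpha> \<rho> tRows = m"
  by (simp add: tRows_def tev_tD m_def)

lemma ok_tRows [simp]: "ok M \<alpha> \<rho> tRows" by (simp add: tRows_def M_const)

lemma tev_tBase: "holds_upto a \<alpha> \<Longrightarrow> 3 < a \<Longrightarrow> tev \<alpha> \<rho> tBase = base"
  by (simp add: tBase_def tev_tQ base_def)

lemma ok_tBase [simp]: "ok M \<alpha> \<rho> tBase" by (simp add: tBase_def M_const)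

lemma tev_tW: "holds_upto a \<alpha> \<Longrightarrow> 10 < a \<Longrightarrow> tev \<alpha> \<rho> tW = W"
  using lookup[of a \<alpha> 10 m] by (simp add: tW_def tev_tRows len_def val_def W_def)

lemma ok_tW [simp]: "ok M \<alpha> \<rho> tW" by (simp add: tW_def)

lemma tev_tRel:
  assumes "holds_upto a \<alpha>" "tev \<alpha> \<rho> i < d" "tev \<alpha> \<rho> j < d"
  shows "7 < a \<Longrightarrow> tev \<alpha> \<rho> (tRel 6 i j) = of_bool (rel n E 1 (tev \<alpha> \<rho> i) (tev \<alpha> \<rho> j))"
    and "7 < a \<Longrightarrow> tev \<alpha> \<rho> (tRel 7 i j) = of_bool (rel n E 2 (tev \<alpha> \<rho> i) (tev \<alpha> \<rho> j))"
proof -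
  let ?u = "tev \<alpha> \<rho> i" and ?v = "tev \<alpha> \<rho> j"
  have *: "?u * d + ?v < len 6" "?u * d + ?v < len 7"
    using mult_add_less[OF assms(2,3)] by (simp_all add: len_def)
  show "tev \<alpha> \<rho> (tRel 6 i j) = of_bool (rel n E 1 ?u ?v)" if "7 < a"
    using lookup[OF assms(1) _ *(1)] assms that by (simp add: tRel_def tev_tD val_def)
  show "tev \<alpha> \<rho> (tRel 7 i j) = of_bool (rel n E 2 ?u ?v)" if "7 < a"
    using lookup[OF assms(1) _ *(2)] assms that by (simp add: tRel_def tev_tD val_def)
qed

lemma ok_tRel: "ok M \<alpha> \<rho> (tRel c i j) \<longleftrightarrow> ok M \<alpha> \<rho> i \<and> ok M \<alpha> \<rho> j \<and> tev \<alpha> \<rho> i \<le> M"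
  by (auto simp: tRel_def)

lemma tev_pow10: "holds_upto a \<alpha> \<Longrightarrow> 10 < a \<Longrightarrow> i \<le> m \<Longrightarrow> \<alpha> 10 i = base ^ i"
  using lookup[of a \<alpha> 10 i] by (simp add: len_def val_def)

lemma tev_pow9: "holds_upto a \<alpha> \<Longrightarrow> 9 < a \<Longrightarrow> i \<le> 2 * n \<Longrightarrow> \<alpha> 9 i = 2 ^ i"
  using lookup[of a \<alpha> 9 i] by (simp add: len_def val_def)

lemma tev_tDig: "holds_upto a \<alpha> \<Longrightarrow> 10 < a \<Longrightarrow> tev \<alpha> \<rho> r \<le> m \<Longrightarrow>
    tev \<alpha> \<rho> (tDig s r) = dp.dig (tev \<alpha> \<rho> s) (tev \<alpha> \<rho> r)"
  by (simp add: tDig_def tev_pow10 tev_tBase dp.dig_def base_def)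

lemma ok_tDig: "holds_upto a \<alpha> \<Longrightarrow> 10 < a \<Longrightarrow> tev \<alpha> \<rho> r \<le> m \<Longrightarrow> tev \<alpha> \<rho> s \<le> M \<Longrightarrow>
    ok M \<alpha> \<rho> s \<Longrightarrow> ok M \<alpha> \<rho> r \<Longrightarrow> ok M \<alpha> \<rho> (tDig s r)"
  by (auto simp: tDig_def tev_pow10 tev_tBase base_def intro: order_trans[OF div_le_dividend])

lemma tev_tCoef:
  assumes "holds_upto a \<alpha>" "12 < a" "tev \<alpha> \<rho> r < m" "tev \<alpha> \<rho> i < q"
  shows "tev \<alpha> \<rho> (tCoef 11 r i) = posC n E (tev \<alpha> \<rho> r) (tev \<alpha> \<rho> i)"
    and "tev \<alpha> \<rho> (tCoef 12 r i) = negC n E (tev \<alpha> \<rho> r) (tev \<alpha> \<rho> i)"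
proof -
  have *: "tev \<alpha> \<rho> r * q + tev \<alpha> \<rho> i < len 11" "tev \<alpha> \<rho> r * q + tev \<alpha> \<rho> i < len 12"
    using mult_add_less[OF assms(3,4)] by (simp_all add: len_def)
  show "tev \<alpha> \<rho> (tCoef 11 r i) = posC n E (tev \<alpha> \<rho> r) (tev \<alpha> \<rho> i)"
    using lookup[OF assms(1) _ *(1)] assms by (simp add: tCoef_def tev_tQ val_def)
  show "tev \<alpha> \<rho> (tCoef 12 r i) = negC n E (tev \<alpha> \<rho> r) (tev \<alpha> \<rho> i)"
    using lookup[OF assms(1) _ *(2)] assms by (simp add: tCoef_def tev_tQ val_def)
qed

lemma ok_tCoef: "ok M \<alpha> \<rho> (tCoef c i j) \<longleftrightarrow> ok M \<alpha> \<rho> i \<and> ok M \<alpha> \<rho> j \<and> tev \<alpha> \<rho> i \<le> M"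
  by (auto simp: tCoef_def)

lemma coef_le: "posC n E r i \<le> M" "negC n E r i \<le> M"
proof -
  have "posC n E r i \<le> 2" "negC n E r i \<le> 1" by (auto simp: posC_def negC_def Let_def)
  then show "posC n E r i \<le> M" "negC n E r i \<le> M" using M_const by linarith+
qed

text \<open>Both summands are evaluated in every column, whichever is selected. Hence the powers of
  two reach exponent \<open>2 * n\<close>: the first division needs a positive divisor in all
  \<open>q \<le> 2 * n + 1\<close> columns.\<close>

lemma tBit:
  assumes a: "holds_upto a \<alpha>" "9 < a" and i: "tev \<alpha> \<rho> i < q" and l: "tev \<alpha> \<rho> l \<le> n"
    and z: "tev \<alpha> \<rho> z < 2 ^ d"
    and okt: "ok M \<alpha> \<rho> i" "ok M \<alpha> \<rho> l" "ok M \<alpha> \<rho> z"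
  shows "tev \<alpha> \<rho> (tBit l z i) = dp.bit_at (tev \<alpha> \<rho> l) (tev \<alpha> \<rho> z) (tev \<alpha> \<rho> i)"
    and "ok M \<alpha> \<rho> (tBit l z i)"
proof -
  have i2: "tev \<alpha> \<rho> i \<le> 2 * n" using i d_le by (simp add: q_def)
  have Yv: "\<alpha> 8 (tev \<alpha> \<rho> i) = Y (tev \<alpha> \<rho> i)"
    using lookup[OF a(1), of 8 "tev \<alpha> \<rho> i"] a(2) i by (simp add: len_def val_def)
  have p: "\<alpha> 9 (tev \<alpha> \<rho> i) = 2 ^ tev \<alpha> \<rho> i" "\<alpha> 9 (n - tev \<alpha> \<rho> l) = 2 ^ (n - tev \<alpha> \<rho> l)"
    using tev_pow9[OF a i2] tev_pow9[OF a, of "n - tev \<alpha> \<rho> l"] by auto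
  have M: "tev \<alpha> \<rho> z \<le> M" "Y (tev \<alpha> \<rho> i) \<le> M"
    using z pow_le Y_le[of "tev \<alpha> \<rho> i"] n_le by linarith+
  have N: "tev \<alpha> \<rho> tD = d" "tev \<alpha> \<rho> tN = n" using a by (simp_all add: tev_tD[OF a(1)] tev_tN[OF a(1)])
  show "tev \<alpha> \<rho> (tBit l z i) = dp.bit_at (tev \<alpha> \<rho> l) (tev \<alpha> \<rho> z) (tev \<alpha> \<rho> i)"
    by (simp add: tBit_def dp.bit_at_def N p Yv not_less)
  show "ok M \<alpha> \<rho> (tBit l z i)"
    using M okt M_const
    by (auto simp: tBit_def N p Yv intro: order_trans[OF div_le_dividend])
qed

section \<open>Each array receives its intended contents\<close>

lemma step_Leader: "step_ok 2 fillLeader"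
proof (rule step_okI)
  show "len 2 \<le> M" using n_le by (simp add: len_def)
  fix \<alpha> and \<rho> :: "nat \<Rightarrow> nat" assume H: "holds_upto 2 \<alpha>"
  show "ok M \<alpha> \<rho> (fst fillLeader) \<and> tev \<alpha> \<rho> (fst fillLeader) = len 2"
    by (simp add: fillLeader_def tev_tN[OF H] len_def)
  assume "\<rho> 2 < len 2"
  then have i: "\<rho> 2 < n" by (simp add: len_def)
  then show "ok M \<alpha> \<rho> (snd fillLeader) \<and> tev \<alpha> \<rho> (snd fillLeader) = val 2 (\<rho> 2)"
    using n_le by (simp add: fillLeader_def ok_tTwin[OF H] tev_tTwin[OF H] val_def leader_def cong: conj_cong)
qed

lemma step_D: "step_ok 3 fillD"
proof (rule step_okI)
  show "len 3 \<le> M" using n_le by (simp add: len_def)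
  fix \<alpha> and \<rho> :: "nat \<Rightarrow> nat" assume H: "holds_upto 3 \<alpha>"
  show "ok M \<alpha> \<rho> (fst fillD) \<and> tev \<alpha> \<rho> (fst fillD) = len 3"
    by (simp add: fillD_def len_def)
  have "\<alpha> 2 v = of_bool (leader n E v)" if "v < n" for v
    using lookup[OF H, of 2 v] that by (simp add: len_def val_def)
  then show "ok M \<alpha> \<rho> (snd fillD) \<and> tev \<alpha> \<rho> (snd fillD) = val 3 (\<rho> 2)"
    using n_le by (simp add: fillD_def tev_tN[OF H] val_def ncls_def del: sum_of_bool_eq)
qed

lemma step_Cls: "step_ok 4 fillCls"
proof (rule step_okI)
  show "len 4 \<le> M" using n_le by (simp add: len_def)
  fix \<alpha> and \<rho> :: "nat \<Rightarrow> nat" assume H: "holds_upto 4 \<alpha>"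
  show "ok M \<alpha> \<rho> (fst fillCls) \<and> tev \<alpha> \<rho> (fst fillCls) = len 4"
    by (simp add: fillCls_def tev_tN[OF H] len_def)
  assume "\<rho> 2 < len 4"
  then have i: "\<rho> 2 < n" by (simp add: len_def)
  have l: "\<alpha> 2 v = of_bool (leader n E v)" if "v < n" for v
    using lookup[OF H, of 2 v] that by (simp add: len_def val_def)
  show "ok M \<alpha> \<rho> (snd fillCls) \<and> tev \<alpha> \<rho> (snd fillCls) = val 4 (\<rho> 2)"
    using n_le i by (simp add: fillCls_def ok_tTwin[OF H] tev_tTwin[OF H] tev_tN[OF H] val_def l cls_def
        del: sum_of_bool_eq cong: conj_cong sum.cong_simp)
qed

lemma cls_lookup: "holds_upto a \<alpha> \<Longrightarrow> 4 < a \<Longrightarrow> v < n \<Longrightarrow> \<alpha> 4 v = cls n E v"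
  using lookup[of a \<alpha> 4 v] by (simp add: len_def val_def)

lemma step_Size: "step_ok 5 fillSize"
proof (rule step_okI)
  show "len 5 \<le> M" using d_le_M by (simp add: len_def)
  fix \<alpha> and \<rho> :: "nat \<Rightarrow> nat" assume H: "holds_upto 5 \<alpha>"
  show "ok M \<alpha> \<rho> (fst fillSize) \<and> tev \<alpha> \<rho> (fst fillSize) = len 5"
    by (simp add: fillSize_def tev_tD[OF H] len_def)
  show "ok M \<alpha> \<rho> (snd fillSize) \<and> tev \<alpha> \<rho> (snd fillSize) = val 5 (\<rho> 2)"
    using n_le by (simp add: fillSize_def tev_tN[OF H] val_def cls_lookup[OF H] csize_def
        del: sum_of_bool_eq cong: sum.cong_simp)
qed

lemma step_Rel:
  assumes "a = 6 \<and> \<sigma> = 1 \<or> a = 7 \<and> \<sigma> = 2"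
  shows "step_ok a (fillRel \<sigma>)"
proof (rule step_okI)
  have len: "len a = d * d" using assms by (auto simp: len_def)
  then show "len a \<le> M" using dd_le by simp
  fix \<alpha> and \<rho> :: "nat \<Rightarrow> nat" assume H: "holds_upto a \<alpha>"
  have a: "3 < a" "4 < a" using assms by auto
  show "ok M \<alpha> \<rho> (fst (fillRel \<sigma>)) \<and> tev \<alpha> \<rho> (fst (fillRel \<sigma>)) = len a"
    using d_le_M by (simp add: fillRel_def tev_tD[OF H a(1)] len)
  assume "\<rho> 2 < len a"
  then have i: "\<rho> 2 < d * d" by (simp add: len)
  \<comment> \<open>An index below \<open>d * d\<close> exists, which makes the divisor
    \<open>d\<close> positive.\<close>
  then have d: "0 < d" by (rule contrapos_pp) simp
  have E: "tev \<alpha> (\<rho>(3 := u, 4 := v)) (tE (V 3) (V 4)) = E u v" if "u < n" "v < n" for u v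
    using tev_tE[OF H, of "\<rho>(3 := u, 4 := v)" "V 3" "V 4"] that by simp
  have val: "val a (\<rho> 2) = of_bool (rel n E \<sigma> (\<rho> 2 div d) (\<rho> 2 mod d))"
    using assms by (elim disjE conjE) (simp_all add: val_def)
  have "\<rho> 2 \<le> M" "n \<le> M" using i dd_le n_le by linarith+
  with d have 1: "ok M \<alpha> \<rho> (snd (fillRel \<sigma>))"
    by (simp add: fillRel_def tev_tD[OF H a(1)] tev_tN[OF H] ok_tE)
  have 2: "tev \<alpha> \<rho> (snd (fillRel \<sigma>)) = of_bool (rel n E \<sigma> (\<rho> 2 div d) (\<rho> 2 mod d))"
    unfolding fillRel_def rel_def
    by (simp add: tev_tD[OF H a(1)] tev_tN[OF H] cls_lookup[OF H a(2)] E cong: conj_cong)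
  show "ok M \<alpha> \<rho> (snd (fillRel \<sigma>)) \<and> tev \<alpha> \<rho> (snd (fillRel \<sigma>)) = val a (\<rho> 2)"
    using 1 2 val by simp
qed

lemma step_Y: "step_ok 8 fillY"
proof (rule step_okI)
  show "len 8 \<le> M" using q_le by (simp add: len_def)
  fix \<alpha> and \<rho> :: "nat \<Rightarrow> nat" assume H: "holds_upto 8 \<alpha>"
  show "ok M \<alpha> \<rho> (fst fillY) \<and> tev \<alpha> \<rho> (fst fillY) = len 8"
    by (simp add: fillY_def tev_tQ[OF H] len_def)
  have "\<alpha> 5 v = csize n E v" if "v < d" for v
    using lookup[OF H, of 5 v] that by (simp add: len_def val_def)
  then show "ok M \<alpha> \<rho> (snd fillY) \<and> tev \<alpha> \<rho> (snd fillY) = val 8 (\<rho> 2)"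
    using M_const by (auto simp: fillY_def tev_tD[OF H] tev_tN[OF H] tev_tK[OF H] val_def Y_def)
qed

lemma step_Pow2: "step_ok 9 (fillPow 9 (Add (Mul (C 2) tN) (C 1)) (C 2))"
  by (rule step_Pow[OF M_const(1), of _ 2]) (use n_le M_const in \<open>auto simp: len_def val_def tev_tN\<close>)

lemma step_PowB: "step_ok 10 (fillPow 10 (Add tRows (C 1)) tBase)"
  by (rule step_Pow[OF M_const(1), of _ base])
    (use m_le q_le in \<open>auto simp: len_def val_def tev_tRows tev_tBase base_def\<close>)

lemma row_index:
  assumes "i < m * q"
  shows "i div q < m" "i mod q < q" "i div q div 6 < d"
  using assms q_pos by (auto simp: less_mult_imp_div_less m_def mult.commute[of 6])

lemma step_Pos: "step_ok 11 fillPos"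
proof (rule step_okI)
  show "len 11 \<le> M" using mq_le by (simp add: len_def)
  fix \<alpha> and \<rho> :: "nat \<Rightarrow> nat" assume H: "holds_upto 11 \<alpha>"
  show "ok M \<alpha> \<rho> (fst fillPos) \<and> tev \<alpha> \<rho> (fst fillPos) = len 11"
    using m_le by (simp add: fillPos_def Let_def tev_tQ[OF H] tev_tRows[OF H] len_def)
  assume "\<rho> 2 < len 11"
  then have i: "\<rho> 2 < m * q" by (simp add: len_def)
  note ri = row_index[OF i]
  have le: "\<rho> 2 \<le> M" "\<rho> 2 div q \<le> M" "\<rho> 2 mod q \<le> M"
    using i mq_le ri m_le q_le by linarith+
  define t1 t2 where "t1 = tRel 7 (tMod (V 2) tQ) (Div (Div (V 2) tQ) (C 6))"
    and "t2 = tRel 6 (tMod (V 2) tQ) (Div (Div (V 2) tQ) (C 6))"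
  have okR: "ok M \<alpha> \<rho> t1" "ok M \<alpha> \<rho> t2"
    using le q_pos by (auto simp: t1_def t2_def ok_tRel tev_tQ[OF H])
  have evR: "tev \<alpha> \<rho> t1 = of_bool (rel n E 2 (\<rho> 2 mod q) (\<rho> 2 div q div 6))"
     "tev \<alpha> \<rho> t2 = of_bool (rel n E 1 (\<rho> 2 mod q) (\<rho> 2 div q div 6))" if "\<rho> 2 mod q < d"
    using that ri by (simp_all add: t1_def t2_def tev_tRel[OF H] tev_tQ[OF H])
  have ok: "ok M \<alpha> \<rho> (snd fillPos)"
    using le q_pos okR M_const
    by (simp add: fillPos_def Let_def t1_def[symmetric] t2_def[symmetric] tev_tQ[OF H])
  have "tev \<alpha> \<rho> (snd fillPos) = posC n E (\<rho> 2 div q) (\<rho> 2 mod q)"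
    unfolding fillPos_def Let_def t1_def[symmetric] t2_def[symmetric] posC_def
    by (cases "\<rho> 2 mod q < d") (simp_all add: evR tev_tQ[OF H] tev_tD[OF H])
  then show "ok M \<alpha> \<rho> (snd fillPos) \<and> tev \<alpha> \<rho> (snd fillPos) = val 11 (\<rho> 2)"
    using ok by (simp add: val_def)
qed

lemma step_Neg: "step_ok 12 fillNeg"
proof (rule step_okI)
  show "len 12 \<le> M" using mq_le by (simp add: len_def)
  fix \<alpha> and \<rho> :: "nat \<Rightarrow> nat" assume H: "holds_upto 12 \<alpha>"
  show "ok M \<alpha> \<rho> (fst fillNeg) \<and> tev \<alpha> \<rho> (fst fillNeg) = len 12"
    using m_le by (simp add: fillNeg_def Let_def tev_tQ[OF H] tev_tRows[OF H] len_def)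
  assume "\<rho> 2 < len 12"
  then have i: "\<rho> 2 < m * q" by (simp add: len_def)
  note ri = row_index[OF i]
  have le: "\<rho> 2 \<le> M" "\<rho> 2 div q \<le> M" "\<rho> 2 mod q \<le> M"
    using i mq_le ri m_le q_le by linarith+
  define t1 t2 where "t1 = tRel 6 (tMod (V 2) tQ) (Div (Div (V 2) tQ) (C 6))"
    and "t2 = tRel 6 (Sub (tMod (V 2) tQ) tD) (Div (Div (V 2) tQ) (C 6))"
  have okR: "ok M \<alpha> \<rho> t1" "ok M \<alpha> \<rho> t2"
    using le q_pos by (auto simp: t1_def t2_def ok_tRel tev_tQ[OF H])
  have evR: "tev \<alpha> \<rho> t1 = of_bool (rel n E 1 (\<rho> 2 mod q) (\<rho> 2 div q div 6))" if "\<rho> 2 mod q < d"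
    using that ri by (simp add: t1_def tev_tRel[OF H] tev_tQ[OF H])
  have evR': "tev \<alpha> \<rho> t2 = of_bool (rel n E 1 (\<rho> 2 mod q - d) (\<rho> 2 div q div 6))"
    if "d \<le> \<rho> 2 mod q" "\<rho> 2 mod q < 2 * d"
  proof -
    have "\<rho> 2 mod q - d < d" using that by linarith
    then show ?thesis using ri by (simp add: t2_def tev_tRel[OF H] tev_tQ[OF H] tev_tD[OF H])
  qed
  have ok: "ok M \<alpha> \<rho> (snd fillNeg)"
    using le q_pos okR M_const
    by (simp add: fillNeg_def Let_def t1_def[symmetric] t2_def[symmetric] tev_tQ[OF H])
  have "tev \<alpha> \<rho> (snd fillNeg) = negC n E (\<rho> 2 div q) (\<rho> 2 mod q)"
    unfolding fillNeg_def Let_def t1_def[symmetric] t2_def[symmetric] negC_def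
    by (cases "\<rho> 2 mod q < d"; cases "\<rho> 2 mod q < 2 * d")
      (simp_all add: evR evR' tev_tQ[OF H] tev_tD[OF H])
  then show "ok M \<alpha> \<rho> (snd fillNeg) \<and> tev \<alpha> \<rho> (snd fillNeg) = val 12 (\<rho> 2)"
    using ok by (simp add: val_def)
qed

definition tSum where
  "tSum c l = Sm 6 tQ (Mul (tCoef c (V 3) (V 6)) (tBit l (V 5) (V 6)))"

lemma tSum:
  assumes H: "holds_upto a \<alpha>" "12 < a" and r: "\<rho> 3 < m" and z: "\<rho> 5 < 2 ^ d" and l: "\<rho> 2 < (n + 1) * W"
  defines "t \<equiv> Div (V 2) tW"
  shows "tev \<alpha> \<rho> (tSum 11 t) = (\<Sum>i<q. posC n E (\<rho> 3) i * dp.bit_at (\<rho> 2 div W) (\<rho> 5) i)"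
    and "tev \<alpha> \<rho> (tSum 12 t) = (\<Sum>i<q. negC n E (\<rho> 3) i * dp.bit_at (\<rho> 2 div W) (\<rho> 5) i)"
    and "ok M \<alpha> \<rho> (tSum 11 t)" "ok M \<alpha> \<rho> (tSum 12 t)"
proof -
  have ln: "\<rho> 2 div W \<le> n"
    using less_mult_imp_div_less[OF l] by simp
  have a: "9 < a" "10 < a" "3 < a" using H(2) by auto
  have i2: "\<rho> 2 \<le> M" using l nW_le by linarith
  have t: "tev \<alpha> (\<rho>(6 := i)) t = \<rho> 2 div W" "ok M \<alpha> (\<rho>(6 := i)) t" for i
    unfolding t_def using tev_tW[OF H(1) a(2)] i2 W_pos by auto
  have bit_at: "tev \<alpha> (\<rho>(6 := i)) (tBit t (V 5) (V 6)) = dp.bit_at (\<rho> 2 div W) (\<rho> 5) i"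
    "ok M \<alpha> (\<rho>(6 := i)) (tBit t (V 5) (V 6))" if "i < q" for i
    using tBit[OF H(1) a(1), of "\<rho>(6 := i)" "V 6" t "V 5"] that t ln z by simp_all
  have coef: "tev \<alpha> (\<rho>(6 := i)) (tCoef 11 (V 3) (V 6)) = posC n E (\<rho> 3) i"
    "tev \<alpha> (\<rho>(6 := i)) (tCoef 12 (V 3) (V 6)) = negC n E (\<rho> 3) i"
    "ok M \<alpha> (\<rho>(6 := i)) (tCoef 11 (V 3) (V 6))" "ok M \<alpha> (\<rho>(6 := i)) (tCoef 12 (V 3) (V 6))"
    if "i < q" for i
    using tev_tCoef[OF H, of "\<rho>(6 := i)" "V 3" "V 6"] that r m_le by (simp_all add: ok_tCoef)
  show "tev \<alpha> \<rho> (tSum 11 t) = (\<Sum>i<q. posC n E (\<rho> 3) i * dp.bit_at (\<rho> 2 div W) (\<rho> 5) i)"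
    "tev \<alpha> \<rho> (tSum 12 t) = (\<Sum>i<q. negC n E (\<rho> 3) i * dp.bit_at (\<rho> 2 div W) (\<rho> 5) i)"
    by (simp_all add: tSum_def tev_tQ[OF H(1) a(3)] bit_at coef)
  show "ok M \<alpha> \<rho> (tSum 11 t)" "ok M \<alpha> \<rho> (tSum 12 t)"
    using q_le by (simp_all add: tSum_def tev_tQ[OF H(1) a(3)] bit_at coef coef_le)
qed

definition tUpdate where
  "tUpdate l s = bEq (tDig s (V 3)) (tMin (Mul (C 2) tQ) (Sub
         (Add (Mul (C 2) (tDig (V 4) (V 3))) (tSum 11 l)) (Add tQ (tSum 12 l))))"

lemma tUpdate:
  assumes H: "holds_upto a \<alpha>" "12 < a" and r: "\<rho> 3 < m" and z: "\<rho> 5 < 2 ^ d" and l: "\<rho> 2 < (n + 1) * W"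
    and s': "\<rho> 4 < W"
  defines "t \<equiv> tUpdate (Div (V 2) tW) (tMod (V 2) tW)"
  shows "tev \<alpha> \<rho> t = of_bool (dp.dig (\<rho> 2 mod W) (\<rho> 3) =
      min (2 * q) (2 * dp.dig (\<rho> 4) (\<rho> 3) + (\<Sum>i<q. posC n E (\<rho> 3) i * dp.bit_at (\<rho> 2 div W) (\<rho> 5) i)
       - (q + (\<Sum>i<q. negC n E (\<rho> 3) i * dp.bit_at (\<rho> 2 div W) (\<rho> 5) i))))"
    and "ok M \<alpha> \<rho> t"
proof -
  have a: "10 < a" "3 < a" using H(2) by auto
  have le: "\<rho> 2 \<le> M" "\<rho> 2 mod W \<le> M" "\<rho> 4 \<le> M"
    using l nW_le s' W_le mod_less_divisor[OF W_pos, of "\<rho> 2"] by linarith+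
  show "tev \<alpha> \<rho> t = of_bool (dp.dig (\<rho> 2 mod W) (\<rho> 3) =
      min (2 * q) (2 * dp.dig (\<rho> 4) (\<rho> 3) + (\<Sum>i<q. posC n E (\<rho> 3) i * dp.bit_at (\<rho> 2 div W) (\<rho> 5) i)
       - (q + (\<Sum>i<q. negC n E (\<rho> 3) i * dp.bit_at (\<rho> 2 div W) (\<rho> 5) i))))"
    using r by (simp add: t_def tUpdate_def tev_tDig[OF H(1) a(1)] tev_tW[OF H(1) a(1)]
        tSum[OF H r z l] tev_tQ[OF H(1) a(2)])
  show "ok M \<alpha> \<rho> t"
    using r le W_pos M_const by (simp add: t_def tUpdate_def ok_tDig[OF H(1) a(1)] tev_tW[OF H(1) a(1)]
        tSum[OF H r z l] tev_tQ[OF H(1) a(2)])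
qed

lemma step_Tab: "step_ok 13 fillTab"
proof (rule step_okI)
  show "len 13 \<le> M" using nW_le by (simp add: len_def)
  fix \<alpha> and \<rho> :: "nat \<Rightarrow> nat" assume H: "holds_upto 13 \<alpha>"
  show "ok M \<alpha> \<rho> (fst fillTab) \<and> tev \<alpha> \<rho> (fst fillTab) = len 13"
    using n_le by (simp add: fillTab_def Let_def tev_tN[OF H] tev_tW[OF H] len_def)
  assume "\<rho> 2 < len 13" and prev: "\<And>j. j < \<rho> 2 \<Longrightarrow> \<alpha> 13 j = val 13 j"
  then have i: "\<rho> 2 < (n + 1) * W" by (simp add: len_def)
  define l s where "l = \<rho> 2 div W" and "s = \<rho> 2 mod W"
  have i_eq: "\<rho> 2 = l * W + s" unfolding l_def s_def by (rule div_mult_mod_eq[symmetric])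
  have sW: "s < W" using W_pos by (simp add: s_def)
  have ln: "l \<le> n" using less_mult_imp_div_less[OF i] by (simp add: l_def)
  have le: "\<rho> 2 \<le> M" "s \<le> M" "l \<le> M" using i nW_le sW W_le ln n_le by linarith+
  have Hs: "holds_upto 13 \<alpha>" "12 < (13::nat)" using H by simp_all
  define tU where "tU = tUpdate (Div (V 2) tW) (tMod (V 2) tW)"
  have upd: "tev \<alpha> (\<rho>(4 := s', 5 := z, 3 := r)) tU = of_bool (dp.dig s r =
      min (2 * q) (2 * dp.dig s' r + (\<Sum>i<q. posC n E r i * dp.bit_at l z i)
       - (q + (\<Sum>i<q. negC n E r i * dp.bit_at l z i))))"
    "ok M \<alpha> (\<rho>(4 := s', 5 := z, 3 := r)) tU"
    if "s' < W" "z < 2 ^ d" "r < m" for s' z r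
    using tUpdate[OF Hs, of "\<rho>(4 := s', 5 := z, 3 := r)"] that i
    unfolding tU_def l_def s_def by simp_all
  have dig0: "tev \<alpha> (\<rho>(3 := r)) (tDig (tMod (V 2) tW) (V 3)) = dp.dig s r"
    "ok M \<alpha> (\<rho>(3 := r)) (tDig (tMod (V 2) tW) (V 3))" if "r < m" for r
    using that le W_pos unfolding s_def
    by (simp_all add: tev_tDig[OF H] ok_tDig[OF H] tev_tW[OF H])
  define tP where "tP = tTab (Sub (Div (V 2) tW) (C 1)) (V 4)"
  have tab: "tev \<alpha> (\<rho>(4 := s')) tP = of_bool (dp.tab (l - 1) s')"
    if "s' < W" "0 < l" for s'
  proof -
    obtain l' where l': "l = Suc l'" using \<open>0 < l\<close> gr0_conv_Suc by auto
    \<comment> \<open>The previous prefix length occupies the preceding block of \<open>W\<close>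
      entries, which is already filled.\<close>
    have "l' * W + s' < \<rho> 2" using that(1) unfolding i_eq l' by simp
    from prev[OF this] have "\<alpha> 13 (l' * W + s') = of_bool (dp.tab l' s')"
      using that(1) by (simp add: val_def)
    then show ?thesis by (simp add: tP_def tTab_def tev_tW[OF H] l_def[symmetric] l')
  qed
  \<comment> \<open>Conjunctions are evaluated in full, so this lookup happens for
    \<open>l = 0\<close> too, where its value is masked; its loop bounds must hold there as
    well.\<close>
  have ok_tab: "ok M \<alpha> (\<rho>(4 := s')) tP" for s'
    using le W_pos by (simp add: tP_def tTab_def tev_tW[OF H] l_def[symmetric])
  have D: "\<alpha> 9 d = 2 ^ d" using tev_pow9[OF H, of d] d_le by simp
  have ok: "ok M \<alpha> \<rho> (snd fillTab)"
    unfolding fillTab_def Let_def tSum_def[symmetric] tUpdate_def[symmetric] tU_def[symmetric] tP_def[symmetric]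
    using le W_pos W_le m_le pow_le
    by (simp add: tev_tW[OF H] tev_tRows[OF H] tev_tD[OF H] ok_tab dig0 upd D)
  have "tev \<alpha> \<rho> (snd fillTab) = of_bool (l = 0 \<and> (\<forall>r<m. dp.dig s r = q) \<or>
      0 < l \<and> (\<exists>s'<W. dp.tab (l - 1) s' \<and> (\<exists>z<2 ^ d. \<forall>r<m. dp.dig s r =
      min (2 * q) (2 * dp.dig s' r + (\<Sum>i<q. posC n E r i * dp.bit_at l z i)
       - (q + (\<Sum>i<q. negC n E r i * dp.bit_at l z i))))))"
    unfolding fillTab_def Let_def tSum_def[symmetric] tUpdate_def[symmetric] tU_def[symmetric] tP_def[symmetric]
    by (simp add: tev_tW[OF H] tev_tRows[OF H] tev_tD[OF H] tev_tQ[OF H] tab dig0 upd D l_def[symmetric]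
        cong: conj_cong)
  also have "\<dots> = of_bool (dp.tab l s)"
    by (cases l) (simp_all add: W_def base_def)
  finally show "ok M \<alpha> \<rho> (snd fillTab) \<and> tev \<alpha> \<rho> (snd fillTab) = val 13 (\<rho> 2)"
    using ok by (simp add: val_def l_def s_def)
qed

definition accepted where
  "accepted \<longleftrightarrow> (\<exists>s<W. dp.tab n s \<and> accepts d q (\<lambda>j. rel n E 1 j j) (dp.dig s))"

lemma tAnswer:
  assumes H: "holds_upto 14 \<alpha>"
  shows "ok M \<alpha> \<rho> tAnswer \<and> tev \<alpha> \<rho> tAnswer = of_bool accepted"
proof -
  define tf where "tf c = tDig (V 2) (Add (Mul (C 6) (V 3)) (C c))" for c
  have f: "tev \<alpha> (\<rho>(2 := s, 3 := j)) (tf c) = dp.dig s (6 * j + c)"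
    "ok M \<alpha> (\<rho>(2 := s, 3 := j)) (tf c)" if "s < W" "j < d" "c < 6" for s j c
    using that W_le M_const by (simp_all add: tf_def tev_tDig[OF H] ok_tDig[OF H] m_def)
  have R: "tev \<alpha> (\<rho>(2 := s, 3 := j)) (tRel 6 (V 3) (V 3)) = of_bool (rel n E 1 j j)"
    "ok M \<alpha> (\<rho>(2 := s, 3 := j)) (tRel 6 (V 3) (V 3))" if "j < d" for s j
    using that d_le_M by (simp_all add: tev_tRel[OF H] ok_tRel)
  have T: "tev \<alpha> (\<rho>(2 := s)) (tTab tN (V 2)) = of_bool (dp.tab n s)"
    "ok M \<alpha> (\<rho>(2 := s)) (tTab tN (V 2))" if "s < W" for s
  proof -
    have "\<alpha> 13 (n * W + s) = val 13 (n * W + s)"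
      using lookup[OF H, of 13 "n * W + s"] that by (simp add: len_def)
    then show "tev \<alpha> (\<rho>(2 := s)) (tTab tN (V 2)) = of_bool (dp.tab n s)"
      using that by (simp add: tTab_def tev_tN[OF H] tev_tW[OF H] val_def)
    show "ok M \<alpha> (\<rho>(2 := s)) (tTab tN (V 2))"
      using n_le by (simp add: tTab_def tev_tN[OF H])
  qed
  define tX where "tX = bAnd (bLe (tf 0) tQ) (bAnd (bLe (tf 4) tQ) (bAnd (bLess tQ (tf 5))
       (bOr (bNot (bAnd (bLess (tf 0) tQ) (bLess tQ (tf 3))))
         (bAnd (bLe tQ (tf 1)) (bLess tQ (Add (tf 2) (tRel 6 (V 3) (V 3))))))))"
  have tA: "tAnswer = bEx 2 tW (bAnd (tTab tN (V 2)) (bAnd (bLess (C 0) tD) (bAll 3 tD tX)))"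
    unfolding tAnswer_def Let_def tf_def[symmetric] tX_def ..
  have num: "(0::nat) < 6" "(1::nat) < 6" "(2::nat) < 6" "(3::nat) < 6" "(4::nat) < 6" "(5::nat) < 6"
    "(3::nat) < 14" by simp_all
  define Z where "Z s j \<longleftrightarrow> dp.dig s (6 * j) \<le> q \<and> dp.dig s (6 * j + 4) \<le> q \<and> q < dp.dig s (6 * j + 5) \<and>
     (dp.dig s (6 * j) < q \<and> q < dp.dig s (6 * j + 3) \<longrightarrow>
       q \<le> dp.dig s (6 * j + 1) \<and> q < dp.dig s (6 * j + 2) + of_bool (rel n E 1 j j))" for s j
  have eq: "tev \<alpha> (\<rho>(2 := s, 3 := j)) tX
     = of_bool (Z s j)"
    if "s < W" "j < d" for s j
    unfolding tX_def Z_def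
    by (simp only: tev_bAnd tev_bOr tev_bNot tev_bLe tev_bLess tev.simps R(1)[OF that(2)]
        f(1)[OF that, of 0] f(1)[OF that, of 1] f(1)[OF that, of 2] f(1)[OF that, of 3]
        f(1)[OF that, of 4] f(1)[OF that, of 5] tev_tQ[OF H] num of_bool_eq_0_iff add_0_right)
      (rule arg_cong[where f = of_bool], blast)
  have okX: "ok M \<alpha> (\<rho>(2 := s, 3 := j)) tX" if "s < W" "j < d" for s j
    unfolding tX_def using f(2)[OF that] R(2)[OF that(2)] by simp
  have ok: "ok M \<alpha> \<rho> tAnswer"
    unfolding tA using W_le d_le_M by (simp add: tev_tW[OF H] tev_tD[OF H] okX T)
  have "tev \<alpha> \<rho> tAnswer = of_bool accepted"
    unfolding tA accepted_def accepts_def Z_def[symmetric]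
    by (simp add: tev_tW[OF H] tev_tD[OF H] eq T cong: conj_cong)
  then show ?thesis using ok by simp
qed

end

section \<open>The six rows of a class and the acceptance test\<close>

lemma sum_lessThan_add: "(\<Sum>i<a + b. f i) = (\<Sum>i<a. f i) + (\<Sum>i<(b::nat). f (a + i) :: nat)"
  by (induction b) (simp_all add: add.assoc)

text \<open>Truncation keeps signs once \<open>B\<close> is at least 1. In the last item the offset
  is added after truncation; for integers it merely turns \<open>0 < v\<close> into
  \<open>0 \<le> v\<close>, which truncation preserves too.\<close>

lemma sat_simps:
  assumes "1 \<le> B"
  shows "sat B v \<le> B \<longleftrightarrow> v \<le> 0" "sat B v < B \<longleftrightarrow> v < 0" "B < sat B v \<longleftrightarrow> 0 < v" "B \<le> sat B v \<longleftrightarrow> 0 \<le> v"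
    "B < sat B v + of_bool b \<longleftrightarrow> 0 < v + of_bool b"
  using assms by (auto simp: sat_def)

context oa_run
begin

lemma sum_q: "(\<Sum>i<q. f i) = (\<Sum>i<d. f i) + (\<Sum>i<d. f (d + i)) + (f (2 * d) :: nat)"
proof -
  have "q = Suc (d + d)" by (simp add: q_def)
  then show ?thesis by (simp add: sum_lessThan_add mult_2)
qed

lemma row_div_mod: "c < 6 \<Longrightarrow> (6 * j + c) div 6 = j" "c < 6 \<Longrightarrow> (6 * j + c) mod 6 = (c::nat)"
  by simp_all

lemma sum_delta: "j < d \<Longrightarrow> (\<Sum>i<d. of_bool (i = j) * X i) = (X j :: nat)"
  by (simp add: sum.delta' of_bool_def if_distrib[of "\<lambda>x. x * _"] cong: if_cong)

lemma posC_row: "c < 6 \<Longrightarrow> posC n E (6 * j + c) i =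
     of_bool (i < d \<and> (c = 0 \<and> i = j \<or> (c = 1 \<or> c = 2 \<or> c = 3) \<and> rel n E 2 i j \<or> 4 \<le> c)) +
     of_bool (i < d \<and> (c = 2 \<or> c = 3) \<and> rel n E 1 i j)"
  unfolding posC_def Let_def by (simp only: row_div_mod)

lemma negC_row: "c < 6 \<Longrightarrow> negC n E (6 * j + c) i =
     of_bool (c = 0 \<and> i = d + j \<or> c = 1 \<and> i < d \<and> rel n E 1 i j \<or>
       c = 2 \<and> d \<le> i \<and> i < 2 * d \<and> rel n E 1 (i - d) j \<or> c = 4 \<and> i = 2 * d)"
  unfolding negC_def Let_def by (simp only: row_div_mod)

lemma row_sums:
  assumes "c < 6"
  shows "(\<Sum>i<q. posC n E (6 * j + c) i * X i) = (\<Sum>i<d.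
      (of_bool (c = 0 \<and> i = j \<or> (c = 1 \<or> c = 2 \<or> c = 3) \<and> rel n E 2 i j \<or> 4 \<le> c) +
       of_bool ((c = 2 \<or> c = 3) \<and> rel n E 1 i j)) * X i)"
    and "(\<Sum>i<q. negC n E (6 * j + c) i * X i) =
      (\<Sum>i<d. of_bool (c = 1 \<and> rel n E 1 i j) * X i) +
      (\<Sum>i<d. of_bool (c = 0 \<and> i = j \<or> c = 2 \<and> rel n E 1 i j) * X (d + i)) +
      of_bool (c = 0 \<and> d = j \<or> c = 4) * X (2 * d)"
proof -
  have "(\<Sum>i<d. posC n E (6 * j + c) i * X i) = (\<Sum>i<d.
      (of_bool (c = 0 \<and> i = j \<or> (c = 1 \<or> c = 2 \<or> c = 3) \<and> rel n E 2 i j \<or> 4 \<le> c) +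
       of_bool ((c = 2 \<or> c = 3) \<and> rel n E 1 i j)) * X i)"
    by (rule sum.cong[OF refl]) (simp add: posC_row[OF assms])
  moreover have "posC n E (6 * j + c) (d + i) = 0" "posC n E (6 * j + c) (2 * d) = 0" for i
    by (simp_all add: posC_row[OF assms])
  ultimately show "(\<Sum>i<q. posC n E (6 * j + c) i * X i) = (\<Sum>i<d.
      (of_bool (c = 0 \<and> i = j \<or> (c = 1 \<or> c = 2 \<or> c = 3) \<and> rel n E 2 i j \<or> 4 \<le> c) +
       of_bool ((c = 2 \<or> c = 3) \<and> rel n E 1 i j)) * X i)"
    unfolding sum_q by simp
  have 1: "(\<Sum>i<d. negC n E (6 * j + c) i * X i) = (\<Sum>i<d. of_bool (c = 1 \<and> rel n E 1 i j) * X i)"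
    by (rule sum.cong[OF refl]) (auto simp: negC_row[OF assms])
  have 2: "(\<Sum>i<d. negC n E (6 * j + c) (d + i) * X (d + i)) =
      (\<Sum>i<d. of_bool (c = 0 \<and> i = j \<or> c = 2 \<and> rel n E 1 i j) * X (d + i))"
    by (rule sum.cong[OF refl]) (auto simp: negC_row[OF assms])
  \<comment> \<open>Column \<open>2 * d\<close> coincides with column \<open>d + j\<close> for
    \<open>j = d\<close>; the later assumption \<open>j < d\<close> excludes this case.\<close>
  have 3: "negC n E (6 * j + c) (2 * d) = of_bool (c = 0 \<and> d = j \<or> c = 4)"
    by (simp add: negC_row[OF assms])
  show "(\<Sum>i<q. negC n E (6 * j + c) i * X i) =
      (\<Sum>i<d. of_bool (c = 1 \<and> rel n E 1 i j) * X i) +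
      (\<Sum>i<d. of_bool (c = 0 \<and> i = j \<or> c = 2 \<and> rel n E 1 i j) * X (d + i)) +
      of_bool (c = 0 \<and> d = j \<or> c = 4) * X (2 * d)"
    unfolding sum_q 1 2 3 ..
qed

text \<open>The signs of the six forms decide, in this order: how far class \<open>j\<close> is used
  up, the first degree inequality, the second one up to its offset, adjacency to the set, the
  budget, and nonemptiness.\<close>

lemma row_values:
  assumes j: "j < d"
  shows "dp.row X (6 * j) = int (X j) - int (X (d + j))"
    and "dp.row X (6 * j + 1) = int (\<Sum>i<d. of_bool (rel n E 2 i j) * X i) - int (\<Sum>i<d. of_bool (rel n E 1 i j) * X i)"
    and "dp.row X (6 * j + 2) = int ((\<Sum>i<d. of_bool (rel n E 2 i j) * X i) + (\<Sum>i<d. of_bool (rel n E 1 i j) * X i))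
      - int (\<Sum>i<d. of_bool (rel n E 1 i j) * X (d + i))"
    and "dp.row X (6 * j + 3) = int ((\<Sum>i<d. of_bool (rel n E 2 i j) * X i) + (\<Sum>i<d. of_bool (rel n E 1 i j) * X i))"
    and "dp.row X (6 * j + 4) = int (\<Sum>i<d. X i) - int (X (2 * d))"
    and "dp.row X (6 * j + 5) = int (\<Sum>i<d. X i)"
proof -
  have lt: "(0::nat) < 6" "(1::nat) < 6" "(2::nat) < 6" "(3::nat) < 6" "(4::nat) < 6" "(5::nat) < 6"
    by simp_all
  show "dp.row X (6 * j) = int (X j) - int (X (d + j))"
    unfolding dp.row_def row_sums[OF lt(1), of j X, unfolded add_0_right]
    using j by (simp add: sum_delta[where X = X] sum_delta[where X = "\<lambda>i. X (d + i)"] del: sum_of_bool_mult_eq)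
  show "dp.row X (6 * j + 1) = int (\<Sum>i<d. of_bool (rel n E 2 i j) * X i) - int (\<Sum>i<d. of_bool (rel n E 1 i j) * X i)"
    unfolding dp.row_def row_sums[OF lt(2)] by simp
  show "dp.row X (6 * j + 2) = int ((\<Sum>i<d. of_bool (rel n E 2 i j) * X i) + (\<Sum>i<d. of_bool (rel n E 1 i j) * X i))
      - int (\<Sum>i<d. of_bool (rel n E 1 i j) * X (d + i))"
    unfolding dp.row_def row_sums[OF lt(3)] by (simp add: sum.distrib distrib_right)
  show "dp.row X (6 * j + 3) = int ((\<Sum>i<d. of_bool (rel n E 2 i j) * X i) + (\<Sum>i<d. of_bool (rel n E 1 i j) * X i))"
    unfolding dp.row_def row_sums[OF lt(4)] by (simp add: sum.distrib distrib_right)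
  show "dp.row X (6 * j + 4) = int (\<Sum>i<d. X i) - int (X (2 * d))"
    unfolding dp.row_def row_sums[OF lt(5)] by simp
  show "dp.row X (6 * j + 5) = int (\<Sum>i<d. X i)"
    unfolding dp.row_def row_sums[OF lt(6)] by simp
qed

lemma sum_csize: "(\<Sum>i<d. csize n E i) = n"
  using card_split[of "{..<n}"] by (simp add: csize_card)

lemma accepts_iff:
  assumes X: "\<And>i. d \<le> i \<Longrightarrow> i < q \<Longrightarrow> X i = Y i"
  shows "accepts d q (\<lambda>j. rel n E 1 j j) (\<lambda>r. sat q (dp.row X r)) \<longleftrightarrow>
    good n E X \<and> 1 \<le> (\<Sum>i<d. X i) \<and> (\<Sum>i<d. X i) \<le> k"
proof -
  have Xn: "X (d + j) = csize n E j" if "j < d" for j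
    using X[of "d + j"] that by (simp add: q_def Y_def)
  have Xk: "X (2 * d) = min n k"
    using X[of "2 * d"] by (simp add: q_def Y_def)
  have q1: "1 \<le> q" by (simp add: q_def)
  define S1 S2 Cn where "S1 j = (\<Sum>i<d. of_bool (rel n E 1 i j) * X i)"
    and "S2 j = (\<Sum>i<d. of_bool (rel n E 2 i j) * X i)"
    and "Cn j = (\<Sum>i<d. of_bool (rel n E 1 i j) * csize n E i)" for j
  have Cn: "(\<Sum>i<d. of_bool (rel n E 1 i j) * X (d + i)) = Cn j" for j
    unfolding Cn_def by (rule sum.cong) (auto simp: Xn)
  define G where "G j \<longleftrightarrow> X j \<le> csize n E j \<and>
     (X j < csize n E j \<and> 0 < S1 j + S2 j \<longrightarrow> S1 j \<le> S2 j \<and> Cn j < S2 j + S1 j + of_bool (rel n E 1 j j))" for j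
  \<comment> \<open>All sign tests of one class, stated for arbitrary numbers so that only linear
    arithmetic is left.\<close>
  have "int x - int y \<le> 0 \<and> int t - int l \<le> 0 \<and> 0 < int t \<and>
      (int x - int y < 0 \<and> 0 < int (b + a) \<longrightarrow> 0 \<le> int b - int a \<and> 0 < int (b + a) - int c + of_bool p)
    \<longleftrightarrow> (x \<le> y \<and> (x < y \<and> 0 < a + b \<longrightarrow> a \<le> b \<and> c < b + a + of_bool p)) \<and> 0 < t \<and> t \<le> l"
    for x y t l a b c :: nat and p
    by (cases p) auto
  then have *: "(sat q (dp.row X (6 * j)) \<le> q \<and> sat q (dp.row X (6 * j + 4)) \<le> q \<and> q < sat q (dp.row X (6 * j + 5)) \<and>
     (sat q (dp.row X (6 * j)) < q \<and> q < sat q (dp.row X (6 * j + 3)) \<longrightarrow> q \<le> sat q (dp.row X (6 * j + 1)) \<and>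
      q < sat q (dp.row X (6 * j + 2)) + of_bool (rel n E 1 j j))) \<longleftrightarrow>
      G j \<and> 0 < (\<Sum>i<d. X i) \<and> (\<Sum>i<d. X i) \<le> min n k" if "j < d" for j
    unfolding sat_simps[OF q1] row_values[OF that] Xn[OF that] Xk Cn G_def
      S1_def[symmetric] S2_def[symmetric] .
  have "accepts d q (\<lambda>j. rel n E 1 j j) (\<lambda>r. sat q (dp.row X r)) \<longleftrightarrow>
     0 < d \<and> (\<forall>j<d. G j \<and> 0 < (\<Sum>i<d. X i) \<and> (\<Sum>i<d. X i) \<le> min n k)"
    unfolding accepts_def by (intro arg_cong2[where f = "(\<and>)"] refl all_cong *)
  \<comment> \<open>The tests on the total are the same for every class and leave the quantifier;
    without classes the total is 0 and both sides fail.\<close>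
  also have "\<dots> \<longleftrightarrow> (\<forall>j<d. G j) \<and> 1 \<le> (\<Sum>i<d. X i) \<and> (\<Sum>i<d. X i) \<le> min n k"
    by (cases "d = 0") auto
  \<comment> \<open>The class sizes add up to \<open>n\<close>, so the total of a feasible vector
    never exceeds \<open>n\<close> and the cut of the budget is invisible.\<close>
  also have "\<dots> \<longleftrightarrow> (\<forall>j<d. G j) \<and> 1 \<le> (\<Sum>i<d. X i) \<and> (\<Sum>i<d. X i) \<le> k"
  proof -
    have "(\<Sum>i<d. X i) \<le> n" if "\<forall>j<d. G j"
      using sum_mono[of "{..<d}" X "csize n E"] that sum_csize by (simp add: G_def)
    then show ?thesis by auto
  qed
  finally show ?thesis unfolding good_def G_def S1_def S2_def Cn_def .
qed

lemma accepted_iff: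
  "accepted \<longleftrightarrow> (\<exists>x. good n E x \<and> 1 \<le> (\<Sum>i<d. x i) \<and> (\<Sum>i<d. x i) \<le> k)"
proof -
  \<comment> \<open>Acceptance reads rows \<open>6 * j + c\<close> with \<open>j < d\<close> and
    \<open>c < 6\<close>, all of them below \<open>m\<close>.\<close>
  have acc: "accepts d q p f \<longleftrightarrow> accepts d q p g" if "\<And>r. r < m \<Longrightarrow> f r = g r" for f g p
    using that unfolding accepts_def m_def by simp
  have tab: "dp.tab n s \<longleftrightarrow> (\<exists>X. dp.prefix_at n X \<and> (\<forall>r<m. dp.dig s r = sat q (dp.row X r)))" for s
    by (rule dp.tab_iff) simp
  show ?thesis
  proof
    assume accepted
    then obtain s X where X: "dp.prefix_at n X" "\<And>r. r < m \<Longrightarrow> dp.dig s r = sat q (dp.row X r)"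
      and a: "accepts d q (\<lambda>j. rel n E 1 j j) (dp.dig s)"
      unfolding accepted_def tab by blast
    have "accepts d q (\<lambda>j. rel n E 1 j j) (\<lambda>r. sat q (dp.row X r))"
      using a acc[of "dp.dig s" "\<lambda>r. sat q (dp.row X r)"] X(2) by blast
    then show "\<exists>x. good n E x \<and> 1 \<le> (\<Sum>i<d. x i) \<and> (\<Sum>i<d. x i) \<le> k"
      using accepts_iff[of X] X(1) by (auto simp: dp.prefix_at_def)
  next
    assume "\<exists>x. good n E x \<and> 1 \<le> (\<Sum>i<d. x i) \<and> (\<Sum>i<d. x i) \<le> k"
    then obtain x where x: "good n E x" "1 \<le> (\<Sum>i<d. x i)" "(\<Sum>i<d. x i) \<le> k" by blast
    define X where "X i = (if i < d then x i else Y i)" for i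
    have "good n E X" using good_cong[of X x] x(1) by (simp add: X_def)
    moreover have "(\<Sum>i<d. X i) = (\<Sum>i<d. x i)" by (simp add: X_def)
    ultimately have a: "accepts d q (\<lambda>j. rel n E 1 j j) (\<lambda>r. sat q (dp.row X r))"
      using accepts_iff[of X] x by (simp add: X_def)
    have "x i < 2 ^ n" if "i < d" for i
    proof -
      have "x i \<le> csize n E i" using x(1) that by (simp add: good_def)
      then show ?thesis using csize_le[of i] less_exp[of n] by linarith
    qed
    then have pre: "dp.prefix_at n X" by (simp add: dp.prefix_at_def X_def)
    have "sat q v < base" for v using sat_le[of q v] by (simp add: base_def)
    then obtain s where s: "s < W" "\<And>r. r < m \<Longrightarrow> dp.dig s r = sat q (dp.row X r)"
      using ex_digits[of m "\<lambda>r. sat q (dp.row X r)" base] unfolding W_def dp.dig_def base_def by blast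
    moreover have "dp.tab n s" unfolding tab using pre s(2) by blast
    ultimately show accepted unfolding accepted_def using a acc[of "dp.dig s" "\<lambda>r. sat q (dp.row X r)"] by blast
  qed
qed

end

section \<open>Running time\<close>

lemma nth_concat_rows:
  assumes "\<And>xs. xs \<in> set xss \<Longrightarrow> length xs = n" "u < length xss" "v < n"
  shows "concat xss ! (u * n + v) = xss ! u ! v"
  using assms
proof (induction xss arbitrary: u)
  case (Cons xs xss)
  then show ?case by (cases u) (auto simp: nth_append add.assoc)
qed simp

lemma length_concat_rows: "(\<And>xs. xs \<in> set xss \<Longrightarrow> length xs = n) \<Longrightarrow> length (concat xss) = length xss * n"
  by (induction xss) auto

lemma length_le_input_size: "length w \<le> input_size w"
  unfolding input_size_def by (induction w) auto

section \<open>A computable bound for the dependence on the parameter\<close>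

lemma computable_double_exp: "computable (\<lambda>x. 2 ^ 2 ^ (x + e))"
proof -
  let ?x = "A 0 (C 0)"
  let ?y = "A 2 (Add ?x (C e))"
  \<comment> \<open>The last entry of the first array of powers, \<open>2 ^ (x + e)\<close>, is the
    last index of the second. Computability imposes no time limit, so \<open>M\<close> may be as
    large as the arrays.\<close>
  let ?p = "fills 2 [fillPow 2 (Add ?x (C (e + 1))) (C 2), fillPow 3 (Add ?y (C 1)) (C 2)] (A 3 ?y)"
  have "\<exists>t s. exec ?p (init_state [x]) t s \<and> result s = 2 ^ 2 ^ (x + e)" for x
  proof -
    define val where "val a i = (if a = 0 then x else (2::nat) ^ i)" for a i :: nat
    define len where "len a = (if a = 0 then 1 else if a = 2 then x + (e + 1) else 2 ^ (x + e) + 1)" for a :: nat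
    define M where "M = 2 + len 2 + len 3"
    interpret tables M val len .
    have X: "tev \<alpha> \<rho> ?x = x" if "holds_upto a \<alpha>" for a \<alpha> \<rho>
      using lookup[OF that, of 0 0] by (simp add: val_def len_def)
    have Y: "tev \<alpha> \<rho> ?y = 2 ^ (x + e)" if "holds_upto a \<alpha>" "2 < a" for a \<alpha> \<rho>
      using lookup[OF that(1), of 2 "x + e"] X[OF that(1)] that(2) by (simp add: val_def len_def)
    have init: "holds_upto 2 (arrs (init_state [x]))"
      by (auto simp: holds_upto_def init_state_def val_def len_def)
    have "step_ok 2 (fillPow 2 (Add ?x (C (e + 1))) (C 2))"
      by (rule step_Pow[of _ 2]) (use X in \<open>auto simp: M_def val_def len_def\<close>)
    moreover have "step_ok 3 (fillPow 3 (Add ?y (C 1)) (C 2))"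
      by (rule step_Pow[of _ 2]) (use Y in \<open>auto simp: M_def val_def len_def\<close>)
    moreover have "ok M \<alpha> \<rho> (A 3 ?y) \<and> tev \<alpha> \<rho> (A 3 ?y) = 2 ^ 2 ^ (x + e)"
      if "holds_upto 4 \<alpha>" for \<alpha> \<rho>
      using lookup[OF that, of 3 "2 ^ (x + e)"] Y[OF that, of \<rho>] by (simp add: val_def len_def)
    ultimately show ?thesis
      using run_fills[OF init, of "[fillPow 2 (Add ?x (C (e + 1))) (C 2), fillPow 3 (Add ?y (C 1)) (C 2)]" "A 3 ?y"]
      unfolding run_def by fastforce
  qed
  then show ?thesis unfolding computable_def by blast
qed

definition oa_steps :: "(tm \<times> tm) list" where
  "oa_steps = [fillLeader, fillD, fillCls, fillSize, fillRel 1, fillRel 2, fillY,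
     fillPow 9 (Add (Mul (C 2) tN) (C 1)) (C 2), fillPow 10 (Add tRows (C 1)) tBase,
     fillPos, fillNeg, fillTab]"

text \<open>What remains of \<open>M\<close> after extracting a factor \<open>n + 1\<close>:
  \<open>4 * d + 3\<close> is the base \<open>2 * q + 1\<close>, and 12 arises from
  \<open>2 * n + 10 \<le> 12 * (n + 1)\<close>.\<close>

definition growth :: "nat \<Rightarrow> nat" where
  "growth d = (4 * d + 3) ^ (6 * d) + 2 ^ d + 6 * d * (2 * d + 1) + d * d + 2 * (2 * d + 1) + 6 * d + 12"

context oa_run
begin

lemma run_oa_prog:
  assumes "holds_upto 2 (arrs s)"
  shows "run (fills 2 oa_steps tAnswer) s (fills_cost oa_steps tAnswer M) (\<lambda>s'. result s' = of_bool accepted)"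
proof (rule run_fills[OF assms order_refl])
  show "steps_ok 2 oa_steps"
    using step_Leader step_D step_Cls step_Size step_Rel[of 6 1] step_Rel[of 7 2] step_Y step_Pow2
      step_PowB step_Pos step_Neg step_Tab
    unfolding oa_steps_def by (simp add: eval_nat_numeral)
next
  fix \<alpha> \<rho> assume "holds_upto (2 + length oa_steps) \<alpha>"
  then have "holds_upto 14 \<alpha>" by (simp add: oa_steps_def eval_nat_numeral)
  then show "ok M \<alpha> \<rho> tAnswer \<and> tev \<alpha> \<rho> tAnswer = of_bool accepted" by (rule tAnswer)
qed

lemma M_le_growth: "n + 1 \<le> N \<Longrightarrow> M \<le> growth d * N"
proof -
  assume N: "n + 1 \<le> N"
  have "M \<le> (n + 1) * (W + 2 ^ d + m * q + d * d + 2 * q + m + 12)"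
    unfolding M_def by (simp add: algebra_simps)
  also have "W + 2 ^ d + m * q + d * d + 2 * q + m + 12 = growth d"
  proof -
    have b: "2 * (2 * d + 1) + 1 = 4 * d + 3" by simp
    show ?thesis unfolding growth_def W_def base_def q_def m_def b ..
  qed
  also have "(n + 1) * growth d \<le> N * growth d" using N by (rule mult_right_mono) simp
  also have "\<dots> = growth d * N" by (rule mult.commute)
  finally show ?thesis .
qed

end

text \<open>From \<open>4 * d + 3 \<le> 4 * 2 ^ d\<close> the leading power is at most
  \<open>2 ^ (6 * d * (d + 2))\<close>, and the rest is at most \<open>2 ^ (2 * d + 5)\<close>. The
  stated exponent is a simple majorant of both combined.\<close>

lemma growth_le: "growth d \<le> 2 ^ (6 * (d + 2)\<^sup>2)"
proof -
  have t: "d + 1 \<le> 2 ^ d" using less_exp[of d] by linarith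
  have "(4 * d + 3) ^ (6 * d) \<le> (2 ^ (d + 2)) ^ (6 * d)"
    using t by (intro power_mono) (simp_all add: power_add)
  also have "\<dots> = 2 ^ ((d + 2) * (6 * d))" by (simp only: power_mult)
  also have "\<dots> \<le> 2 ^ (2 * d + 5 + (d + 2) * (6 * d))" by (rule power_increasing) auto
  finally have 1: "(4 * d + 3) ^ (6 * d) \<le> (2::nat) ^ (2 * d + 5 + (d + 2) * (6 * d))" .
  define R where "R = 6 * d * (2 * d + 1) + d * d + 2 * (2 * d + 1) + 6 * d + 12"
  have gr: "growth d = (4 * d + 3) ^ (6 * d) + (2 ^ d + R)" by (simp only: growth_def R_def add.assoc)
  have "R \<le> 16 * ((d + 1) * (d + 1))"
    by (simp add: R_def algebra_simps)
  also have "\<dots> \<le> 16 * (2 ^ d * 2 ^ d)" using t by (intro mult_left_mono mult_mono) auto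
  finally have "2 ^ d + R \<le> 16 * (2 ^ d * 2 ^ d) + 16 * (2 ^ d * 2 ^ d)" by (intro add_mono) simp_all
  also have "\<dots> = 2 ^ (2 * d + 5)"
  proof -
    have "(2::nat) ^ (2 * d) = 2 ^ d * 2 ^ d" by (simp only: mult_2 power_add)
    then show ?thesis by (simp add: power_add)
  qed
  also have "\<dots> \<le> 2 ^ (2 * d + 5 + (d + 2) * (6 * d))" by (rule power_increasing) auto
  finally have 2: "2 ^ d + R \<le> 2 ^ (2 * d + 5 + (d + 2) * (6 * d))" .
  have "growth d \<le> 2 * 2 ^ (2 * d + 5 + (d + 2) * (6 * d))"
    unfolding gr mult_2[of "2 ^ _"] by (rule add_mono[OF 1 2])
  also have "\<dots> = 2 ^ Suc (2 * d + 5 + (d + 2) * (6 * d))" by (rule power_Suc[symmetric])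
  also have "\<dots> \<le> 2 ^ (6 * (d + 2)\<^sup>2)"
    by (rule power_increasing) (simp_all add: power2_eq_square algebra_simps)
  finally show ?thesis .
qed

lemma square_le_exp: "(d + 2)\<^sup>2 \<le> 2 ^ (d + 3)"
proof (induction d)
  case 0
  show ?case by (simp add: power2_eq_square)
next
  case (Suc d)
  show ?case
  proof (cases d)
    case 0
    then show ?thesis by (simp add: power2_eq_square)
  next
    case d': (Suc d')
    \<comment> \<open>This amounts to \<open>1 \<le> d * d + 2 * d\<close>, which fails at 0; hence
      the separate case.\<close>
    then have "(Suc d + 2)\<^sup>2 \<le> 2 * (d + 2)\<^sup>2" by (simp add: power2_eq_square algebra_simps)
    also have "\<dots> \<le> 2 * 2 ^ (d + 3)" using Suc.IH by (rule mult_left_mono) simp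
    also have "\<dots> = 2 ^ (Suc d + 3)" by (simp only: add_Suc power_Suc)
    finally show ?thesis .
  qed
qed

text \<open>\<open>c\<close> and \<open>e\<close> stand for the constants of a cost polynomial; they
  merely shift the upper exponent. The number 48 is 6 times the 8 in
  \<open>2 ^ (d + 3) = 8 * 2 ^ d\<close>.\<close>

lemma growth_bound: "c * growth d ^ e \<le> 2 ^ 2 ^ (d + (c + 48 * e))"
proof -
  have "c * growth d ^ e \<le> 2 ^ c * (2 ^ (6 * (d + 2)\<^sup>2)) ^ e"
    using less_exp[of c] growth_le by (intro mult_mono power_mono) auto
  also have "\<dots> = 2 ^ (c + 6 * e * (d + 2)\<^sup>2)"
    by (simp add: power_add power_mult[symmetric] mult.commute mult.left_commute)
  also have "\<dots> \<le> 2 ^ 2 ^ (d + (c + 48 * e))"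
  proof (rule power_increasing)
    have "c + 6 * e * (d + 2)\<^sup>2 \<le> c * 2 ^ d + 6 * e * 2 ^ (d + 3)"
      using square_le_exp[of d] by (intro add_mono mult_left_mono) auto
    also have "\<dots> = (c + 48 * e) * 2 ^ d" by (simp add: power_add algebra_simps)
    also have "\<dots> \<le> 2 ^ (c + 48 * e) * 2 ^ d" using less_exp[of "c + 48 * e"] by (intro mult_right_mono) auto
    also have "\<dots> = 2 ^ (d + (c + 48 * e))" by (simp add: power_add)
    finally show "c + 6 * e * (d + 2)\<^sup>2 \<le> 2 ^ (d + (c + 48 * e))" .
  qed simp
  finally show ?thesis .
qed

theorem theorem8:
  shows "fixed_parameter_tractable
    (oa_instances :: ('a sgraph \<times> nat) set) oa_encodings oa_question
    (\<lambda>(G, k). signed_neighborhood_diversity G)"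
proof -
  let ?p = "fills 2 oa_steps tAnswer"
  \<comment> \<open>The program is fixed before any instance, so \<open>c\<close> and
    \<open>e\<close> are absolute constants.\<close>
  obtain c e where ce: "\<And>M. M \<ge> 1 \<Longrightarrow> fills_cost oa_steps tAnswer M \<le> c * M ^ e"
    using poly_bounded_fills_cost unfolding poly_bounded_def by blast
  let ?f = "\<lambda>x. 2 ^ 2 ^ (x + (c + 48 * e)) :: nat"
  have main: "\<exists>t s. exec ?p (init_state w) t s \<and> (result s \<noteq> 0 \<longleftrightarrow> oa_question (G, k)) \<and>
      t \<le> ?f (signed_neighborhood_diversity G) * input_size w ^ e"
    if G: "signed_graph G" and w: "w \<in> oa_encodings (G, k)" for G :: "'a sgraph" and k w
  proof -
    obtain vs where vs: "distinct vs" "set vs = verts G"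
      and w: "w = k # length vs # concat (map (\<lambda>u. map (edge_sign G u) vs) vs)"
      using w by (auto simp: oa_encodings_def)
    interpret enumerated_sgraph G vs using G vs by unfold_locales
    interpret oa_run n E k ..
    let ?rows = "map (\<lambda>u. map (edge_sign G u) vs) vs"
    have len_w: "length w = 2 + n * n"
    proof -
      have "length (concat ?rows) = length ?rows * n" by (rule length_concat_rows) auto
      then show ?thesis unfolding w by simp
    qed
    have "w ! i = val 0 i" if i: "i < 2 + n * n" for i
    proof -
      have "concat ?rows ! j = E (j div n) (j mod n)" if j: "j < n * n" for j
      proof -
        have n: "0 < n" using j by (cases n) auto
        have lt: "j div n < n" "j mod n < n" using less_mult_imp_div_less[OF j] n by simp_all
        have "length xs = n" if "xs \<in> set ?rows" for xs using that by auto
        then have "concat ?rows ! (j div n * n + j mod n) = ?rows ! (j div n) ! (j mod n)"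
          by (rule nth_concat_rows) (simp_all add: lt)
        then show ?thesis using lt by (simp add: E_def)
      qed
      from this[of "i - 2"] show ?thesis
        using i unfolding w by (auto simp: val_def nth_Cons' numeral_2_eq_2)
    qed
    then have "holds_upto 2 (arrs (init_state w))"
      using len_w by (auto simp: holds_upto_def init_state_def len_def)
    from run_oa_prog[OF this] obtain t s where ts: "exec ?p (init_state w) t s"
      "t \<le> fills_cost oa_steps tAnswer M" "result s = of_bool accepted"
      unfolding run_def by blast
    have "oa_question (G, k) \<longleftrightarrow> accepted"
      using question_iff ex_alliance_iff accepted_iff by simp
    moreover have "t \<le> ?f (signed_neighborhood_diversity G) * input_size w ^ e"
    proof -
      \<comment> \<open>The matrix alone contributes \<open>n * n\<close> numbers to the input, so
        the input size exceeds \<open>n\<close>.\<close>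
      have "n \<le> n * n" by (cases n) auto
      then have "n + 1 \<le> input_size w" using length_le_input_size[of w] len_w by linarith
      then have M: "M \<le> growth d * input_size w" by (rule M_le_growth)
      have "t \<le> c * M ^ e" using ts(2) ce[OF M_const(1)] by linarith
      also have "\<dots> \<le> c * (growth d * input_size w) ^ e"
        using M by (intro mult_left_mono power_mono) auto
      also have "\<dots> = c * growth d ^ e * input_size w ^ e" by (simp add: power_mult_distrib)
      also have "\<dots> \<le> ?f d * input_size w ^ e" by (rule mult_right_mono[OF growth_bound]) simp
      \<comment> \<open>The bound is monotone, so the number of computed classes may be replaced by
        the parameter.\<close>
      also have "\<dots> \<le> ?f (signed_neighborhood_diversity G) * input_size w ^ e"
        using ncls_le by (intro mult_right_mono power_increasing) auto
      finally show ?thesis .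
    qed
    ultimately show ?thesis using ts by (intro exI[of _ t] exI[of _ s]) auto
  qed
  show ?thesis
    unfolding fixed_parameter_tractable_def
    by (intro exI[of _ ?p] exI[of _ ?f] exI[of _ e] conjI computable_double_exp)
      (use main in \<open>auto simp: oa_instances_def\<close>)
qed

end
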